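(* Let $X$ be a closed orientable surface of genus at least two equipped with a hyperbolic metric, and let $\mu$ be a filling geodesic current on $X$. Then $\mu$ is non-atomic if and only if its dual pseudometric $d_\mu$ on $\widetilde X$ is strongly bolic.
   Context: $\widetilde X$ is the universal cover of $X$, and $\mathcal G(\widetilde X)$ is the space of unparametrized, unoriented bi-infinite geodesics of $\widetilde X$. A geodesic current on $X$ is a locally finite, positive, $\pi_1(X)$-invariant Borel measure on $\mathcal G(\widetilde X)$; $\mathcal C(X)$ is the space of geodesic currents with the weak$^*$ topology. Closed geodesics are viewed as currents (the sum of Dirac masses on all lifts), and $i:\mathcal C(X)\times\mathcal C(X)\to\mathbb R_{\ge0}$ is Bonahon's intersection form, the continuous symmetric bilinear extension of the geometric intersection number of closed geodesics. $\mu$ is filling if $i(\mu,\nu)>0$ for every nonzero $\nu\in\mathcal C(X)$. $\mu$ is non-atomic if $\mu(\{\gamma\})=0$ for every $\gamma\in\mathcal G(\widetilde X)$. Dual pseudometric: for $x,y\in\widetilde X$, $d_\mu(x,y)=\frac12\mu(G[x,y))+\frac12\mu(G(x,y])$, where for a geodesic segment $I$, $G(I)$ is the set of bi-infinite geodesics of $\widetilde X$ intersecting $I$ transversely. (It is known that $d_\mu$ is Gromov hyperbolic and roughly geodesic.) A roughly geodesic (pseudo)metric space $(M,d)$ is strongly bolic if $d(x,z)+d(y,w)-d(x,w)-d(y,z)\to0$ as $d(x,z)+d(y,w)-d(x,y)-d(z,w)\to\infty$, for four-tuples of points of $M$; i.e. for every $\eta>0$ there is $R>0$ such that for all $x,y,z,w\in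 M$, $d(x,z)+d(y,w)-d(x,y)-d(z,w)>R$ implies $|d(x,z)+d(y,w)-d(x,w)-d(y,z)|<\eta$. *)

theory Defs
  imports "HOL-Analysis.Analysis" "HOL-Algebra.Bij"
begin

text \<open>
  A closed orientable hyperbolic surface is presented as \<open>X = \<Gamma> \<backslash> H\<close>: its universal cover is
  the hyperbolic plane \<open>H\<close> (upper half-plane model) and \<open>\<Gamma>\<close>, its group of deck transformations,
  is identified with the fundamental group of \<open>X\<close>.
\<close>

definition hyp_plane :: "complex set" where
  "hyp_plane = {z. Im z > 0}"

definition hyp_dist :: "complex \<Rightarrow> complex \<Rightarrow> real" where
  "hyp_dist z w = arcosh (1 + (cmod (z - w))\<^sup>2 / (2 * Im z * Im w))"

text \<open>
  The orientation-preserving isometries are the holomorphic ones. Deck transformations are elements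
  of \<open>BijGroup\<close>, hence extensional: they are determined by their values on the hyperbolic plane.
  The third condition says that \<open>\<Gamma>\<close> acts as a covering space action (since the action is
  isometric, the quotient is then Hausdorff) and the fourth that the quotient is compact. By
  Gauss--Bonnet a closed orientable hyperbolic surface always has genus at least two, so no separate
  condition on the genus is needed.
\<close>

definition closed_hyperbolic_surface_group :: "(complex \<Rightarrow> complex) set \<Rightarrow> bool" where
  "closed_hyperbolic_surface_group \<Gamma> \<longleftrightarrow>
     subgroup \<Gamma> (BijGroup hyp_plane) \<and>
     (\<forall>g\<in>\<Gamma>. g holomorphic_on hyp_plane \<and>
        (\<forall>z\<in>hyp_plane. \<forall>w\<in>hyp_plane. hyp_dist (g z) (g w) = hyp_dist z w)) \<and>
     (\<forall>z\<in>hyp_plane. \<exists>U. open U \<and> z \<in> U \<and> U \<subseteq> hyp_plane \<and>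
        (\<forall>g\<in>\<Gamma> - {\<one>\<^bsub>BijGroup hyp_plane\<^esub>}. g ` U \<inter> U = {})) \<and>
     (\<exists>K. compact K \<and> K \<subseteq> hyp_plane \<and> (\<Union>g\<in>\<Gamma>. g ` K) = hyp_plane)"


definition unit_speed_geodesics :: "(real \<Rightarrow> complex) set" where
  "unit_speed_geodesics =
     {c. range c \<subseteq> hyp_plane \<and> (\<forall>s t. hyp_dist (c s) (c t) = \<bar>s - t\<bar>)}"

definition geodesics :: "complex set set" where
  "geodesics = range ` unit_speed_geodesics"

text \<open>
  The quotient topology under \<open>c \<mapsto> range c\<close>, which forgets parametrization and orientation. On
  isometric embeddings the topology of pointwise convergence, used here for parametrized geodesics,
  coincides with the topology of locally uniform convergence.
\<close>

definition geodesic_topology :: "complex set topology" where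
  "geodesic_topology = topology (\<lambda>U. U \<subseteq> geodesics \<and>
     openin (top_of_set unit_speed_geodesics) {c \<in> unit_speed_geodesics. range c \<in> U})"

lemma openin_geodesic_topology:
  "openin geodesic_topology U \<longleftrightarrow> U \<subseteq> geodesics \<and>
     openin (top_of_set unit_speed_geodesics) {c \<in> unit_speed_geodesics. range c \<in> U}"
proof -
  let ?pre = "\<lambda>U. {c \<in> unit_speed_geodesics. range c \<in> U}"
  have "istopology (\<lambda>U. U \<subseteq> geodesics \<and> openin (top_of_set unit_speed_geodesics) (?pre U))"
    unfolding istopology_def
  proof (intro conjI allI impI)
    fix S T
    assume S: "S \<subseteq> geodesics \<and> openin (top_of_set unit_speed_geodesics) (?pre S)"
      and T: "T \<subseteq> geodesics \<and> openin (top_of_set unit_speed_geodesics) (?pre T)"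
    show "S \<inter> T \<subseteq> geodesics" using S by blast
    have "?pre (S \<inter> T) = ?pre S \<inter> ?pre T" by blast
    then show "openin (top_of_set unit_speed_geodesics) (?pre (S \<inter> T))"
      using S T by (simp add: openin_Int)
  next
    fix \<K>
    assume K: "\<forall>S\<in>\<K>. S \<subseteq> geodesics \<and> openin (top_of_set unit_speed_geodesics) (?pre S)"
    show "\<Union>\<K> \<subseteq> geodesics" using K by blast
    have "?pre (\<Union>\<K>) = \<Union>(?pre ` \<K>)" by blast
    moreover have "openin (top_of_set unit_speed_geodesics) (\<Union>(?pre ` \<K>))"
      using K by (intro openin_Union) blast
    ultimately show "openin (top_of_set unit_speed_geodesics) (?pre (\<Union>\<K>))" by simp
  qed
  then show ?thesis
    unfolding geodesic_topology_def by (simp add: topology_inverse')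
qed


definition geodesic_current :: "(complex \<Rightarrow> complex) set \<Rightarrow> complex set measure \<Rightarrow> bool" where
  "geodesic_current \<Gamma> \<mu> \<longleftrightarrow>
     space \<mu> = geodesics \<and>
     sets \<mu> = sigma_sets geodesics {U. openin geodesic_topology U} \<and>
     (\<forall>\<gamma>\<in>geodesics. \<exists>U. openin geodesic_topology U \<and> \<gamma> \<in> U \<and> emeasure \<mu> U < \<infinity>) \<and>
     (\<forall>g\<in>\<Gamma>. \<forall>A\<in>sets \<mu>. emeasure \<mu> ((`) g ` A) = emeasure \<mu> A)"

definition non_atomic :: "complex set measure \<Rightarrow> bool" where
  "non_atomic \<mu> \<longleftrightarrow> (\<forall>\<gamma>\<in>geodesics. emeasure \<mu> {\<gamma>} = 0)"

text \<open>Distinct geodesics of the hyperbolic plane that meet do so transversely, in a single point.\<close>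

definition transverse_pairs :: "(complex set \<times> complex set) set" where
  "transverse_pairs = {(\<gamma>, \<delta>). \<gamma> \<in> geodesics \<and> \<delta> \<in> geodesics \<and> \<gamma> \<noteq> \<delta> \<and> \<gamma> \<inter> \<delta> \<noteq> {}}"

text \<open>
  Bonahon's intersection form: the total mass of the measure that \<open>\<mu> \<otimes> \<nu>\<close> induces on the
  quotient of the space of transverse pairs by the diagonal action of \<open>\<Gamma>\<close>. This action is free and
  properly discontinuous, so the quotient mass is the mass of a Borel fundamental domain, which is
  the largest mass of a Borel set disjoint from all its nontrivial translates. If \<open>\<mu>\<close> and \<open>\<nu>\<close> are
  the counting measures on all lifts of two closed geodesics, this counts the pairs of lifts crossing
  each other, up to \<open>\<Gamma>\<close>, that is, the geometric intersection number.
\<close>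

definition intersection_form ::
  "(complex \<Rightarrow> complex) set \<Rightarrow> complex set measure \<Rightarrow> complex set measure \<Rightarrow> ennreal" where
  "intersection_form \<Gamma> \<mu> \<nu> =
     (SUP A \<in> {A \<in> sets (\<mu> \<Otimes>\<^sub>M \<nu>). A \<subseteq> transverse_pairs \<and>
                 (\<forall>g\<in>\<Gamma> - {\<one>\<^bsub>BijGroup hyp_plane\<^esub>}. map_prod ((`) g) ((`) g) ` A \<inter> A = {})}.
        emeasure (\<mu> \<Otimes>\<^sub>M \<nu>) A)"

definition filling :: "(complex \<Rightarrow> complex) set \<Rightarrow> complex set measure \<Rightarrow> bool" where
  "filling \<Gamma> \<mu> \<longleftrightarrow>
     (\<forall>\<nu>. geodesic_current \<Gamma> \<nu> \<and> emeasure \<nu> (space \<nu>) \<noteq> 0 \<longrightarrow> intersection_form \<Gamma> \<mu> \<nu> > 0)"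


definition hyp_segment :: "complex \<Rightarrow> complex \<Rightarrow> complex set" where
  "hyp_segment x y = {z \<in> hyp_plane. hyp_dist x z + hyp_dist z y = hyp_dist x y}"

text \<open>
  Used for half-open segments. A geodesic meeting a nondegenerate segment does so non-transversely
  exactly if it contains the segment; no geodesic meets the degenerate half-open segment \<open>{}\<close>.
\<close>

definition transverse_geodesics :: "complex set \<Rightarrow> complex set set" where
  "transverse_geodesics I = {\<gamma> \<in> geodesics. \<gamma> \<inter> I \<noteq> {} \<and> \<not> I \<subseteq> \<gamma>}"

definition dual_pseudometric :: "complex set measure \<Rightarrow> complex \<Rightarrow> complex \<Rightarrow> real" where
  "dual_pseudometric \<mu> x y =
     measure \<mu> (transverse_geodesics (hyp_segment x y - {y})) / 2 +
     measure \<mu> (transverse_geodesics (hyp_segment x y - {x})) / 2"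


definition pseudometric_on :: "'a set \<Rightarrow> ('a \<Rightarrow> 'a \<Rightarrow> real) \<Rightarrow> bool" where
  "pseudometric_on M d \<longleftrightarrow>
     (\<forall>x\<in>M. d x x = 0) \<and>
     (\<forall>x\<in>M. \<forall>y\<in>M. d x y \<ge> 0 \<and> d x y = d y x) \<and>
     (\<forall>x\<in>M. \<forall>y\<in>M. \<forall>z\<in>M. d x z \<le> d x y + d y z)"

definition roughly_geodesic :: "'a set \<Rightarrow> ('a \<Rightarrow> 'a \<Rightarrow> real) \<Rightarrow> bool" where
  "roughly_geodesic M d \<longleftrightarrow>
     (\<exists>C\<ge>0. \<forall>x\<in>M. \<forall>y\<in>M. \<exists>L\<ge>0. \<exists>c.
        c ` {0..L} \<subseteq> M \<and> c 0 = x \<and> c L = y \<and>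
        (\<forall>s\<in>{0..L}. \<forall>t\<in>{0..L}. \<bar>d (c s) (c t) - \<bar>s - t\<bar>\<bar> \<le> C))"

definition strongly_bolic :: "'a set \<Rightarrow> ('a \<Rightarrow> 'a \<Rightarrow> real) \<Rightarrow> bool" where
  "strongly_bolic M d \<longleftrightarrow>
     pseudometric_on M d \<and> roughly_geodesic M d \<and>
     (\<forall>\<eta>>0. \<exists>R>0. \<forall>x\<in>M. \<forall>y\<in>M. \<forall>z\<in>M. \<forall>w\<in>M.
        d x z + d y w - d x y - d z w > R \<longrightarrow> \<bar>d x z + d y w - d x w - d y z\<bar> < \<eta>)"

end

theory Submission
  imports Defs
begin

text \<open>
  A geodesic \<open>\<delta>\<close> cuts the hyperbolic plane in two. Let \<open>s\<close> be \<open>1\<close> and \<open>-1\<close> on its sides and \<open>0\<close> on \<open>\<delta>\<close>.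
  Averaging over the two half-open segments makes \<open>\<delta>\<close> contribute \<open>\<bar>s x - s y\<bar> / 2\<close> to the distance of
  \<open>x\<close> and \<open>y\<close>, also if it passes through one of them. So \<open>d\<^sub>\<mu> x y\<close> is the integral over all geodesics of
  \<open>crossing x y = \<bar>s x - s y\<bar> / 2\<close> (\<open>dual_pseudometric_eq_integral\<close>), and inequalities between
  distances follow from pointwise ones: the triangle inequality, additivity along hyperbolic
  segments, and, most importantly, \<open>crossing_four_points\<close>: the integrand of
  \<open>d\<^sub>\<mu> x z + d\<^sub>\<mu> y w - d\<^sub>\<mu> x w - d\<^sub>\<mu> y z\<close> is at most \<open>2\<close> in absolute value, and it vanishes on each geodesic
  that does not meet both segments \<open>[x, y]\<close> and \<open>[z, w]\<close>. This includes the geodesics through some of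
  the four points, which may form a set of positive measure.
  
  Non-atomic implies strongly bolic (\<open>non_atomic_imp_strongly_bolic\<close>). Going from \<open>x\<close> to \<open>z\<close> and from
  \<open>y\<close> to \<open>w\<close> through \<open>a\<close> in \<open>[x, y]\<close> and \<open>b\<close> in \<open>[z, w]\<close> shows
  \<open>d\<^sub>\<mu> x z + d\<^sub>\<mu> y w - d\<^sub>\<mu> x y - d\<^sub>\<mu> z w \<le> 2 d\<^sub>\<mu> a b\<close>. By cocompactness \<open>d\<^sub>\<mu>\<close> is at most linear in the hyperbolic
  distance, so if the left side is large, then the two segments are far apart. The plane being
  Gromov hyperbolic, all geodesics that meet two distant segments stay close to one geodesic for a
  long time (\<open>geodesics_between_distant_segments\<close>). If the measure of such sets of geodesics did not
  tend to zero, then moving the middle of the long stretch into a compact fundamental set and passing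
  to a limit geodesic would make that limit an atom (\<open>non_atomic_distant_segments\<close>).
  
  Strongly bolic implies non-atomic (\<open>strongly_bolic_imp_non_atomic\<close>). Let \<open>\<gamma>\<close> be an atom of mass \<open>m\<close>.
  Only finitely many translates of \<open>\<gamma>\<close> meet a compact set, because they all have mass \<open>m\<close>; by the
  pigeonhole principle some deck transformation translates \<open>\<gamma>\<close> along itself (\<open>atom_translation\<close>).
  The restriction of \<open>\<mu>\<close> to the orbit of \<open>\<gamma>\<close> is a current, and since \<open>\<mu>\<close> is filling, it intersects
  \<open>\<mu>\<close>; so \<open>\<gamma>\<close> is crossed by a set of geodesics of positive measure, and by translation \<open>d\<^sub>\<mu>\<close> grows
  linearly along \<open>\<gamma>\<close> (\<open>dual_grows_along_atom\<close>). Now take \<open>x\<close> and \<open>y\<close> near one point of \<open>\<gamma>\<close>, on opposite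
  sides, and \<open>z\<close> and \<open>w\<close> near a distant point of \<open>\<gamma>\<close>, with \<open>z\<close> on the side of \<open>x\<close>. Strong bolicity
  applies to them, but \<open>\<gamma>\<close> contributes \<open>-2 m\<close> to \<open>d\<^sub>\<mu> x z + d\<^sub>\<mu> y w - d\<^sub>\<mu> x w - d\<^sub>\<mu> y z\<close>, and the only other
  contributions come from geodesics that follow \<open>\<gamma>\<close> for a long time, whose measure tends to zero.
\<close>

section \<open>The hyperboloid model and thin triangles\<close>

text \<open>
  Polarization of the determinant \<open>a c - b\<^sup>2\<close> of the symmetric matrix with rows \<open>(a, b)\<close> and
  \<open>(b, c)\<close>, which is written \<open>(a, b, c)\<close>. Its signature is \<open>(1, 2)\<close>.
\<close>
definition lorentz :: "real \<times> real \<times> real \<Rightarrow> real \<times> real \<times> real \<Rightarrow> real" where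
  "lorentz u v = (fst u * snd (snd v) + snd (snd u) * fst v) / 2 - fst (snd u) * fst (snd v)"

text \<open>
  Up to a factor, the vector with \<open>lorentz (lorentz_cross u v) w = det (u, v, w)\<close>.
\<close>
definition lorentz_cross :: "real \<times> real \<times> real \<Rightarrow> real \<times> real \<times> real \<Rightarrow> real \<times> real \<times> real" where
  "lorentz_cross u v =
     (fst u * fst (snd v) - fst (snd u) * fst v,
      (fst u * snd (snd v) - snd (snd u) * fst v) / 2,
      fst (snd u) * snd (snd v) - snd (snd u) * fst (snd v))"

text \<open>
  The isometry onto the hyperboloid model. There geodesics are plane sections and distances are
  inverse hyperbolic cosines of the bilinear form, so that most of hyperbolic geometry becomes linear
  algebra.
\<close>
definition hyp_embed :: "complex \<Rightarrow> real \<times> real \<times> real" where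
  "hyp_embed z = ((cmod z)\<^sup>2 / Im z, Re z / Im z, 1 / Im z)"

lemma lorentz_commute: "lorentz u v = lorentz v u"
  by (simp add: lorentz_def mult.commute add.commute)

lemma lorentz_linear:
  "lorentz (u + v) w = lorentz u w + lorentz v w"
  "lorentz w (u + v) = lorentz w u + lorentz w v"
  "lorentz (u - v) w = lorentz u w - lorentz v w"
  "lorentz w (u - v) = lorentz w u - lorentz w v"
  "lorentz (r *\<^sub>R u) w = r * lorentz u w"
  "lorentz w (r *\<^sub>R u) = r * lorentz w u"
  by (simp_all add: lorentz_def field_simps)

text \<open>
  The Gram determinant of three vectors is a square, which is the source of the triangle inequality
  and of all estimates of the distance to a geodesic below.
\<close>
lemma lorentz_cross_gram:
  "(lorentz (lorentz_cross u v) w)\<^sup>2 =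
     lorentz u u * lorentz v v * lorentz w w + 2 * lorentz u v * lorentz v w * lorentz u w
     - lorentz u u * (lorentz v w)\<^sup>2 - lorentz v v * (lorentz u w)\<^sup>2 - lorentz w w * (lorentz u v)\<^sup>2"
proof -
  obtain u1 u2 u3 v1 v2 v3 w1 w2 w3 where
    "u = (u1, u2, u3)" "v = (v1, v2, v3)" "w = (w1, w2, w3)" by (metis prod_cases3)
  then show ?thesis
    by (simp add: lorentz_def lorentz_cross_def power2_eq_square field_simps)
qed

lemma lorentz_cross_orthogonal:
  "lorentz (lorentz_cross u v) u = 0" "lorentz (lorentz_cross u v) v = 0"
  by (simp_all add: lorentz_def lorentz_cross_def field_simps)

lemma lorentz_cross_square:
  "lorentz (lorentz_cross u v) (lorentz_cross u v) = lorentz u u * lorentz v v - (lorentz u v)\<^sup>2"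
  by (simp add: lorentz_def lorentz_cross_def power2_eq_square field_simps)

lemma lorentz_cross_linear:
  "lorentz_cross u (v - w) = lorentz_cross u v - lorentz_cross u w"
  "lorentz_cross u (r *\<^sub>R v) = r *\<^sub>R lorentz_cross u v"
  "lorentz_cross u u = 0"
  by (simp_all add: lorentz_cross_def field_simps prod_eq_iff)

lemma hyp_planeI: "Im z > 0 \<Longrightarrow> z \<in> hyp_plane"
  by (simp add: hyp_plane_def)

lemma cosh_hyp_dist:
  assumes "z \<in> hyp_plane" "w \<in> hyp_plane"
  shows "cosh (hyp_dist z w) = 1 + (cmod (z - w))\<^sup>2 / (2 * Im z * Im w)"
  using assms unfolding hyp_dist_def hyp_plane_def
  by (subst cosh_arcosh_real) (auto intro!: divide_nonneg_pos)

lemma hyp_dist_nonneg: "z \<in> hyp_plane \<Longrightarrow> w \<in> hyp_plane \<Longrightarrow> 0 \<le> hyp_dist z w"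
  unfolding hyp_dist_def hyp_plane_def
  by (intro arcosh_nonneg_real) (auto intro!: divide_nonneg_pos)

lemma hyp_dist_commute: "hyp_dist z w = hyp_dist w z"
  unfolding hyp_dist_def by (simp add: norm_minus_commute mult_ac)

lemma hyp_dist_le_iff:
  assumes "z \<in> hyp_plane" "w \<in> hyp_plane" "0 \<le> r"
  shows "hyp_dist z w \<le> r \<longleftrightarrow> cosh (hyp_dist z w) \<le> cosh r"
  using cosh_real_nonneg_le_iff[OF hyp_dist_nonneg[OF assms(1,2)] assms(3)] by simp

lemma lorentz_embed:
  assumes "z \<in> hyp_plane" "w \<in> hyp_plane"
  shows "lorentz (hyp_embed z) (hyp_embed w) = cosh (hyp_dist z w)"
proof -
  have "Im z > 0" "Im w > 0" using assms by (auto simp: hyp_plane_def)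
  moreover have "(cmod (z - w))\<^sup>2 = (cmod z)\<^sup>2 + (cmod w)\<^sup>2 - 2 * Re z * Re w - 2 * Im z * Im w"
    by (simp add: cmod_power2) (simp add: power2_eq_square algebra_simps)
  moreover have "lorentz (hyp_embed z) (hyp_embed w) =
      ((cmod z)\<^sup>2 + (cmod w)\<^sup>2 - 2 * Re z * Re w) / (2 * Im z * Im w)"
    using \<open>Im z > 0\<close> \<open>Im w > 0\<close> by (simp add: lorentz_def hyp_embed_def field_simps)
  ultimately show ?thesis
    unfolding cosh_hyp_dist[OF assms] by (simp add: field_simps)
qed

lemma lorentz_embed_self: "z \<in> hyp_plane \<Longrightarrow> lorentz (hyp_embed z) (hyp_embed z) = 1"
  by (simp add: lorentz_embed cosh_hyp_dist)

lemma lorentz_embed_ge1: "z \<in> hyp_plane \<Longrightarrow> w \<in> hyp_plane \<Longrightarrow> 1 \<le> lorentz (hyp_embed z) (hyp_embed w)"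
  by (simp add: lorentz_embed cosh_real_ge_1)

lemma hyp_embed_inj:
  assumes "z \<in> hyp_plane" "w \<in> hyp_plane" "hyp_embed z = hyp_embed w"
  shows "z = w"
  using assms by (auto simp: hyp_embed_def hyp_plane_def complex_eq_iff)

lemma hyp_dist_self: "z \<in> hyp_plane \<Longrightarrow> hyp_dist z z = 0"
  by (simp add: hyp_dist_def)

lemma hyp_dist_eq_0:
  assumes "z \<in> hyp_plane" "w \<in> hyp_plane"
  shows "hyp_dist z w = 0 \<longleftrightarrow> z = w"
proof
  assume "hyp_dist z w = 0"
  then have "1 + (cmod (z - w))\<^sup>2 / (2 * Im z * Im w) = 1"
    using cosh_hyp_dist[OF assms] by simp
  then show "z = w" using assms by (simp add: hyp_plane_def)
qed (use assms in \<open>simp add: hyp_dist_self\<close>)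

lemma hyp_embed_surj:
  assumes Y: "lorentz Y Y = 1" and p: "p \<in> hyp_plane" "lorentz Y (hyp_embed p) > 0"
  obtains z where "z \<in> hyp_plane" "hyp_embed z = Y"
proof -
  obtain a b c where abc: "Y = (a, b, c)" by (metis prod_cases3)
  have ac: "a * c = 1 + b\<^sup>2"
    using Y by (simp add: abc lorentz_def power2_eq_square field_simps)
  then have "c \<noteq> 0" by (metis add_pos_nonneg zero_less_one zero_le_power2 mult_zero_right less_irrefl)
  have Imp: "Im p > 0" using p by (simp add: hyp_plane_def)
  have "lorentz Y (hyp_embed p) = (a + c * (cmod p)\<^sup>2 - 2 * b * Re p) / (2 * Im p)"
    using Imp by (simp add: abc lorentz_def hyp_embed_def field_simps)
  then have pos: "a + c * (cmod p)\<^sup>2 - 2 * b * Re p > 0"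
    using p(2) Imp by (simp add: zero_less_divide_iff)
  have "c * (a + c * (cmod p)\<^sup>2 - 2 * b * Re p) = 1 + (b - c * Re p)\<^sup>2 + (c * Im p)\<^sup>2"
  proof -
    have "c * (a + c * (cmod p)\<^sup>2 - 2 * b * Re p) = a * c + c * (c * (cmod p)\<^sup>2 - 2 * b * Re p)"
      by (simp add: algebra_simps)
    also have "\<dots> = 1 + (b - c * Re p)\<^sup>2 + (c * Im p)\<^sup>2"
      unfolding ac cmod_power2 by (simp add: power2_eq_square algebra_simps)
    finally show ?thesis .
  qed
  then have "c * (a + c * (cmod p)\<^sup>2 - 2 * b * Re p) > 0"
    using zero_le_power2[of "b - c * Re p"] zero_le_power2[of "c * Im p"] by linarith
  then have c: "c > 0" using pos by (simp add: zero_less_mult_iff)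
  let ?z = "Complex (b / c) (1 / c)"
  have "(cmod ?z)\<^sup>2 = (1 + b\<^sup>2) / c\<^sup>2"
    by (simp add: cmod_power2 power_divide add_divide_distrib)
  then have "(cmod ?z)\<^sup>2 / Im ?z = (1 + b\<^sup>2) / c"
    using c by (simp add: power2_eq_square)
  also have "\<dots> = a" using c ac by (simp add: field_simps)
  finally have "hyp_embed ?z = Y" using c by (simp add: hyp_embed_def abc)
  moreover have "?z \<in> hyp_plane" using c by (simp add: hyp_plane_def)
  ultimately show thesis using that by blast
qed

text \<open>
  The form is negative definite on the orthogonal complement of a positive vector. This is used in
  the following form: a vector that is isotropic and orthogonal to a point of the hyperboloid is zero.
\<close>
lemma orthogonal_complement_definite:
  assumes z: "z \<in> hyp_plane" and orth: "lorentz W (hyp_embed z) = 0"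
  shows "lorentz W W \<le> 0" "lorentz W W = 0 \<Longrightarrow> W = 0"
proof -
  obtain p q r where W: "W = (p, q, r)" by (metis prod_cases3)
  define a b c where "a = (cmod z)\<^sup>2 / Im z" and "b = Re z / Im z" and "c = 1 / Im z"
  have "Im z > 0" using z by (simp add: hyp_plane_def)
  then have c: "c > 0" and a: "a > 0" by (auto simp: a_def c_def intro!: divide_pos_pos)
  have ac: "a * c = 1 + b\<^sup>2"
    using lorentz_embed_self[OF z]
    by (simp add: lorentz_def hyp_embed_def a_def b_def c_def power2_eq_square field_simps)
  have o: "p * c + r * a = 2 * (q * b)"
    using orth by (simp add: lorentz_def W hyp_embed_def a_def b_def c_def)
  have "(2 * (q * b))\<^sup>2 - (p * c - r * a)\<^sup>2 = 4 * (a * c) * (p * r)"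
    unfolding o[symmetric] by (simp add: power2_eq_square algebra_simps)
  then have key: "b\<^sup>2 * (p * r - q\<^sup>2) + p * r = - ((p * c - r * a)\<^sup>2) / 4"
    unfolding ac by (simp add: power2_eq_square algebra_simps)
  have Q: "lorentz W W = p * r - q\<^sup>2"
    by (simp add: lorentz_def W power2_eq_square field_simps)
  show "lorentz W W \<le> 0"
  proof (rule ccontr)
    assume "\<not> ?thesis"
    then have "p * r > q\<^sup>2" using Q by simp
    then have "b\<^sup>2 * (p * r - q\<^sup>2) \<ge> 0" "p * r > 0"
      using zero_le_power2[of q] by (simp, linarith)
    then show False using key zero_le_power2[of "p * c - r * a"] by linarith
  qed
  assume "lorentz W W = 0"
  then have pr: "p * r = q\<^sup>2" using Q by simp
  then have "q\<^sup>2 = - ((p * c - r * a)\<^sup>2) / 4" using key by simp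
  then have "q\<^sup>2 = 0" "(p * c - r * a)\<^sup>2 = 0"
    using zero_le_power2[of q] zero_le_power2[of "p * c - r * a"] by linarith+
  then have "q = 0" "p * c = r * a" by auto
  with o a c show "W = 0" by (auto simp: W zero_prod_def)
qed

text \<open>
  A nonnegative Gram determinant says
  \<open>(cosh (d x z) - cosh (d x y) cosh (d y z))\<^sup>2 \<le> (sinh (d x y) sinh (d y z))\<^sup>2\<close>.
\<close>
lemma hyp_dist_triangle:
  assumes "x \<in> hyp_plane" "y \<in> hyp_plane" "z \<in> hyp_plane"
  shows "hyp_dist x z \<le> hyp_dist x y + hyp_dist y z"
proof -
  let ?a = "hyp_dist x y" and ?b = "hyp_dist y z" and ?C = "cosh (hyp_dist x z)"
  have nn: "?a \<ge> 0" "?b \<ge> 0" using assms by (simp_all add: hyp_dist_nonneg)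
  have "0 \<le> (lorentz (lorentz_cross (hyp_embed x) (hyp_embed y)) (hyp_embed z))\<^sup>2" by simp
  also have "\<dots> = 1 + 2 * cosh ?a * cosh ?b * ?C - (cosh ?a)\<^sup>2 - (cosh ?b)\<^sup>2 - ?C\<^sup>2"
    using assms by (simp add: lorentz_cross_gram lorentz_embed hyp_dist_self)
  finally have "(?C - cosh ?a * cosh ?b)\<^sup>2 \<le> ((cosh ?a)\<^sup>2 - 1) * ((cosh ?b)\<^sup>2 - 1)"
    by (simp add: power2_eq_square algebra_simps)
  also have "\<dots> = (sinh ?a * sinh ?b)\<^sup>2"
    by (simp add: cosh_square_eq power_mult_distrib)
  finally have "\<bar>?C - cosh ?a * cosh ?b\<bar> \<le> \<bar>sinh ?a * sinh ?b\<bar>"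
    by (simp add: abs_le_square_iff)
  moreover have "sinh ?a * sinh ?b \<ge> 0" using nn by simp
  ultimately have "?C \<le> cosh (?a + ?b)" unfolding cosh_add by linarith
  then show ?thesis using hyp_dist_le_iff[OF assms(1,3)] nn by simp
qed

text \<open>
  The difference of the two sides is isotropic and orthogonal to \<open>hyp_embed z\<close>. The formula shows
  that hyperbolic segments are the central projections of straight segments.
\<close>
lemma hyp_embed_between:
  assumes "x \<in> hyp_plane" "y \<in> hyp_plane" "z \<in> hyp_plane"
    and between: "hyp_dist x z + hyp_dist z y = hyp_dist x y" and "x \<noteq> y"
  shows "hyp_embed z = (sinh (hyp_dist z y) / sinh (hyp_dist x y)) *\<^sub>R hyp_embed x
                 + (sinh (hyp_dist x z) / sinh (hyp_dist x y)) *\<^sub>R hyp_embed y"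
proof -
  define a b where "a = hyp_dist x z" and "b = hyp_dist z y"
  define S where "S = sinh (a + b)"
  have d: "hyp_dist x y = a + b" using between by (simp add: a_def b_def)
  have "a + b > 0" using assms hyp_dist_nonneg[OF assms(1,2)] hyp_dist_eq_0[OF assms(1,2)] d by linarith
  then have S: "S > 0" by (simp add: S_def)
  define W where "W = S *\<^sub>R hyp_embed z - (sinh b *\<^sub>R hyp_embed x + sinh a *\<^sub>R hyp_embed y)"
  have ip: "lorentz (hyp_embed z) (hyp_embed x) = cosh a" "lorentz (hyp_embed z) (hyp_embed y) = cosh b"
    "lorentz (hyp_embed x) (hyp_embed z) = cosh a" "lorentz (hyp_embed y) (hyp_embed z) = cosh b"
    "lorentz (hyp_embed x) (hyp_embed y) = cosh (a + b)" "lorentz (hyp_embed y) (hyp_embed x) = cosh (a + b)"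
    using assms d by (simp_all add: lorentz_embed hyp_dist_commute a_def b_def)
  have W0: "lorentz W (hyp_embed z) = 0"
    using assms by (simp add: W_def lorentz_linear lorentz_embed_self ip S_def sinh_add)
  have "lorentz W W = S\<^sup>2 - 2 * S * (sinh b * cosh a + sinh a * cosh b)
          + (sinh b)\<^sup>2 + (sinh a)\<^sup>2 + 2 * sinh a * sinh b * cosh (a + b)"
    using assms by (simp add: W_def lorentz_linear lorentz_embed_self ip power2_eq_square algebra_simps)
  also have "\<dots> = - (S\<^sup>2) + (sinh b)\<^sup>2 + (sinh a)\<^sup>2 + 2 * sinh a * sinh b * cosh (a + b)"
    by (simp add: S_def sinh_add power2_eq_square algebra_simps)
  also have "\<dots> = 0"
  proof -
    have "S\<^sup>2 = (sinh a)\<^sup>2 * (cosh b)\<^sup>2 + (cosh a)\<^sup>2 * (sinh b)\<^sup>2 + 2 * sinh a * sinh b * cosh a * cosh b"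
      by (simp add: S_def sinh_add power2_eq_square algebra_simps)
    then show ?thesis
      unfolding cosh_add cosh_square_eq by (simp add: power2_eq_square algebra_simps)
  qed
  finally have "W = 0" using orthogonal_complement_definite(2)[OF assms(3) W0] by simp
  then have "S *\<^sub>R hyp_embed z = sinh b *\<^sub>R hyp_embed x + sinh a *\<^sub>R hyp_embed y" by (simp add: W_def)
  then have "(1 / S) *\<^sub>R (S *\<^sub>R hyp_embed z) = (1 / S) *\<^sub>R (sinh b *\<^sub>R hyp_embed x + sinh a *\<^sub>R hyp_embed y)" by simp
  then have "hyp_embed z = (sinh b / S) *\<^sub>R hyp_embed x + (sinh a / S) *\<^sub>R hyp_embed y"
    using S by (simp add: scaleR_right_distrib)
  then show ?thesis by (simp add: S_def d a_def b_def)
qed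

lemma segment_coordinates:
  assumes "x \<in> hyp_plane" "y \<in> hyp_plane" "z \<in> hyp_segment x y"
  obtains l m where "l \<ge> 0" "m \<ge> 0" "hyp_embed z = l *\<^sub>R hyp_embed x + m *\<^sub>R hyp_embed y"
    "z \<noteq> y \<Longrightarrow> l > 0" "z \<noteq> x \<Longrightarrow> m > 0"
proof (cases "x = y")
  case True
  then have "hyp_dist x z = 0"
    using assms hyp_dist_nonneg[of x z] by (simp add: hyp_segment_def hyp_dist_self hyp_dist_commute)
  then have "z = x" using assms hyp_dist_eq_0[of x z] by (simp add: hyp_segment_def)
  then show ?thesis using True that[of 1 0] by simp
next
  case False
  have z: "z \<in> hyp_plane" "hyp_dist x z + hyp_dist z y = hyp_dist x y"
    using assms by (auto simp: hyp_segment_def)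
  have nn: "hyp_dist x z \<ge> 0" "hyp_dist z y \<ge> 0" "hyp_dist x y > 0"
    using assms z False hyp_dist_nonneg hyp_dist_eq_0[OF assms(1,2)] less_eq_real_def by auto
  show ?thesis
  proof (rule that[OF _ _ hyp_embed_between[OF assms(1,2) z False]])
    assume "z \<noteq> y"
    then have "hyp_dist z y > 0" using nn hyp_dist_eq_0[OF z(1) assms(2)] by linarith
    then show "0 < sinh (hyp_dist z y) / sinh (hyp_dist x y)" using nn by simp
  next
    assume "z \<noteq> x"
    then have "hyp_dist x z > 0" using nn hyp_dist_eq_0[OF assms(1) z(1)] by auto
    then show "0 < sinh (hyp_dist x z) / sinh (hyp_dist x y)" using nn by simp
  qed (use nn in auto)
qed

lemma segmentI:
  assumes "x \<in> hyp_plane" "y \<in> hyp_plane" "z \<in> hyp_plane"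
    and lm: "l \<ge> 0" "m \<ge> 0" and z: "hyp_embed z = l *\<^sub>R hyp_embed x + m *\<^sub>R hyp_embed y"
  shows "z \<in> hyp_segment x y"
proof -
  define a b d where "a = hyp_dist x z" and "b = hyp_dist z y" and "d = hyp_dist x y"
  have nn: "a \<ge> 0" "b \<ge> 0" "d \<ge> 0" using assms by (simp_all add: a_def b_def d_def hyp_dist_nonneg)
  have xy: "lorentz (hyp_embed x) (hyp_embed y) = cosh d" "lorentz (hyp_embed y) (hyp_embed x) = cosh d"
    using assms by (simp_all add: d_def lorentz_embed hyp_dist_commute)
  have a: "cosh a = l + m * cosh d"
    unfolding a_def lorentz_embed[OF assms(1,3), symmetric] z
    using assms by (simp add: lorentz_linear lorentz_embed_self xy)
  have b: "cosh b = l * cosh d + m"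
    unfolding b_def lorentz_embed[OF assms(3,2), symmetric] z
    using assms by (simp add: lorentz_linear lorentz_embed_self xy)
  have one: "l\<^sup>2 + m\<^sup>2 + 2 * l * m * cosh d = 1"
    using lorentz_embed_self[OF assms(3)] assms(1,2)
    unfolding z by (simp add: lorentz_linear lorentz_embed_self xy power2_eq_square algebra_simps)
  have "(sinh a)\<^sup>2 = (m * sinh d)\<^sup>2"
    using one unfolding sinh_square_eq a power_mult_distrib by (simp add: power2_eq_square algebra_simps)
  then have sa: "sinh a = m * sinh d" using nn lm by (simp add: power2_eq_iff_nonneg)
  have "(sinh b)\<^sup>2 = (l * sinh d)\<^sup>2"
    using one unfolding sinh_square_eq b power_mult_distrib by (simp add: power2_eq_square algebra_simps)
  then have sb: "sinh b = l * sinh d" using nn lm by (simp add: power2_eq_iff_nonneg)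
  have "cosh (a + b) = cosh d * (l\<^sup>2 + m\<^sup>2 + 2 * l * m * cosh d) + l * m * ((sinh d)\<^sup>2 - ((cosh d)\<^sup>2 - 1))"
    unfolding cosh_add a b sa sb by (simp add: power2_eq_square algebra_simps)
  also have "\<dots> = cosh d" by (simp add: one sinh_square_eq)
  finally have "a + b = d" using nn by (metis add_nonneg_nonneg cosh_real_nonneg_le_iff order_antisym order_refl)
  then show ?thesis using assms by (simp add: hyp_segment_def a_def b_def d_def)
qed

lemma positive_combination_in_segment:
  assumes "x \<in> hyp_plane" "y \<in> hyp_plane" "l > 0" "m > 0"
  obtains z where "z \<in> hyp_segment x y"
    "hyp_embed z = (1 / sqrt (l\<^sup>2 + m\<^sup>2 + 2 * l * m * cosh (hyp_dist x y))) *\<^sub>R (l *\<^sub>R hyp_embed x + m *\<^sub>R hyp_embed y)"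
proof -
  define q where "q = l\<^sup>2 + m\<^sup>2 + 2 * l * m * cosh (hyp_dist x y)"
  have q: "q > 0" unfolding q_def using assms by (intro add_pos_pos mult_pos_pos) auto
  define Y where "Y = (1 / sqrt q) *\<^sub>R (l *\<^sub>R hyp_embed x + m *\<^sub>R hyp_embed y)"
  have xy: "lorentz (hyp_embed x) (hyp_embed y) = cosh (hyp_dist x y)"
     "lorentz (hyp_embed y) (hyp_embed x) = cosh (hyp_dist x y)"
    using assms by (simp_all add: lorentz_embed hyp_dist_commute)
  have "lorentz (l *\<^sub>R hyp_embed x + m *\<^sub>R hyp_embed y) (l *\<^sub>R hyp_embed x + m *\<^sub>R hyp_embed y) = q"
    using assms by (simp add: lorentz_linear lorentz_embed_self xy q_def power2_eq_square algebra_simps)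
  then have "lorentz Y Y = (1 / sqrt q)\<^sup>2 * q"
    unfolding Y_def lorentz_linear(5,6) by (simp add: power2_eq_square)
  then have 1: "lorentz Y Y = 1" using q by (simp add: power_divide)
  have "lorentz Y (hyp_embed x) = (1 / sqrt q) * (l + m * cosh (hyp_dist x y))"
    unfolding Y_def using assms by (simp add: lorentz_linear lorentz_embed_self xy)
  also have "\<dots> > 0" using assms q by (intro mult_pos_pos add_pos_pos) auto
  finally obtain z where z: "z \<in> hyp_plane" "hyp_embed z = Y" using hyp_embed_surj[OF 1 assms(1)] by blast
  have "z \<in> hyp_segment x y"
    by (rule segmentI[OF assms(1,2) z(1), of "l / sqrt q" "m / sqrt q"])
      (use assms q z in \<open>auto simp: Y_def scaleR_right_distrib\<close>)
  then show thesis using z(2) unfolding Y_def q_def by (rule that)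
qed

text \<open>
  By the hyperbolic law of cosines the hypothesis says that \<open>u\<close> sees \<open>p\<close> and \<open>q\<close> under an angle that
  is not acute.
\<close>
lemma close_point_on_segment:
  assumes "p \<in> hyp_plane" "q \<in> hyp_plane" "u \<in> hyp_plane"
    and obtuse: "cosh (hyp_dist p q) \<ge> cosh (hyp_dist u p) * cosh (hyp_dist u q)"
  shows "\<exists>v \<in> hyp_segment p q. cosh (hyp_dist u v) \<le> 2"
proof -
  define P Q C where "P = cosh (hyp_dist u p)" and "Q = cosh (hyp_dist u q)" and "C = cosh (hyp_dist p q)"
  have pos: "P > 0" "Q > 0" by (simp_all add: P_def Q_def)
  \<comment> \<open>Weighting each endpoint by the hyperbolic cosine of the distance from u to the other one
     balances their contributions to the distance from u to the combination.\<close>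
  obtain v where v: "v \<in> hyp_segment p q"
    "hyp_embed v = (1 / sqrt (Q\<^sup>2 + P\<^sup>2 + 2 * Q * P * C)) *\<^sub>R (Q *\<^sub>R hyp_embed p + P *\<^sub>R hyp_embed q)"
    by (rule positive_combination_in_segment[OF assms(1,2) pos(2,1), folded C_def])
  have vH: "v \<in> hyp_plane" using v by (simp add: hyp_segment_def)
  have "P * Q * (P * Q) \<le> P * Q * C"
    using obtuse pos by (intro mult_left_mono) (auto simp: P_def Q_def C_def)
  moreover have "0 \<le> P * Q * C" using pos by (simp add: C_def)
  moreover have "(P * Q)\<^sup>2 = P * Q * (P * Q)" by (rule power2_eq_square)
  ultimately have "(P * Q)\<^sup>2 \<le> 2 * (P * Q * C)" by linarith
  also have "\<dots> \<le> Q\<^sup>2 + P\<^sup>2 + 2 * Q * P * C"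
    using zero_le_power2[of P] zero_le_power2[of Q] by (simp add: mult_ac)
  finally have s: "P * Q \<le> sqrt (Q\<^sup>2 + P\<^sup>2 + 2 * Q * P * C)"
    by (rule real_le_rsqrt)
  have "cosh (hyp_dist u v) = (1 / sqrt (Q\<^sup>2 + P\<^sup>2 + 2 * Q * P * C)) * (2 * (P * Q))"
    unfolding lorentz_embed[OF assms(3) vH, symmetric] v(2)
    using assms by (simp add: lorentz_linear lorentz_embed P_def Q_def)
  also have "\<dots> = 2 * ((P * Q) / sqrt (Q\<^sup>2 + P\<^sup>2 + 2 * Q * P * C))" by simp
  also have "(P * Q) / sqrt (Q\<^sup>2 + P\<^sup>2 + 2 * Q * P * C) \<le> 1"
    using s mult_pos_pos[OF pos] by (intro divide_le_eq_1_pos[THEN iffD2]) linarith+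
  finally have "cosh (hyp_dist u v) \<le> 2" by simp
  then show ?thesis using v by blast
qed

text \<open>
  If \<open>u\<close> saw both remaining sides under acute angles, then pairing \<open>r\<close> with \<open>u\<close>, as a combination of
  \<open>p\<close> and \<open>q\<close>, would give a value smaller than itself. So one of these sides is seen under an angle
  that is not acute and \<open>close_point_on_segment\<close> applies.
\<close>
lemma thin_triangle:
  assumes "p \<in> hyp_plane" "q \<in> hyp_plane" "r \<in> hyp_plane" and u: "u \<in> hyp_segment p q"
  shows "\<exists>v \<in> hyp_segment p r \<union> hyp_segment r q. cosh (hyp_dist u v) \<le> 2"
proof -
  have uH: "u \<in> hyp_plane" using u by (simp add: hyp_segment_def)
  obtain l m where lm: "l \<ge> 0" "m \<ge> 0" "hyp_embed u = l *\<^sub>R hyp_embed p + m *\<^sub>R hyp_embed q"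
    using segment_coordinates[OF assms(1,2) u] by metis
  define P Q R where "P = cosh (hyp_dist u p)" and "Q = cosh (hyp_dist u q)" and "R = cosh (hyp_dist u r)"
  have "lorentz (hyp_embed u) (hyp_embed u) = l * P + m * Q"
    by (subst (2) lm(3)) (use assms uH in \<open>simp add: lorentz_linear lorentz_embed P_def Q_def\<close>)
  then have one: "l * P + m * Q = 1" using lorentz_embed_self[OF uH] by simp
  have R: "R = l * cosh (hyp_dist p r) + m * cosh (hyp_dist r q)"
    unfolding R_def lorentz_embed[OF uH assms(3), symmetric] lm(3)
    using assms by (simp add: lorentz_linear lorentz_embed hyp_dist_commute)
  have "cosh (hyp_dist p r) \<ge> P * R \<or> cosh (hyp_dist r q) \<ge> R * Q"
  proof (rule ccontr)
    assume "\<not> ?thesis"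
    then have less: "cosh (hyp_dist p r) < P * R" "cosh (hyp_dist r q) < R * Q" by auto
    have "l > 0 \<or> m > 0" using one lm by (metis add_0 less_eq_real_def mult_zero_left zero_neq_one)
    then have "R < l * (P * R) + m * (R * Q)"
    proof
      assume "l > 0"
      then show ?thesis unfolding R using less lm
        by (intro add_less_le_mono mult_strict_left_mono mult_left_mono) (auto simp: R)
    next
      assume "m > 0"
      then show ?thesis unfolding R using less lm
        by (intro add_le_less_mono mult_strict_left_mono mult_left_mono) (auto simp: R)
    qed
    also have "\<dots> = R * (l * P + m * Q)" by (simp add: algebra_simps)
    finally show False by (simp add: one)
  qed
  then show ?thesis
  proof
    assume "cosh (hyp_dist p r) \<ge> P * R"
    then show ?thesis using close_point_on_segment[OF assms(1,3) uH] by (auto simp: P_def R_def)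
  next
    assume "cosh (hyp_dist r q) \<ge> R * Q"
    then show ?thesis using close_point_on_segment[OF assms(3,2) uH] by (auto simp: Q_def R_def)
  qed
qed

section \<open>Geodesics and their sides\<close>

text \<open>
  The unit normal vector of the plane that cuts the geodesic out of the hyperboloid.
\<close>
definition geodesic_normal :: "(real \<Rightarrow> complex) \<Rightarrow> real \<times> real \<times> real" where
  "geodesic_normal c = (1 / sinh 1) *\<^sub>R lorentz_cross (hyp_embed (c 0)) (hyp_embed (c 1))"

text \<open>
  The hyperbolic sine of the signed distance from \<open>z\<close> to the geodesic. Being linear in \<open>hyp_embed z\<close>, it
  detects incidence, sides and fellow travelling at once.
\<close>
definition side :: "(real \<Rightarrow> complex) \<Rightarrow> complex \<Rightarrow> real" where
  "side c z = lorentz (geodesic_normal c) (hyp_embed z)"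

lemma hyp_dist_eqI:
  assumes "z \<in> hyp_plane" "w \<in> hyp_plane" "r \<ge> 0" "lorentz (hyp_embed z) (hyp_embed w) = cosh r"
  shows "hyp_dist z w = r"
  using assms hyp_dist_nonneg[OF assms(1,2)]
  by (metis cosh_real_nonneg_le_iff lorentz_embed order_antisym order_refl)

lemma unit_speed_in_plane: "c \<in> unit_speed_geodesics \<Longrightarrow> c t \<in> hyp_plane"
  by (auto simp: unit_speed_geodesics_def)

lemma unit_speed_dist: "c \<in> unit_speed_geodesics \<Longrightarrow> hyp_dist (c s) (c t) = \<bar>s - t\<bar>"
  by (auto simp: unit_speed_geodesics_def)

lemma lorentz_unit_speed:
  "c \<in> unit_speed_geodesics \<Longrightarrow> lorentz (hyp_embed (c s)) (hyp_embed (c t)) = cosh (s - t)"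
  by (simp add: lorentz_embed unit_speed_in_plane unit_speed_dist)

text \<open>
  Each isometric embedding of the line is a hyperbola \<open>cosh t P + sinh t Q\<close>, because the
  difference to this curve is isotropic and orthogonal to a point of the hyperboloid.
\<close>
lemma geodesic_frame:
  assumes c: "c \<in> unit_speed_geodesics"
  obtains P Q where "lorentz P P = 1" "lorentz P Q = 0" "lorentz Q Q = -1"
    "\<And>t. hyp_embed (c t) = cosh t *\<^sub>R P + sinh t *\<^sub>R Q" "geodesic_normal c = lorentz_cross P Q"
proof -
  define P where "P = hyp_embed (c 0)"
  define Q where "Q = (1 / sinh 1) *\<^sub>R (hyp_embed (c 1) - cosh 1 *\<^sub>R P)"
  have s1: "sinh (1::real) \<noteq> 0" by simp
  have PP: "lorentz P P = 1" using c by (simp add: P_def lorentz_unit_speed)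
  have P1: "lorentz P (hyp_embed (c 1)) = cosh 1" "lorentz (hyp_embed (c 1)) P = cosh 1"
    using c by (simp_all add: P_def lorentz_unit_speed)
  have PQ: "lorentz P Q = 0" using PP P1 by (simp add: Q_def lorentz_linear)
  have "lorentz Q Q = (1 / sinh 1)\<^sup>2 * (1 - (cosh 1)\<^sup>2)"
    using PP P1 c by (simp add: Q_def lorentz_linear lorentz_unit_speed power2_eq_square)
  then have QQ: "lorentz Q Q = -1" by (simp add: cosh_square_eq power_divide)
  have "hyp_embed (c t) = cosh t *\<^sub>R P + sinh t *\<^sub>R Q" for t
  proof -
    have cP: "lorentz (hyp_embed (c t)) P = cosh t"
      using lorentz_unit_speed[OF c, of t 0] by (simp add: P_def)
    have "lorentz (hyp_embed (c t)) Q = (cosh (t - 1) - cosh 1 * cosh t) / sinh 1"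
      using cP lorentz_unit_speed[OF c, of t 1] by (simp add: Q_def lorentz_linear)
    then have cQ: "lorentz (hyp_embed (c t)) Q = - sinh t"
      by (simp add: cosh_diff)
    define W where "W = hyp_embed (c t) - (cosh t *\<^sub>R P + sinh t *\<^sub>R Q)"
    have WP: "lorentz W (hyp_embed (c 0)) = 0"
      using PP PQ cP by (simp add: W_def P_def[symmetric] lorentz_linear lorentz_commute[of Q P])
    have "lorentz W W = 1 - (cosh t)\<^sup>2 + (sinh t)\<^sup>2"
      using PP PQ QQ cP cQ lorentz_unit_speed[OF c, of t t]
      by (simp add: W_def lorentz_linear lorentz_commute[of Q P] lorentz_commute[of P "hyp_embed (c t)"]
          lorentz_commute[of Q "hyp_embed (c t)"] power2_eq_square)
    then have "lorentz W W = 0" by (simp add: cosh_square_eq)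
    then have "W = 0"
      using orthogonal_complement_definite(2)[OF unit_speed_in_plane[OF c] WP] by simp
    then show ?thesis by (simp add: W_def)
  qed
  moreover have "geodesic_normal c = lorentz_cross P Q"
    by (simp add: geodesic_normal_def P_def[symmetric] Q_def lorentz_cross_linear)
  ultimately show thesis using that PP PQ QQ by blast
qed

lemma geodesic_from_frame:
  assumes p: "p \<in> hyp_plane" and PQ: "lorentz (hyp_embed p) Q = 0" and QQ: "lorentz Q Q = -1"
  obtains c where "c \<in> unit_speed_geodesics"
    "\<And>t. hyp_embed (c t) = cosh t *\<^sub>R hyp_embed p + sinh t *\<^sub>R Q"
proof -
  have ip: "lorentz (cosh s *\<^sub>R hyp_embed p + sinh s *\<^sub>R Q) (cosh t *\<^sub>R hyp_embed p + sinh t *\<^sub>R Q)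
      = cosh (s - t)" for s t
    using PQ QQ p by (simp add: lorentz_linear lorentz_embed_self lorentz_commute[of Q "hyp_embed p"] cosh_diff)
  have "\<exists>z. z \<in> hyp_plane \<and> hyp_embed z = cosh t *\<^sub>R hyp_embed p + sinh t *\<^sub>R Q" for t
  proof -
    have "lorentz (cosh t *\<^sub>R hyp_embed p + sinh t *\<^sub>R Q) (hyp_embed p) > 0"
      using PQ p by (simp add: lorentz_linear lorentz_embed_self lorentz_commute[of Q "hyp_embed p"])
    then show ?thesis using hyp_embed_surj[OF _ p] ip[of t t] by (metis cosh_0 diff_self)
  qed
  then obtain c where c: "\<And>t. c t \<in> hyp_plane"
    "\<And>t. hyp_embed (c t) = cosh t *\<^sub>R hyp_embed p + sinh t *\<^sub>R Q" by metis
  have "hyp_dist (c s) (c t) = \<bar>s - t\<bar>" for s t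
    by (rule hyp_dist_eqI) (use c ip in \<open>simp_all add: cosh_real_abs\<close>)
  then have "c \<in> unit_speed_geodesics" using c by (auto simp: unit_speed_geodesics_def)
  then show thesis using that c by blast
qed

lemma geodesic_through:
  assumes "x \<in> hyp_plane" "y \<in> hyp_plane" "x \<noteq> y"
  obtains c where "c \<in> unit_speed_geodesics" "c 0 = x" "c (hyp_dist x y) = y"
proof -
  define d where "d = hyp_dist x y"
  have d: "d > 0"
    using assms hyp_dist_nonneg[OF assms(1,2)] hyp_dist_eq_0[OF assms(1,2)] by (simp add: d_def)
  define Q where "Q = (1 / sinh d) *\<^sub>R (hyp_embed y - cosh d *\<^sub>R hyp_embed x)"
  have xy: "lorentz (hyp_embed x) (hyp_embed y) = cosh d" "lorentz (hyp_embed y) (hyp_embed x) = cosh d"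
    using assms by (simp_all add: d_def lorentz_embed hyp_dist_commute)
  have PQ: "lorentz (hyp_embed x) Q = 0"
    using assms xy by (simp add: Q_def lorentz_linear lorentz_embed_self)
  have "lorentz Q Q = (1 / sinh d)\<^sup>2 * (1 - (cosh d)\<^sup>2)"
    using assms xy by (simp add: Q_def lorentz_linear lorentz_embed_self power2_eq_square)
  then have QQ: "lorentz Q Q = -1" using d by (simp add: cosh_square_eq power_divide)
  obtain c where c: "c \<in> unit_speed_geodesics"
    "\<And>t. hyp_embed (c t) = cosh t *\<^sub>R hyp_embed x + sinh t *\<^sub>R Q"
    using geodesic_from_frame[OF assms(1) PQ QQ] by blast
  have "c 0 = x" using c(2)[of 0] by (intro hyp_embed_inj unit_speed_in_plane c(1) assms(1)) simp
  moreover have "c d = y"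
    using c(2)[of d] d by (intro hyp_embed_inj unit_speed_in_plane c(1) assms(2)) (simp add: Q_def)
  ultimately show thesis using that c(1) by (simp add: d_def)
qed

lemma unit_speed_shift:
  assumes "c \<in> unit_speed_geodesics"
  shows "(\<lambda>t. c (t + a)) \<in> unit_speed_geodesics" "range (\<lambda>t. c (t + a)) = range c"
proof -
  show "(\<lambda>t. c (t + a)) \<in> unit_speed_geodesics"
    using assms by (auto simp: unit_speed_geodesics_def)
  have "range (\<lambda>t. c (t + a)) = c ` range (\<lambda>t. t + a)" by (rule image_image[symmetric])
  also have "range (\<lambda>t. t + a) = UNIV" by (rule surj_plus_right)
  finally show "range (\<lambda>t. c (t + a)) = range c" .
qed

text \<open>
  If \<open>side c z\<close> vanishes, then the Gram determinant of \<open>P\<close>, \<open>Q\<close> and \<open>hyp_embed z\<close> is zero, and the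
  coordinates of \<open>z\<close> with respect to \<open>P\<close> and \<open>Q\<close> are a hyperbolic cosine and sine.
\<close>
lemma side_eq_0_iff:
  assumes c: "c \<in> unit_speed_geodesics" and z: "z \<in> hyp_plane"
  shows "side c z = 0 \<longleftrightarrow> z \<in> range c"
proof -
  obtain P Q where PQ: "lorentz P P = 1" "lorentz P Q = 0" "lorentz Q Q = -1"
    and ct: "\<And>t. hyp_embed (c t) = cosh t *\<^sub>R P + sinh t *\<^sub>R Q" and N: "geodesic_normal c = lorentz_cross P Q"
    using geodesic_frame[OF c] by blast
  show ?thesis
  proof
    assume "z \<in> range c"
    then show "side c z = 0"
      by (auto simp: side_def N ct lorentz_linear lorentz_cross_orthogonal)
  next
    assume s0: "side c z = 0"
    define u v where "u = lorentz (hyp_embed z) P" and "v = lorentz (hyp_embed z) Q"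
    have uv: "lorentz P (hyp_embed z) = u" "lorentz Q (hyp_embed z) = v"
      by (simp_all add: u_def v_def lorentz_commute)
    have one: "u\<^sup>2 - v\<^sup>2 = 1"
      using s0 lorentz_cross_gram[of P Q "hyp_embed z"] PQ z
      by (simp add: side_def N uv lorentz_embed_self)
    have P: "P = hyp_embed (c 0)" using ct[of 0] by simp
    have "u \<ge> 1" unfolding u_def P by (rule lorentz_embed_ge1[OF z unit_speed_in_plane[OF c]])
    define t where "t = arsinh (- v)"
    have st: "sinh t = - v" by (simp add: t_def)
    then have "(cosh t)\<^sup>2 = u\<^sup>2" using one by (simp add: cosh_square_eq)
    then have cht: "cosh t = u" using \<open>u \<ge> 1\<close> by (simp add: power2_eq_iff_nonneg)
    have "lorentz (hyp_embed z) (hyp_embed (c t)) = u * u - v * v"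
      by (simp add: ct lorentz_linear st cht u_def[symmetric] v_def[symmetric])
    also have "\<dots> = cosh 0" using one by (simp add: power2_eq_square)
    finally have "hyp_dist z (c t) = 0"
      by (intro hyp_dist_eqI z unit_speed_in_plane[OF c]) auto
    then have "z = c t" using hyp_dist_eq_0[OF z unit_speed_in_plane[OF c]] by simp
    then show "z \<in> range c" by simp
  qed
qed

lemma side_square_le:
  assumes c: "c \<in> unit_speed_geodesics" and z: "z \<in> hyp_plane"
  shows "(side c z)\<^sup>2 \<le> (cosh (hyp_dist z (c t)))\<^sup>2 - 1"
proof -
  obtain P Q where PQ: "lorentz P P = 1" "lorentz P Q = 0" "lorentz Q Q = -1"
    and ct: "\<And>t. hyp_embed (c t) = cosh t *\<^sub>R P + sinh t *\<^sub>R Q" and N: "geodesic_normal c = lorentz_cross P Q"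
    using geodesic_frame[OF c] by blast
  define u v where "u = lorentz (hyp_embed z) P" and "v = lorentz (hyp_embed z) Q"
  have uv: "lorentz P (hyp_embed z) = u" "lorentz Q (hyp_embed z) = v"
    by (simp_all add: u_def v_def lorentz_commute)
  have one: "(side c z)\<^sup>2 = u\<^sup>2 - v\<^sup>2 - 1"
    using lorentz_cross_gram[of P Q "hyp_embed z"] PQ z
    by (simp add: side_def N uv lorentz_embed_self)
  have "cosh (hyp_dist z (c t)) = u * cosh t + v * sinh t"
    unfolding lorentz_embed[OF z unit_speed_in_plane[OF c], symmetric]
    by (simp add: ct lorentz_linear u_def v_def)
  then have "(cosh (hyp_dist z (c t)))\<^sup>2 = u\<^sup>2 * (cosh t)\<^sup>2 + v\<^sup>2 * (sinh t)\<^sup>2 + 2 * u * v * cosh t * sinh t"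
    by (simp add: power2_eq_square algebra_simps)
  also have "\<dots> = u\<^sup>2 - v\<^sup>2 + (u * sinh t + v * cosh t)\<^sup>2"
    unfolding power2_sum power_mult_distrib cosh_square_eq by (simp add: algebra_simps)
  also have "\<dots> \<ge> u\<^sup>2 - v\<^sup>2" by simp
  finally show ?thesis using one by simp
qed

lemma side_along_geodesic:
  assumes "c' \<in> unit_speed_geodesics"
  obtains a b where "\<And>t. side c (c' t) = a * cosh t + b * sinh t"
proof -
  obtain P Q where "\<And>t. hyp_embed (c' t) = cosh t *\<^sub>R P + sinh t *\<^sub>R Q"
    using geodesic_frame[OF assms] by metis
  then show thesis
    by (intro that[of "lorentz (geodesic_normal c) P" "lorentz (geodesic_normal c) Q"])
      (simp add: side_def lorentz_linear)
qed

text \<open>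
  Follow the perpendicular of the geodesic at \<open>c t\<close> for unit time in both directions.
\<close>
lemma points_beside_geodesic:
  assumes c: "c \<in> unit_speed_geodesics"
  obtains x y where "x \<in> hyp_plane" "hyp_dist x (c t) = 1" "side c x > 0"
    "y \<in> hyp_plane" "hyp_dist y (c t) = 1" "side c y < 0"
proof -
  obtain P Q where PQ: "lorentz P P = 1" "lorentz P Q = 0" "lorentz Q Q = -1"
    and ct: "\<And>t. hyp_embed (c t) = cosh t *\<^sub>R P + sinh t *\<^sub>R Q" and N: "geodesic_normal c = lorentz_cross P Q"
    using geodesic_frame[OF c] by blast
  define n where "n = geodesic_normal c"
  have nn: "lorentz n n = -1" using PQ by (simp add: n_def N lorentz_cross_square)
  have nc: "lorentz n (hyp_embed (c t)) = 0"
    by (simp add: n_def N ct lorentz_linear lorentz_cross_orthogonal)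
  then have nc': "lorentz (hyp_embed (c t)) n = 0" by (simp add: lorentz_commute)
  have cH: "c t \<in> hyp_plane" by (rule unit_speed_in_plane[OF c])
  have ex: "\<exists>x \<in> hyp_plane. hyp_dist x (c t) = 1 \<and> side c x = e * sinh 1" if e: "e * e = 1" for e
  proof -
    define Y where "Y = cosh 1 *\<^sub>R hyp_embed (c t) - (e * sinh 1) *\<^sub>R n"
    have "lorentz Y Y = cosh 1 * cosh 1 - (e * e) * (sinh 1 * sinh 1)"
      using nc nc' nn cH by (simp add: Y_def lorentz_linear lorentz_embed_self algebra_simps)
    also have "\<dots> = 1" using cosh_square_eq[of "1::real"] by (simp add: e power2_eq_square)
    finally have YY: "lorentz Y Y = 1" .
    have Yc: "lorentz Y (hyp_embed (c t)) = cosh 1"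
      using nc cH by (simp add: Y_def lorentz_linear lorentz_embed_self)
    then obtain x where x: "x \<in> hyp_plane" "hyp_embed x = Y"
      using hyp_embed_surj[OF YY cH] by (metis cosh_real_pos)
    then have "hyp_dist x (c t) = 1" using Yc cH by (intro hyp_dist_eqI) auto
    moreover have "side c x = e * sinh 1"
      by (simp add: side_def n_def[symmetric] x Y_def lorentz_linear nc nn)
    ultimately show ?thesis using x by blast
  qed
  obtain x y where "x \<in> hyp_plane" "hyp_dist x (c t) = 1" "side c x = 1 * sinh 1"
    "y \<in> hyp_plane" "hyp_dist y (c t) = 1" "side c y = -1 * sinh 1"
    using ex[of 1] ex[of "-1"] by auto
  then show thesis using that by auto
qed

text \<open>
  An isometric embedding of the real line into itself is onto.
\<close>
lemma geodesic_subset_imp_eq: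
  assumes c: "c \<in> unit_speed_geodesics" and c': "c' \<in> unit_speed_geodesics" and sub: "range c \<subseteq> range c'"
  shows "range c = range c'"
proof -
  have "\<forall>t. \<exists>s. c t = c' s" using sub by blast
  then obtain f where f: "\<And>t. c t = c' (f t)" by metis
  have iso: "\<bar>f s - f t\<bar> = \<bar>s - t\<bar>" for s t
    using unit_speed_dist[OF c, of s t] unit_speed_dist[OF c', of "f s" "f t"] by (simp add: f)
  have "c' s \<in> range c" for s
  proof -
    define t where "t = s - f 0"
    have "\<bar>f t - f 0\<bar> = \<bar>t\<bar>" "\<bar>f (-t) - f 0\<bar> = \<bar>t\<bar>" "\<bar>f t - f (-t)\<bar> = 2 * \<bar>t\<bar>"
      using iso[of t 0] iso[of "-t" 0] iso[of t "-t"] by auto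
    moreover from this have "f t - f 0 = t \<or> f t - f 0 = - t" "f (-t) - f 0 = t \<or> f (-t) - f 0 = - t"
      by (simp_all only: abs_eq_iff)
    ultimately have "f t - f 0 = t \<or> f (-t) - f 0 = t" by fastforce
    then have "f t = s \<or> f (-t) = s" by (auto simp: t_def)
    then show ?thesis using f[of t] f[of "-t"] by (metis rangeI)
  qed
  then show ?thesis using sub by auto
qed

lemma geodesic_unique:
  assumes c: "c \<in> unit_speed_geodesics" and c': "c' \<in> unit_speed_geodesics"
    and "s \<noteq> t" "c s \<in> range c'" "c t \<in> range c'"
  shows "range c = range c'"
proof (rule geodesic_subset_imp_eq[OF c c'])
  obtain a b where ab: "\<And>t. side c' (c t) = a * cosh t + b * sinh t"
    using side_along_geodesic[OF c] by blast
  have 1: "a * cosh s + b * sinh s = 0" and 2: "a * cosh t + b * sinh t = 0"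
    using assms side_eq_0_iff[OF c' unit_speed_in_plane[OF c]] ab by auto
  have "a * sinh (t - s) = sinh t * (a * cosh s + b * sinh s) - sinh s * (a * cosh t + b * sinh t)"
    by (simp add: sinh_diff algebra_simps)
  moreover have "b * sinh (t - s) = cosh s * (a * cosh t + b * sinh t) - cosh t * (a * cosh s + b * sinh s)"
    by (simp add: sinh_diff algebra_simps)
  moreover have "sinh (t - s) \<noteq> 0" using \<open>s \<noteq> t\<close> by simp
  ultimately have "a = 0" "b = 0" using 1 2 by auto
  then show "range c \<subseteq> range c'"
    using ab side_eq_0_iff[OF c' unit_speed_in_plane[OF c]] by auto
qed

lemma geodesics_unique:
  assumes "\<gamma> \<in> geodesics" "\<delta> \<in> geodesics" "x \<noteq> y" "x \<in> \<gamma>" "y \<in> \<gamma>" "x \<in> \<delta>" "y \<in> \<delta>"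
  shows "\<gamma> = \<delta>"
proof -
  obtain c c' where c: "c \<in> unit_speed_geodesics" "\<gamma> = range c" "c' \<in> unit_speed_geodesics" "\<delta> = range c'"
    using assms(1,2) by (auto simp: geodesics_def)
  obtain s t where "x = c s" "y = c t" using assms c by auto
  then show ?thesis using geodesic_unique[OF c(1,3), of s t] assms c by auto
qed

text \<open>
  The function \<open>side c' (c t)\<close> is a combination of \<open>exp t\<close> and \<open>exp (- t)\<close>; being bounded along two
  sequences of times tending to \<open>\<infinity>\<close> and to \<open>-\<infinity>\<close>, it vanishes.
\<close>
lemma geodesic_eq_if_bounded:
  assumes c: "c \<in> unit_speed_geodesics" and c': "c' \<in> unit_speed_geodesics"
    and far: "\<And>T. \<exists>t\<ge>T. \<exists>v\<in>range c'. hyp_dist (c t) v \<le> r"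
      "\<And>T. \<exists>t\<le>T. \<exists>v\<in>range c'. hyp_dist (c t) v \<le> r"
  shows "range c = range c'"
proof (rule geodesic_subset_imp_eq[OF c c'])
  obtain a b where ab: "\<And>t. side c' (c t) = a * cosh t + b * sinh t"
    using side_along_geodesic[OF c] by blast
  obtain t0 s0 where "hyp_dist (c t0) (c' s0) \<le> r" using far(1) by blast
  then have r: "r \<ge> 0"
    using hyp_dist_nonneg[OF unit_speed_in_plane[OF c] unit_speed_in_plane[OF c'], of t0 s0] by linarith
  define M where "M = cosh r"
  have bound: "\<bar>a * cosh t + b * sinh t\<bar> \<le> M" if v_in: "v \<in> range c'" and v_near: "hyp_dist (c t) v \<le> r" for t v
  proof -
    obtain s where v: "v = c' s" using v_in by auto
    have "cosh (hyp_dist (c t) v) \<le> M"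
      using v_near hyp_dist_le_iff[OF unit_speed_in_plane[OF c] _ r, of v t] unit_speed_in_plane[OF c'] v by (auto simp: M_def)
    then have "(cosh (hyp_dist (c t) v))\<^sup>2 \<le> M\<^sup>2" by (intro power_mono) auto
    then have "(side c' (c t))\<^sup>2 \<le> M\<^sup>2"
      using side_square_le[OF c' unit_speed_in_plane[OF c], of t s] v by simp
    then have "\<bar>side c' (c t)\<bar> \<le> \<bar>M\<bar>" by (rule abs_le_square_iff[THEN iffD2])
    then show ?thesis by (simp add: ab M_def)
  qed
  have large: "e = 0" if unbounded: "\<And>T. \<exists>t\<ge>T. \<bar>d * exp (- t) + e * exp t\<bar> \<le> 2 * M" for d e :: real
  proof (rule ccontr)
    assume e: "e \<noteq> 0"
    define T where "T = max 0 (ln ((2 * M + \<bar>d\<bar> + 1) / \<bar>e\<bar>))"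
    have M: "M > 0" by (simp add: M_def)
    obtain t where t: "t \<ge> T" "\<bar>d * exp (- t) + e * exp t\<bar> \<le> 2 * M" using unbounded by blast
    have "(2 * M + \<bar>d\<bar> + 1) / \<bar>e\<bar> \<le> exp t"
      using t(1) e M by (subst ln_le_cancel_iff[symmetric]) (auto simp: T_def)
    then have "2 * M + \<bar>d\<bar> + 1 \<le> \<bar>e * exp t\<bar>" using e by (simp add: field_simps abs_mult)
    moreover have "\<bar>d * exp (- t)\<bar> \<le> \<bar>d\<bar>"
      using t(1) by (simp add: abs_mult T_def mult_left_le)
    ultimately show False using t(2) by linarith
  qed
  have exp_form: "2 * (a * cosh t + b * sinh t) = (a - b) * exp (- t) + (a + b) * exp t" for t
    by (simp add: cosh_def sinh_def field_simps)
  have "a + b = 0"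
  proof (rule large[of "a - b"])
    fix T
    obtain t v where "t \<ge> T" "v \<in> range c'" "hyp_dist (c t) v \<le> r" using far(1) by blast
    then show "\<exists>t\<ge>T. \<bar>(a - b) * exp (- t) + (a + b) * exp t\<bar> \<le> 2 * M"
      using bound[of v t] exp_form[of t] by (intro exI[of _ t]) auto
  qed
  moreover have "a - b = 0"
  proof (rule large[of "a + b"])
    fix T
    obtain t v where "t \<le> - T" "v \<in> range c'" "hyp_dist (c t) v \<le> r" using far(2) by blast
    then show "\<exists>t\<ge>T. \<bar>(a + b) * exp (- t) + (a - b) * exp t\<bar> \<le> 2 * M"
      using bound[of v t] exp_form[of t] by (intro exI[of _ "-t"]) (auto simp: add.commute)
  qed
  ultimately have "a = 0" "b = 0" by auto
  then show "range c \<subseteq> range c'"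
    using ab side_eq_0_iff[OF c' unit_speed_in_plane[OF c]] by auto
qed

lemma hyp_segment_commute: "hyp_segment x y = hyp_segment y x"
  by (auto simp: hyp_segment_def hyp_dist_commute add.commute)

lemma hyp_segment_self: "x \<in> hyp_plane \<Longrightarrow> hyp_segment x x = {x}"
  using hyp_dist_eq_0[of x] hyp_dist_nonneg[of x]
  by (auto simp: hyp_segment_def hyp_dist_self hyp_dist_commute)

lemma ends_in_segment:
  "x \<in> hyp_plane \<Longrightarrow> x \<in> hyp_segment x y" "y \<in> hyp_plane \<Longrightarrow> y \<in> hyp_segment x y"
  by (auto simp: hyp_segment_def hyp_dist_self)

lemma hyp_segment_in_plane: "z \<in> hyp_segment x y \<Longrightarrow> z \<in> hyp_plane"
  by (simp add: hyp_segment_def)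

lemma segment_of_geodesic:
  assumes c: "c \<in> unit_speed_geodesics" and "s \<le> t"
  shows "hyp_segment (c s) (c t) = c ` {s..t}"
proof (intro subset_antisym subsetI)
  fix z assume "z \<in> c ` {s..t}"
  then show "z \<in> hyp_segment (c s) (c t)"
    using c assms by (auto simp: hyp_segment_def unit_speed_dist unit_speed_in_plane)
next
  fix z assume z: "z \<in> hyp_segment (c s) (c t)"
  show "z \<in> c ` {s..t}"
  proof (cases "s = t")
    case True
    then show ?thesis using z hyp_segment_self unit_speed_in_plane[OF c] by auto
  next
    case False
    have H: "c u \<in> hyp_plane" for u by (rule unit_speed_in_plane[OF c])
    have zH: "z \<in> hyp_plane" "hyp_dist (c s) z + hyp_dist z (c t) = t - s"
      using z c \<open>s \<le> t\<close> by (auto simp: hyp_segment_def unit_speed_dist)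
    define u where "u = s + hyp_dist (c s) z"
    have u: "s \<le> u" "u \<le> t" using zH hyp_dist_nonneg[OF H zH(1)] hyp_dist_nonneg[OF zH(1) H, of t]
      by (auto simp: u_def)
    have ne: "c s \<noteq> c t" using False unit_speed_dist[OF c, of s t] hyp_dist_self[OF H, of s] by auto
    have d: "hyp_dist (c s) (c u) = hyp_dist (c s) z" "hyp_dist (c u) (c t) = hyp_dist z (c t)"
      using u zH by (auto simp: unit_speed_dist[OF c] u_def)
    have "hyp_embed z = hyp_embed (c u)"
      using hyp_embed_between[OF H H zH(1) _ ne] hyp_embed_between[OF H H H[of u] _ ne] d zH(2) u
        unit_speed_dist[OF c, of s t] \<open>s \<le> t\<close> by simp
    then have "z = c u" using hyp_embed_inj zH H by blast
    then show ?thesis using u by auto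
  qed
qed

lemma segment_subset_geodesic:
  assumes "c \<in> unit_speed_geodesics" "x \<in> range c" "y \<in> range c"
  shows "hyp_segment x y \<subseteq> range c"
proof -
  obtain s t where st: "x = c s" "y = c t" using assms by auto
  show ?thesis
  proof (cases "s \<le> t")
    case True
    then show ?thesis using segment_of_geodesic[OF assms(1) True] by (auto simp: st)
  next
    case False
    then have "hyp_segment y x = c ` {t..s}" using segment_of_geodesic[OF assms(1), of t s] by (simp add: st)
    then show ?thesis by (auto simp: hyp_segment_commute[of x y])
  qed
qed

lemma side_on_segment:
  assumes "x \<in> hyp_plane" "y \<in> hyp_plane" "z \<in> hyp_segment x y"
  obtains l m where "l \<ge> 0" "m \<ge> 0" "\<And>c. side c z = l * side c x + m * side c y"
    "z \<noteq> y \<Longrightarrow> l > 0" "z \<noteq> x \<Longrightarrow> m > 0"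
proof -
  obtain l m where "l \<ge> 0" "m \<ge> 0" "hyp_embed z = l *\<^sub>R hyp_embed x + m *\<^sub>R hyp_embed y"
    "z \<noteq> y \<Longrightarrow> l > 0" "z \<noteq> x \<Longrightarrow> m > 0" using segment_coordinates[OF assms] by blast
  then show thesis using that by (simp add: side_def lorentz_linear)
qed

text \<open>
  This turns incidence with a segment into a closed condition on the geodesic, which is what
  makes the corresponding sets of geodesics measurable.
\<close>
lemma geodesic_meets_segment_iff:
  assumes c: "c \<in> unit_speed_geodesics" and x: "x \<in> hyp_plane" and y: "y \<in> hyp_plane"
  shows "range c \<inter> hyp_segment x y \<noteq> {} \<longleftrightarrow> side c x * side c y \<le> 0"
proof
  assume "range c \<inter> hyp_segment x y \<noteq> {}"
  then obtain z where z: "z \<in> range c" "z \<in> hyp_segment x y" by blast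
  obtain l m where lm: "l \<ge> 0" "m \<ge> 0" "\<And>c. side c z = l * side c x + m * side c y"
    "z \<noteq> y \<Longrightarrow> l > 0" "z \<noteq> x \<Longrightarrow> m > 0" using side_on_segment[OF x y z(2)] by blast
  have s0: "side c z = 0" using z side_eq_0_iff[OF c hyp_segment_in_plane[OF z(2)]] by simp
  show "side c x * side c y \<le> 0"
  proof (cases "z = x \<or> z = y")
    case True
    then show ?thesis using s0 by auto
  next
    case False
    have "l > 0" "m > 0" using lm False by auto
    have "l * side c x = - (m * side c y)" using lm(3)[of c] s0 by linarith
    then have "l * side c x * side c y = - (m * side c y) * side c y" by simp
    then have "l * (side c x * side c y) = - (m * (side c y)\<^sup>2)"
      by (simp only: power2_eq_square mult.assoc mult_minus_left)
    with \<open>m > 0\<close> have "l * (side c x * side c y) \<le> 0" by simp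
    then show ?thesis using \<open>l > 0\<close> by (simp add: mult_le_0_iff)
  qed
next
  assume le: "side c x * side c y \<le> 0"
  show "range c \<inter> hyp_segment x y \<noteq> {}"
  proof (cases "side c x = 0 \<or> side c y = 0")
    case True
    then show ?thesis using side_eq_0_iff[OF c] x y ends_in_segment by blast
  next
    case False
    then obtain z where z: "z \<in> hyp_segment x y"
      "hyp_embed z = (1 / sqrt ((\<bar>side c y\<bar>)\<^sup>2 + (\<bar>side c x\<bar>)\<^sup>2 + 2 * \<bar>side c y\<bar> * \<bar>side c x\<bar> * cosh (hyp_dist x y))) *\<^sub>R
         (\<bar>side c y\<bar> *\<^sub>R hyp_embed x + \<bar>side c x\<bar> *\<^sub>R hyp_embed y)"
      using positive_combination_in_segment[OF x y, of "\<bar>side c y\<bar>" "\<bar>side c x\<bar>"] by auto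
    have "\<bar>side c y\<bar> * side c x + \<bar>side c x\<bar> * side c y = 0"
      using le False by (auto simp: mult_le_0_iff abs_if)
    then have "side c z = 0" unfolding side_def z(2) by (simp add: lorentz_linear)
    then show ?thesis using side_eq_0_iff[OF c hyp_segment_in_plane[OF z(1)]] z(1) by blast
  qed
qed

section \<open>The contribution of a geodesic to the dual distance\<close>

definition meeting :: "complex set \<Rightarrow> complex set set" where
  "meeting A = {\<gamma> \<in> geodesics. \<gamma> \<inter> A \<noteq> {}}"

text \<open>
  The contribution of a single geodesic to the dual distance of \<open>x\<close> and \<open>y\<close>. It is written with sets
  of geodesics, and not with \<open>side\<close>, because geodesics are neither oriented nor parametrized.
\<close>
definition crossing :: "complex \<Rightarrow> complex \<Rightarrow> complex set \<Rightarrow> real" where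
  "crossing x y \<gamma> =
     (indicator (meeting (hyp_segment x y) - meeting {y}) \<gamma> +
      indicator (meeting (hyp_segment x y) - meeting {x}) \<gamma>) / 2"

lemma geodesics_obtain:
  assumes "\<gamma> \<in> geodesics"
  obtains c where "c \<in> unit_speed_geodesics" "\<gamma> = range c"
  using assms by (auto simp: geodesics_def)

lemma range_in_geodesics: "c \<in> unit_speed_geodesics \<Longrightarrow> range c \<in> geodesics"
  by (auto simp: geodesics_def)

lemma geodesic_in_plane: "\<gamma> \<in> geodesics \<Longrightarrow> x \<in> \<gamma> \<Longrightarrow> x \<in> hyp_plane"
  by (auto simp: geodesics_def unit_speed_geodesics_def)

lemma segment_in_geodesic:
  assumes "\<gamma> \<in> geodesics" "x \<in> \<gamma>" "y \<in> \<gamma>"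
  shows "hyp_segment x y \<subseteq> \<gamma>"
proof -
  obtain c where c: "c \<in> unit_speed_geodesics" "\<gamma> = range c" using geodesics_obtain[OF assms(1)] .
  then show ?thesis using segment_subset_geodesic[OF c(1)] assms by simp
qed

text \<open>
  For \<open>x \<noteq> y\<close>, a geodesic that contains the half-open segment also contains its end \<open>y\<close>, and a
  geodesic through \<open>y\<close> and another point of the segment contains all of it.
\<close>
lemma transverse_half_open_segment:
  assumes x: "x \<in> hyp_plane" and y: "y \<in> hyp_plane"
  shows "transverse_geodesics (hyp_segment x y - {y}) = meeting (hyp_segment x y) - meeting {y}"
proof (cases "x = y")
  case True
  then show ?thesis using hyp_segment_self[OF y] by (auto simp: transverse_geodesics_def)
next
  case False
  have "\<gamma> \<in> transverse_geodesics (hyp_segment x y - {y}) \<longleftrightarrow> \<gamma> \<in> meeting (hyp_segment x y) - meeting {y}"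
    if g: "\<gamma> \<in> geodesics" for \<gamma>
  proof -
    obtain c where c: "c \<in> unit_speed_geodesics" and \<gamma>: "\<gamma> = range c" using geodesics_obtain[OF g] .
    show ?thesis
    proof
      assume tr: "\<gamma> \<in> transverse_geodesics (hyp_segment x y - {y})"
      then obtain z where z: "z \<in> \<gamma>" "z \<in> hyp_segment x y" "z \<noteq> y"
        and nsub: "\<not> hyp_segment x y - {y} \<subseteq> \<gamma>" by (auto simp: transverse_geodesics_def)
      obtain l m where "\<And>c. side c z = l * side c x + m * side c y" "z \<noteq> y \<Longrightarrow> l > 0"
        using side_on_segment[OF x y z(2)] by metis
      then have lm: "side c z = l * side c x + m * side c y" "l > 0" using z by auto
      have "y \<notin> \<gamma>"
      proof
        assume "y \<in> \<gamma>"
        then have "side c y = 0" "side c z = 0"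
          using z \<gamma> side_eq_0_iff[OF c] y hyp_segment_in_plane by auto
        then have "x \<in> range c" using lm side_eq_0_iff[OF c x] by simp
        then show False using segment_subset_geodesic[OF c] \<open>y \<in> \<gamma>\<close> \<gamma> nsub by blast
      qed
      then show "\<gamma> \<in> meeting (hyp_segment x y) - meeting {y}" using z g by (auto simp: meeting_def)
    next
      assume m: "\<gamma> \<in> meeting (hyp_segment x y) - meeting {y}"
      obtain b where b: "b \<in> unit_speed_geodesics" "b 0 = x" "b (hyp_dist x y) = y"
        using geodesic_through[OF x y False] .
      define d where "d = hyp_dist x y"
      have d: "d > 0" using hyp_dist_nonneg[OF x y] hyp_dist_eq_0[OF x y] False by (simp add: d_def)
      have inj: "b s = b t \<longleftrightarrow> s = t" for s t
        using unit_speed_dist[OF b(1), of s t] hyp_dist_self[OF unit_speed_in_plane[OF b(1)], of t] by auto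
      have seg: "hyp_segment x y = b ` {0..d}" using segment_of_geodesic[OF b(1), of 0 d] b d by (simp add: d_def)
      have "\<not> hyp_segment x y - {y} \<subseteq> \<gamma>"
      proof
        assume sub: "hyp_segment x y - {y} \<subseteq> \<gamma>"
        have y': "y = b d" using b by (simp add: d_def)
        have "b 0 \<in> hyp_segment x y - {y}" "b (d / 2) \<in> hyp_segment x y - {y}"
          using d unfolding seg by (auto simp: y' inj)
        then have "\<gamma> = range b"
          using sub d by (intro geodesics_unique[OF g range_in_geodesics[OF b(1)], of "b 0" "b (d/2)"]) (auto simp: inj)
        then show False using m y' g by (auto simp: meeting_def)
      qed
      then show "\<gamma> \<in> transverse_geodesics (hyp_segment x y - {y})"
        using m by (auto simp: meeting_def transverse_geodesics_def)
    qed
  qed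
  then show ?thesis by (auto simp: transverse_geodesics_def meeting_def)
qed

text \<open>
  The factor \<open>1/2\<close> of a geodesic through exactly one endpoint matches the value \<open>0\<close> of the sign
  function on the geodesic; a geodesic through both endpoints has weight \<open>0\<close>.
\<close>
lemma crossing_eq_sgn:
  assumes c: "c \<in> unit_speed_geodesics" and x: "x \<in> hyp_plane" and y: "y \<in> hyp_plane"
  shows "crossing x y (range c) = \<bar>sgn (side c x) - sgn (side c y)\<bar> / 2"
proof -
  have 1: "range c \<in> meeting (hyp_segment x y) \<longleftrightarrow> side c x * side c y \<le> 0"
    using geodesic_meets_segment_iff[OF c x y] range_in_geodesics[OF c] by (simp add: meeting_def)
  have 2: "range c \<in> meeting {z} \<longleftrightarrow> side c z = 0" if "z \<in> hyp_plane" for z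
    using side_eq_0_iff[OF c that] range_in_geodesics[OF c] by (auto simp: meeting_def)
  show ?thesis
    unfolding crossing_def indicator_def Diff_iff 1 2[OF x] 2[OF y]
    by (cases "side c x" "0::real" rule: linorder_cases; cases "side c y" "0::real" rule: linorder_cases)
       (auto simp: mult_le_0_iff sgn_if)
qed

lemma crossing_nonneg: "0 \<le> crossing x y \<gamma>"
  by (simp add: crossing_def)

lemma crossing_le_indicator: "crossing x y \<gamma> \<le> indicator (meeting (hyp_segment x y)) \<gamma>"
  by (auto simp: crossing_def indicator_def)

lemma crossing_triangle:
  assumes g: "\<gamma> \<in> geodesics" and H: "x \<in> hyp_plane" "y \<in> hyp_plane" "z \<in> hyp_plane"
  shows "crossing x z \<gamma> \<le> crossing x y \<gamma> + crossing y z \<gamma>"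
proof -
  obtain c where c: "c \<in> unit_speed_geodesics" and \<gamma>: "\<gamma> = range c" using geodesics_obtain[OF g] .
  show ?thesis unfolding \<gamma> using H by (simp add: crossing_eq_sgn[OF c])
qed

text \<open>
  Since \<open>side c z\<close> is a positive combination of \<open>side c x\<close> and \<open>side c y\<close>, its sign lies between
  their signs.
\<close>
lemma crossing_additive:
  assumes g: "\<gamma> \<in> geodesics" and x: "x \<in> hyp_plane" and y: "y \<in> hyp_plane" and z: "z \<in> hyp_segment x y"
  shows "crossing x y \<gamma> = crossing x z \<gamma> + crossing z y \<gamma>"
proof -
  obtain c where c: "c \<in> unit_speed_geodesics" and \<gamma>: "\<gamma> = range c" using geodesics_obtain[OF g] .
  note cr = crossing_eq_sgn[OF c]
  have zH: "z \<in> hyp_plane" by (rule hyp_segment_in_plane[OF z])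
  show ?thesis
  proof (cases "z = x \<or> z = y")
    case True
    then show ?thesis using x y by (auto simp: \<gamma> cr)
  next
    case False
    obtain l m where s: "side c z = l * side c x + m * side c y"
      and "z \<noteq> y \<Longrightarrow> l > 0" "z \<noteq> x \<Longrightarrow> m > 0" using side_on_segment[OF x y z] by metis
    then have lm: "l > 0" "m > 0" using False by auto
    consider "side c x = 0" | "side c y = 0" | "side c x > 0" "side c y > 0" | "side c x < 0" "side c y < 0"
      | "side c x > 0" "side c y < 0" | "side c x < 0" "side c y > 0" by linarith
    then show ?thesis
    proof cases
      case 1
      then have "sgn (side c z) = sgn (side c y)" using lm by (simp add: s sgn_mult)
      then show ?thesis unfolding \<gamma> using x y zH by (simp add: cr)
    next
      case 2
      then have "sgn (side c z) = sgn (side c x)" using lm by (simp add: s sgn_mult)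
      then show ?thesis unfolding \<gamma> using x y zH by (simp add: cr)
    next
      case 3
      then have "side c z > 0" using lm by (simp add: s add_pos_pos)
      then show ?thesis unfolding \<gamma> using x y zH 3 by (simp add: cr)
    next
      case 4
      then have "side c z < 0" using lm by (simp add: s add_neg_neg mult_pos_neg)
      then show ?thesis unfolding \<gamma> using x y zH 4 by (simp add: cr)
    next
      case 5
      then show ?thesis unfolding \<gamma> using x y zH
        by (cases "side c z" "0::real" rule: linorder_cases) (simp_all add: cr)
    next
      case 6
      then show ?thesis unfolding \<gamma> using x y zH
        by (cases "side c z" "0::real" rule: linorder_cases) (simp_all add: cr)
    qed
  qed
qed

text \<open>
  If the geodesic misses the segment from \<open>x\<close> to \<open>y\<close>, then both points are on the same side and the
  terms cancel; likewise for \<open>z\<close> and \<open>w\<close>.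
\<close>
lemma crossing_four_points:
  assumes g: "\<gamma> \<in> geodesics" and H: "x \<in> hyp_plane" "y \<in> hyp_plane" "z \<in> hyp_plane" "w \<in> hyp_plane"
  shows "\<bar>crossing x z \<gamma> + crossing y w \<gamma> - crossing x w \<gamma> - crossing y z \<gamma>\<bar>
    \<le> 2 * indicator (meeting (hyp_segment x y) \<inter> meeting (hyp_segment z w)) \<gamma>"
proof -
  obtain c where c: "c \<in> unit_speed_geodesics" and \<gamma>: "\<gamma> = range c" using geodesics_obtain[OF g] .
  note cr = crossing_eq_sgn[OF c]
  have same: "sgn (side c p) = sgn (side c q)"
    if "p \<in> hyp_plane" "q \<in> hyp_plane" "\<gamma> \<notin> meeting (hyp_segment p q)" for p q
  proof -
    have "side c p * side c q > 0"
      using that geodesic_meets_segment_iff[OF c that(1,2)] g by (auto simp: meeting_def \<gamma>)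
    then show ?thesis by (auto simp: zero_less_mult_iff)
  qed
  show ?thesis
  proof (cases "\<gamma> \<in> meeting (hyp_segment x y) \<inter> meeting (hyp_segment z w)")
    case True
    have le1: "crossing p q \<gamma> \<le> 1" for p q
      by (rule order_trans[OF crossing_le_indicator]) (simp add: indicator_def)
    have "crossing x z \<gamma> + crossing y w \<gamma> \<le> 2" "crossing x w \<gamma> + crossing y z \<gamma> \<le> 2"
      using le1[of x z] le1[of y w] le1[of x w] le1[of y z] by linarith+
    then show ?thesis using True crossing_nonneg[of x z \<gamma>] crossing_nonneg[of y w \<gamma>]
       crossing_nonneg[of x w \<gamma>] crossing_nonneg[of y z \<gamma>] by (simp add: abs_le_iff)
  next
    case False
    then have "sgn (side c x) = sgn (side c y) \<or> sgn (side c z) = sgn (side c w)" using same H by blast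
    then show ?thesis using False H by (auto simp: \<gamma> cr)
  qed
qed

lemma crossing_four_points_separated:
  assumes c: "c \<in> unit_speed_geodesics"
    and H: "x \<in> hyp_plane" "y \<in> hyp_plane" "z \<in> hyp_plane" "w \<in> hyp_plane"
    and sides: "side c x > 0" "side c y < 0" "side c z > 0" "side c w < 0"
  shows "crossing x z (range c) + crossing y w (range c) - crossing x w (range c) - crossing y z (range c) = -2"
  using H sides by (simp add: crossing_eq_sgn[OF c])

section \<open>Fellow travelling\<close>

lemma segment_convex:
  assumes x: "x \<in> hyp_plane" and y: "y \<in> hyp_plane" and "p \<in> hyp_segment x y" "q \<in> hyp_segment x y"
  shows "hyp_segment p q \<subseteq> hyp_segment x y"
proof (cases "x = y")
  case True
  then show ?thesis using assms hyp_segment_self[OF x] by auto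
next
  case False
  obtain c where c: "c \<in> unit_speed_geodesics" "c 0 = x" "c (hyp_dist x y) = y"
    using geodesic_through[OF x y False] .
  have seg: "hyp_segment x y = c ` {0..hyp_dist x y}"
    using segment_of_geodesic[OF c(1) hyp_dist_nonneg[OF x y]] c by simp
  then obtain a b where ab: "p = c a" "q = c b" "a \<in> {0..hyp_dist x y}" "b \<in> {0..hyp_dist x y}"
    using assms(3,4) by auto
  show ?thesis
  proof (cases "a \<le> b")
    case True
    then show ?thesis using segment_of_geodesic[OF c(1) True] ab by (auto simp: seg)
  next
    case False
    then have "hyp_segment q p = c ` {b..a}" using segment_of_geodesic[OF c(1), of b a] ab by simp
    then show ?thesis using ab by (auto simp: seg hyp_segment_commute[of "c a" "c b"])
  qed
qed

lemma le_2_if_cosh_le_2: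
  assumes "cosh (r::real) \<le> 2" shows "r \<le> 2"
proof (rule ccontr)
  assume "\<not> r \<le> 2"
  have "exp (1::real) \<ge> 2" using exp_ge_add_one_self[of "1::real"] by simp
  then have "exp (1::real) * exp 1 \<ge> 2 * 2" by (intro mult_mono) auto
  then have "exp (2::real) \<ge> 4" by (simp flip: exp_add)
  moreover have "exp (2::real) < exp r" using \<open>\<not> r \<le> 2\<close> by simp
  ultimately have "exp r > 4" by linarith
  then have "4 + 0 < exp r + exp (- r)" by (intro add_strict_mono) auto
  then have "cosh r > 2" by (simp add: cosh_def)
  then show False using assms by simp
qed

lemma thin_quadrilateral:
  assumes "p \<in> hyp_plane" "q \<in> hyp_plane" "p' \<in> hyp_plane" "q' \<in> hyp_plane" and u: "u \<in> hyp_segment p q"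
  shows "\<exists>v \<in> hyp_segment p p' \<union> hyp_segment p' q' \<union> hyp_segment q' q. hyp_dist u v \<le> 4"
proof -
  obtain v where v: "v \<in> hyp_segment p p' \<union> hyp_segment p' q" "hyp_dist u v \<le> 2"
    using thin_triangle[OF assms(1,2,3) u] le_2_if_cosh_le_2 by blast
  show ?thesis
  proof (cases "v \<in> hyp_segment p p'")
    case True
    then show ?thesis using v by force
  next
    case False
    then obtain v' where v': "v' \<in> hyp_segment p' q' \<union> hyp_segment q' q" "hyp_dist v v' \<le> 2"
      using thin_triangle[OF assms(3,2,4)] v le_2_if_cosh_le_2 by blast
    have "hyp_dist u v' \<le> hyp_dist u v + hyp_dist v v'"
      by (rule hyp_dist_triangle) (use u v v' hyp_segment_in_plane in auto)
    then show ?thesis using v v' by force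
  qed
qed

text \<open>
  A point of \<open>c\<close> far from both \<open>c s\<close> and \<open>c t\<close> is not close to the short sides of the quadrilateral
  \<open>c s\<close>, \<open>p\<close>, \<open>q\<close>, \<open>c t\<close>, hence it is close to the side that lies on \<open>\<delta>\<close>.
\<close>
lemma fellow_travelling:
  assumes c: "c \<in> unit_speed_geodesics" and d: "\<delta> \<in> geodesics"
    and pq: "p \<in> \<delta>" "q \<in> \<delta>" "hyp_dist (c s) p \<le> e" "hyp_dist (c t) q \<le> e"
    and u: "u - s > e + 4" "t - u > e + 4"
  shows "\<exists>v\<in>\<delta>. hyp_dist (c u) v \<le> 4"
proof -
  have H: "c r \<in> hyp_plane" for r by (rule unit_speed_in_plane[OF c])
  have pqH: "p \<in> hyp_plane" "q \<in> hyp_plane" using pq geodesic_in_plane[OF d] by auto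
  have e: "e \<ge> 0" using pq(3) hyp_dist_nonneg[OF H pqH(1), of s] by linarith
  have "c u \<in> hyp_segment (c s) (c t)" using u e by (simp add: segment_of_geodesic[OF c])
  then obtain v where v: "v \<in> hyp_segment (c s) p \<union> hyp_segment p q \<union> hyp_segment q (c t)" "hyp_dist (c u) v \<le> 4"
    using thin_quadrilateral[OF H H pqH] by blast
  then have vH: "v \<in> hyp_plane" using hyp_segment_in_plane by blast
  have "v \<notin> hyp_segment (c s) p"
  proof
    assume "v \<in> hyp_segment (c s) p"
    then have "hyp_dist (c s) v \<le> e"
      using pq hyp_dist_nonneg[OF vH pqH(1)] by (simp add: hyp_segment_def)
    moreover have "hyp_dist (c s) (c u) \<le> hyp_dist (c s) v + hyp_dist v (c u)"
      by (rule hyp_dist_triangle[OF H vH H])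
    ultimately show False using v(2) u e unit_speed_dist[OF c, of s u] by (simp add: hyp_dist_commute)
  qed
  moreover have "v \<notin> hyp_segment q (c t)"
  proof
    assume "v \<in> hyp_segment q (c t)"
    then have "hyp_dist v (c t) \<le> e"
      using pq hyp_dist_nonneg[OF pqH(2) vH] by (simp add: hyp_segment_def hyp_dist_commute)
    moreover have "hyp_dist (c u) (c t) \<le> hyp_dist (c u) v + hyp_dist v (c t)"
      by (rule hyp_dist_triangle[OF H vH H])
    ultimately show False using v(2) u e unit_speed_dist[OF c, of u t] by simp
  qed
  ultimately have "v \<in> hyp_segment p q" using v by blast
  then have "v \<in> \<delta>" using segment_in_geodesic[OF d pq(1,2)] by blast
  then show ?thesis using v by blast
qed

text \<open>
  The geodesic \<open>c\<close> passes through \<open>x\<close> and \<open>z\<close>. Cutting off its parts near the two segments leaves an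
  interval of length at least \<open>2 T + 2\<close>, at whose points thin quadrilaterals leave no choice
  but to be close to each geodesic that meets both segments. It is essential that \<open>c\<close> does not depend
  on \<open>\<delta>\<close>.
\<close>
lemma geodesics_between_distant_segments:
  assumes H: "x \<in> hyp_plane" "y \<in> hyp_plane" "z \<in> hyp_plane" "w \<in> hyp_plane" and T: "T \<ge> 0"
    and far: "\<And>a b. a \<in> hyp_segment x y \<Longrightarrow> b \<in> hyp_segment z w \<Longrightarrow> hyp_dist a b \<ge> 2 * T + 10"
  obtains c where "c \<in> unit_speed_geodesics"
    "\<And>\<delta> t. \<delta> \<in> meeting (hyp_segment x y) \<inter> meeting (hyp_segment z w) \<Longrightarrow> \<bar>t\<bar> \<le> T \<Longrightarrow>
       \<exists>v\<in>\<delta>. hyp_dist (c t) v \<le> 4"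
proof -
  define L where "L = hyp_dist x z"
  have L: "L \<ge> 2 * T + 10" using far[of x z] H by (simp add: L_def ends_in_segment)
  then have "x \<noteq> z" using T hyp_dist_self[OF H(1)] by (auto simp: L_def)
  then obtain c where c: "c \<in> unit_speed_geodesics" "c 0 = x" "c L = z"
    using geodesic_through[OF H(1,3)] unfolding L_def by blast
  have cH: "c r \<in> hyp_plane" for r by (rule unit_speed_in_plane[OF c(1)])
  define A where "A = {s. 0 \<le> s \<and> s \<le> L \<and> (\<exists>a\<in>hyp_segment x y. hyp_dist (c s) a \<le> 4)}"
  define B where "B = {s. 0 \<le> s \<and> s \<le> L \<and> (\<exists>b\<in>hyp_segment z w. hyp_dist (c s) b \<le> 4)}"
  \<comment> \<open>The interval between s1 and t1 avoids both A and B. It starts at the last time before t1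
     at which c is close to the first segment and ends when c first comes close to the second.\<close>
  define t1 where "t1 = Inf B"
  define s1 where "s1 = Sup {s \<in> A. s \<le> t1}"
  have gap: "\<bar>s - t\<bar> \<ge> 2 * T + 2" if sA: "s \<in> A" and tB: "t \<in> B" for s t
  proof -
    obtain a where a: "a \<in> hyp_segment x y" "hyp_dist (c s) a \<le> 4" using sA by (auto simp: A_def)
    obtain b where b: "b \<in> hyp_segment z w" "hyp_dist (c t) b \<le> 4" using tB by (auto simp: B_def)
    have "hyp_dist a b \<le> hyp_dist a (c s) + hyp_dist (c s) b"
      by (rule hyp_dist_triangle) (use a b cH hyp_segment_in_plane in auto)
    moreover have "hyp_dist (c s) b \<le> hyp_dist (c s) (c t) + hyp_dist (c t) b"
      by (rule hyp_dist_triangle) (use a b cH hyp_segment_in_plane in auto)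
    ultimately show ?thesis
      using a(2) b(2) far[OF a(1) b(1)] hyp_dist_commute[of a "c s"] unit_speed_dist[OF c(1), of s t] by linarith
  qed
  have "0 \<in> A" using L T H c hyp_dist_self[OF H(1)] ends_in_segment(1)[OF H(1), of y] by (force simp: A_def)
  have "L \<in> B" using L T H c hyp_dist_self[OF H(3)] ends_in_segment(1)[OF H(3), of w] by (force simp: B_def)
  have Bb: "bdd_below B" by (rule bdd_belowI[of _ 0]) (auto simp: B_def)
  have t1: "0 \<le> t1" unfolding t1_def using \<open>L \<in> B\<close> by (intro cInf_greatest) (auto simp: B_def)
  have Ab: "bdd_above {s \<in> A. s \<le> t1}" by (rule bdd_aboveI[of _ t1]) auto
  have width: "s1 + (2 * T + 2) \<le> t1"
  proof -
    have "s + (2 * T + 2) \<le> t" if "s \<in> A" "s \<le> t1" "t \<in> B" for s t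
      using gap[of s t] that cInf_lower[OF that(3) Bb] T by (simp add: t1_def abs_if split: if_splits)
    then have "s + (2 * T + 2) \<le> t1" if "s \<in> A" "s \<le> t1" for s
      unfolding t1_def using that \<open>L \<in> B\<close> by (intro cInf_greatest) (auto simp: t1_def)
    then have "s1 \<le> t1 - (2 * T + 2)"
      unfolding s1_def using \<open>0 \<in> A\<close> t1 by (intro cSup_least) (force simp: algebra_simps)+
    then show ?thesis by simp
  qed
  have s1: "0 \<le> s1" unfolding s1_def using \<open>0 \<in> A\<close> t1 Ab by (intro cSup_upper) auto
  have t1L: "t1 \<le> L" unfolding t1_def using \<open>L \<in> B\<close> Bb by (rule cInf_lower)
  define m where "m = (s1 + t1) / 2"
  have core: "\<exists>v\<in>\<delta>. hyp_dist (c (t + m)) v \<le> 4"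
    if d: "\<delta> \<in> meeting (hyp_segment x y) \<inter> meeting (hyp_segment z w)" and t: "\<bar>t\<bar> \<le> T" for \<delta> t
  proof -
    obtain p q where p: "p \<in> \<delta>" "p \<in> hyp_segment x y" and q: "q \<in> \<delta>" "q \<in> hyp_segment z w" and dg: "\<delta> \<in> geodesics"
      using d by (auto simp: meeting_def)
    define u where "u = t + m"
    have u: "s1 < u" "u < t1" using t width unfolding u_def m_def by (auto simp: abs_le_iff field_simps)
    have "c u \<in> hyp_segment x z"
      using segment_of_geodesic[OF c(1), of 0 L] c L T s1 t1L u by auto
    then obtain v where v: "v \<in> hyp_segment x p \<union> hyp_segment p q \<union> hyp_segment q z" "hyp_dist (c u) v \<le> 4"
      using thin_quadrilateral[OF H(1,3)] p q hyp_segment_in_plane by blast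
    have "v \<notin> hyp_segment x p"
    proof
      assume "v \<in> hyp_segment x p"
      then have "v \<in> hyp_segment x y"
        using segment_convex[OF H(1,2) ends_in_segment(1)[OF H(1)] p(2)] by blast
      then have "u \<in> {s \<in> A. s \<le> t1}" using v u s1 t1L by (auto simp: A_def)
      then have "u \<le> s1" unfolding s1_def using Ab by (rule cSup_upper)
      then show False using u by simp
    qed
    moreover have "v \<notin> hyp_segment q z"
    proof
      assume "v \<in> hyp_segment q z"
      then have "v \<in> hyp_segment z w"
        using segment_convex[OF H(3,4) q(2) ends_in_segment(1)[OF H(3)]] by blast
      then have "u \<in> B" using v u s1 t1L by (auto simp: B_def)
      then have "t1 \<le> u" unfolding t1_def using Bb by (rule cInf_lower)
      then show False using u by simp
    qed
    ultimately have "v \<in> hyp_segment p q" using v by blast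
    then have "v \<in> \<delta>" using segment_in_geodesic[OF dg p(1) q(1)] by blast
    then show ?thesis using v by (auto simp: u_def)
  qed
  show thesis
    by (rule that[OF unit_speed_shift(1)[OF c(1), of m] core])
qed

section \<open>Compactness in the space of geodesics\<close>

lemma continuous_on_hyp_dist:
  "continuous_on (hyp_plane \<times> hyp_plane) (\<lambda>p. hyp_dist (fst p) (snd p))"
  unfolding hyp_dist_def
  by (rule continuous_on_compose2[OF continuous_on_arcosh[of "{1..}"]])
    (auto simp: hyp_plane_def intro!: continuous_intros divide_nonneg_pos)

text \<open>
  A bound on the distance to a compact set bounds the imaginary part from below and the absolute value
  from above, by the formula for \<open>cosh (hyp_dist p q)\<close>.
\<close>
lemma hyp_ball_relatively_compact:
  assumes K: "compact K" "K \<subseteq> hyp_plane"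
  obtains K' where "compact K'" "K' \<subseteq> hyp_plane"
    "\<And>p q. p \<in> K \<Longrightarrow> q \<in> hyp_plane \<Longrightarrow> hyp_dist p q \<le> r \<Longrightarrow> q \<in> K'"
proof (cases "K = {} \<or> r < 0")
  case True
  then have "\<not> (p \<in> K \<and> q \<in> hyp_plane \<and> hyp_dist p q \<le> r)" for p q
    using hyp_dist_nonneg[of p q] K by force
  then show ?thesis by (intro that[of "{}"]) auto
next
  case False
  have "continuous_on K Im" by (intro continuous_intros)
  with False obtain p0 where p0: "p0 \<in> K" "\<And>p. p \<in> K \<Longrightarrow> Im p0 \<le> Im p"
    using continuous_attains_inf[OF K(1), of Im] by blast
  have m: "Im p0 > 0" using p0(1) K(2) by (auto simp: hyp_plane_def)
  obtain M where M: "\<And>p. p \<in> K \<Longrightarrow> cmod p \<le> M" using compact_imp_bounded[OF K(1)] by (auto simp: bounded_iff)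
  define k where "k = 2 * cosh r"
  have k: "k \<ge> 2" using cosh_real_ge_1[of r] by (simp add: k_def)
  have q: "Im p0 / k \<le> Im q" "cmod q \<le> M + k * M"
    if pq: "p \<in> K" "q \<in> hyp_plane" "hyp_dist p q \<le> r" for p q
  proof -
    have pH: "p \<in> hyp_plane" using pq K by blast
    have Im: "Im p > 0" "Im q > 0" using pH pq by (auto simp: hyp_plane_def)
    have "cosh (hyp_dist p q) \<le> cosh r"
      using hyp_dist_le_iff[OF pH pq(2), of r] pq False by simp
    then have "(cmod (p - q))\<^sup>2 / (2 * Im p * Im q) \<le> cosh r - 1"
      using cosh_hyp_dist[OF pH pq(2)] by simp
    then have "(cmod (p - q))\<^sup>2 \<le> (cosh r - 1) * (2 * Im p * Im q)"
      using Im by (subst (asm) pos_divide_le_eq) auto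
    then have le: "(cmod (p - q))\<^sup>2 \<le> (k - 2) * Im p * Im q"
      by (simp add: k_def algebra_simps)
    have "\<bar>Im (p - q)\<bar> \<le> cmod (p - q)" by (rule abs_Im_le_cmod)
    then have "(Im p - Im q)\<^sup>2 \<le> (cmod (p - q))\<^sup>2" by (metis abs_le_square_iff abs_norm_cancel minus_complex.sel(2))
    with le have "(Im p - Im q)\<^sup>2 \<le> (k - 2) * Im p * Im q" by linarith
    then have sq: "(Im p)\<^sup>2 + (Im q)\<^sup>2 \<le> k * Im p * Im q"
      by (simp add: power2_eq_square algebra_simps)
    have "(Im p)\<^sup>2 \<le> k * Im p * Im q" "(Im q)\<^sup>2 \<le> k * Im p * Im q"
      using sq zero_le_power2[of "Im p"] zero_le_power2[of "Im q"] by linarith+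
    then have "Im p * Im p \<le> Im p * (k * Im q)" "Im q * Im q \<le> Im q * (k * Im p)"
      by (simp_all add: power2_eq_square mult_ac)
    then have pk: "Im p \<le> k * Im q" and qk: "Im q \<le> k * Im p" using Im by simp_all
    have "Im p0 \<le> k * Im q" using p0(2)[OF pq(1)] pk by linarith
    then show "Im p0 / k \<le> Im q" using k by (simp add: divide_le_eq mult.commute)
    have pM: "Im p \<le> M" "0 \<le> M" using M[OF pq(1)] abs_Im_le_cmod[of p] Im by linarith+
    have qM: "Im q \<le> k * M" using pM qk mult_left_mono[OF pM(1), of k] k by linarith
    then have "Im p * Im q \<le> M * (k * M)" using pM Im qM by (intro mult_mono) auto
    then have "(k - 2) * (Im p * Im q) \<le> k * (M * (k * M))"
      using k Im pM qM by (intro mult_mono) auto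
    with le have "(cmod (p - q))\<^sup>2 \<le> (k * M)\<^sup>2" by (simp add: power2_eq_square mult_ac)
    then have "cmod (p - q) \<le> k * M" by (rule power2_le_imp_le) (use k pM in simp)
    moreover have "cmod q \<le> cmod p + cmod (p - q)" using norm_triangle_sub[of q p] by (simp add: norm_minus_commute)
    ultimately show "cmod q \<le> M + k * M" using M[OF pq(1)] by linarith
  qed
  define K' where "K' = {q. Im p0 / k \<le> Im q} \<inter> cball 0 (M + k * M)"
  have "compact K'" unfolding K'_def
    by (intro closed_Int_compact compact_cball closed_halfspace_Im_ge)
  moreover have "K' \<subseteq> hyp_plane" using m k by (force simp: K'_def hyp_plane_def intro: less_le_trans[of 0 "Im p0 / k"])
  moreover have "q \<in> K'" if "p \<in> K" "q \<in> hyp_plane" "hyp_dist p q \<le> r" for p q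
    using q[OF that] by (simp add: K'_def dist_norm)
  ultimately show ?thesis using that by blast
qed

lemma compact_unit_pairs:
  assumes K: "compact K" "K \<subseteq> hyp_plane"
  shows "compact {pq. fst pq \<in> K \<and> snd pq \<in> hyp_plane \<and> hyp_dist (fst pq) (snd pq) = 1}" (is "compact ?D")
proof -
  obtain K' where K': "compact K'" "K' \<subseteq> hyp_plane"
    "\<And>p q. p \<in> K \<Longrightarrow> q \<in> hyp_plane \<Longrightarrow> hyp_dist p q \<le> 1 \<Longrightarrow> q \<in> K'"
    using hyp_ball_relatively_compact[OF K] by metis
  have "?D = {pq \<in> K \<times> K'. hyp_dist (fst pq) (snd pq) = 1}" using K'(2,3) by force
  moreover have "closed {pq \<in> K \<times> K'. hyp_dist (fst pq) (snd pq) = 1}"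
    using K K' by (intro continuous_closed_preimage_constant continuous_on_subset[OF continuous_on_hyp_dist]
        closed_Times compact_imp_closed) auto
  moreover have "?D \<subseteq> K \<times> K'" using calculation(1) by auto
  ultimately show ?thesis
    using compact_Times[OF K(1) K'(1)] by (metis (no_types, lifting) compact_Int_closed inf.absorb2)
qed

text \<open>
  The unit speed geodesic \<open>c\<close> with \<open>(c 0, c 1) = pq\<close>, computed in the hyperboloid model from
  \<open>sinh 1 c(t) = sinh (1 - t) c(0) + sinh t c(1)\<close>. It identifies parametrized geodesics with pairs of
  points at distance \<open>1\<close>, and so transfers compactness and convergent subsequences from the plane
  to the topology of pointwise convergence.
\<close>
definition geodesic_param :: "complex \<times> complex \<Rightarrow> real \<Rightarrow> complex" where
  "geodesic_param pq t =
     Complex ((sinh (1 - t) * (Re (fst pq) / Im (fst pq)) + sinh t * (Re (snd pq) / Im (snd pq))) /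
              (sinh (1 - t) / Im (fst pq) + sinh t / Im (snd pq)))
             (sinh 1 / (sinh (1 - t) / Im (fst pq) + sinh t / Im (snd pq)))"

lemma geodesic_param_endpoints:
  assumes c: "c \<in> unit_speed_geodesics"
  shows "geodesic_param (c 0, c 1) t = c t"
    "sinh (1 - t) / Im (c 0) + sinh t / Im (c 1) = sinh 1 / Im (c t)"
proof -
  obtain P Q where ct: "\<And>t. hyp_embed (c t) = cosh t *\<^sub>R P + sinh t *\<^sub>R Q"
    using geodesic_frame[OF c] by metis
  have "sinh (1 - t) *\<^sub>R hyp_embed (c 0) + sinh t *\<^sub>R hyp_embed (c 1) = sinh 1 *\<^sub>R hyp_embed (c t)"
    by (simp add: ct sinh_diff algebra_simps)
  then have "snd (snd (sinh (1 - t) *\<^sub>R hyp_embed (c 0) + sinh t *\<^sub>R hyp_embed (c 1))) = snd (snd (sinh 1 *\<^sub>R hyp_embed (c t)))"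
    "fst (snd (sinh (1 - t) *\<^sub>R hyp_embed (c 0) + sinh t *\<^sub>R hyp_embed (c 1))) = fst (snd (sinh 1 *\<^sub>R hyp_embed (c t)))"
    by simp_all
  then have e: "sinh (1 - t) / Im (c 0) + sinh t / Im (c 1) = sinh 1 / Im (c t)"
    "sinh (1 - t) * (Re (c 0) / Im (c 0)) + sinh t * (Re (c 1) / Im (c 1)) = sinh 1 * (Re (c t) / Im (c t))"
    by (simp_all add: hyp_embed_def)
  then show "sinh (1 - t) / Im (c 0) + sinh t / Im (c 1) = sinh 1 / Im (c t)" by simp
  have "Im (c t) > 0" using unit_speed_in_plane[OF c, of t] by (simp add: hyp_plane_def)
  then show "geodesic_param (c 0, c 1) t = c t"
    unfolding geodesic_param_def fst_conv snd_conv e by (simp add: complex_eq_iff)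
qed

lemma unit_pairs_endpoints:
  assumes "p \<in> hyp_plane" "q \<in> hyp_plane" "hyp_dist p q = 1"
  obtains c where "c \<in> unit_speed_geodesics" "c 0 = p" "c 1 = q"
  using geodesic_through[OF assms(1,2)] assms hyp_dist_self by (metis zero_neq_one)

lemma continuous_on_geodesic_param:
  assumes "S \<subseteq> {pq. fst pq \<in> hyp_plane \<and> snd pq \<in> hyp_plane \<and> hyp_dist (fst pq) (snd pq) = 1}"
  shows "continuous_on S geodesic_param"
proof -
  have "sinh (1 - t) / Im (fst pq) + sinh t / Im (snd pq) \<noteq> 0" and "Im (fst pq) \<noteq> 0" and "Im (snd pq) \<noteq> 0"
    if pq: "pq \<in> S" for pq t
  proof -
    have H: "fst pq \<in> hyp_plane" "snd pq \<in> hyp_plane" "hyp_dist (fst pq) (snd pq) = 1" using pq assms by auto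
    then obtain c where c: "c \<in> unit_speed_geodesics" "c 0 = fst pq" "c 1 = snd pq"
      using unit_pairs_endpoints by metis
    have "Im (c t) > 0" using unit_speed_in_plane[OF c(1), of t] by (simp add: hyp_plane_def)
    then show "sinh (1 - t) / Im (fst pq) + sinh t / Im (snd pq) \<noteq> 0"
      using geodesic_param_endpoints(2)[OF c(1), of t] c by simp
    show "Im (fst pq) \<noteq> 0" "Im (snd pq) \<noteq> 0" using H by (auto simp: hyp_plane_def)
  qed
  then show ?thesis
    unfolding geodesic_param_def Complex_eq
    by (intro continuous_on_coordinatewise_then_product continuous_intros) auto
qed

lemma geodesics_from_compact:
  assumes K: "K \<subseteq> hyp_plane"
  shows "{c \<in> unit_speed_geodesics. c 0 \<in> K} =
    geodesic_param ` {pq. fst pq \<in> K \<and> snd pq \<in> hyp_plane \<and> hyp_dist (fst pq) (snd pq) = 1}"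
proof (intro subset_antisym subsetI)
  fix c assume "c \<in> {c \<in> unit_speed_geodesics. c 0 \<in> K}"
  then have c: "c \<in> unit_speed_geodesics" "c 0 \<in> K" by auto
  then have "c = geodesic_param (c 0, c 1)" using geodesic_param_endpoints(1)[OF c(1)] by auto
  then show "c \<in> geodesic_param ` {pq. fst pq \<in> K \<and> snd pq \<in> hyp_plane \<and> hyp_dist (fst pq) (snd pq) = 1}"
    using c unit_speed_in_plane[OF c(1)] unit_speed_dist[OF c(1), of 0 1] by (intro image_eqI[of _ _ "(c 0, c 1)"]) auto
next
  fix c assume "c \<in> geodesic_param ` {pq. fst pq \<in> K \<and> snd pq \<in> hyp_plane \<and> hyp_dist (fst pq) (snd pq) = 1}"
  then obtain p q where c: "c = geodesic_param (p, q)" "p \<in> K" "q \<in> hyp_plane" "hyp_dist p q = 1" by auto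
  then obtain b where b: "b \<in> unit_speed_geodesics" "b 0 = p" "b 1 = q" using unit_pairs_endpoints K by blast
  then have "c = b" using geodesic_param_endpoints(1)[OF b(1)] c by auto
  then show "c \<in> {c \<in> unit_speed_geodesics. c 0 \<in> K}" using b c by simp
qed

lemma compact_geodesics_from_compact:
  assumes K: "compact K" "K \<subseteq> hyp_plane"
  shows "compact {c \<in> unit_speed_geodesics. c 0 \<in> K}"
  unfolding geodesics_from_compact[OF K(2)]
  by (intro compact_continuous_image compact_unit_pairs[OF K] continuous_on_geodesic_param) (use K in auto)

lemma geodesics_convergent_subsequence:
  assumes K: "compact K" "K \<subseteq> hyp_plane" and c: "\<And>n. c n \<in> unit_speed_geodesics" "\<And>n. c n 0 \<in> K"
  shows "\<exists>b\<in>unit_speed_geodesics. \<exists>r :: nat \<Rightarrow> nat. strict_mono r \<and> (\<forall>t. (\<lambda>n. c (r n) t) \<longlonglongrightarrow> b t)"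
proof -
  define D where "D = {pq. fst pq \<in> K \<and> snd pq \<in> hyp_plane \<and> hyp_dist (fst pq) (snd pq) = 1}"
  have "\<forall>n. (c n 0, c n 1) \<in> D"
    using c unit_speed_in_plane[OF c(1)] unit_speed_dist[OF c(1), of _ 0 1] by (auto simp: D_def)
  then obtain l r where l: "l \<in> D" "strict_mono r" "((\<lambda>n. (c n 0, c n 1)) \<circ> r) \<longlonglongrightarrow> l"
    using compact_unit_pairs[OF K] unfolding D_def[symmetric] compact_def by meson
  have cont: "continuous_on D geodesic_param"
    by (rule continuous_on_geodesic_param) (use K in \<open>auto simp: D_def\<close>)
  have "(\<lambda>n. c (r n) t) \<longlonglongrightarrow> geodesic_param l t" for t
  proof -
    have "continuous_on D (\<lambda>pq. geodesic_param pq t)"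
      using cont by (rule continuous_on_product_then_coordinatewise)
    then have "(\<lambda>n. geodesic_param (((\<lambda>n. (c n 0, c n 1)) \<circ> r) n) t) \<longlonglongrightarrow> geodesic_param l t"
      by (rule continuous_on_tendsto_compose[OF _ l(3,1)])
        (use \<open>\<forall>n. (c n 0, c n 1) \<in> D\<close> in auto)
    then show ?thesis by (simp add: geodesic_param_endpoints[OF c(1)])
  qed
  moreover have "geodesic_param l \<in> unit_speed_geodesics"
    using geodesics_from_compact[OF K(2)] l(1) by (auto simp: D_def)
  ultimately show ?thesis using l(2) by blast
qed

lemma hyp_dist_tendsto:
  assumes "a \<longlonglongrightarrow> x" "\<And>n. a n \<in> hyp_plane" "x \<in> hyp_plane"
  shows "(\<lambda>n. hyp_dist x (a n)) \<longlonglongrightarrow> 0"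
proof -
  have "continuous_on hyp_plane (\<lambda>q. hyp_dist x q)"
    using continuous_on_compose2[OF continuous_on_hyp_dist, of hyp_plane "\<lambda>q. (x, q)"] assms(3)
    by (force intro!: continuous_intros)
  then have "(\<lambda>n. hyp_dist x (a n)) \<longlonglongrightarrow> hyp_dist x x"
    by (rule continuous_on_tendsto_compose[OF _ assms(1,3)]) (use assms(2) in auto)
  then show ?thesis using assms(3) by (simp add: hyp_dist_self)
qed

lemma continuous_on_side:
  assumes "x \<in> hyp_plane"
  shows "continuous_on unit_speed_geodesics (\<lambda>c. side c x)"
proof -
  have ev: "continuous_on unit_speed_geodesics (\<lambda>c. c t)" for t :: real
    by (rule continuous_on_subset[OF continuous_on_product_coordinates]) auto
  have "Im (c t) \<noteq> 0" if "c \<in> unit_speed_geodesics" for c t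
    using unit_speed_in_plane[OF that, of t] by (auto simp: hyp_plane_def)
  then show ?thesis
    unfolding side_def geodesic_normal_def lorentz_def lorentz_cross_def hyp_embed_def
    by (intro continuous_intros ev) auto
qed

lemma openin_not_meeting_segment:
  assumes x: "x \<in> hyp_plane" and y: "y \<in> hyp_plane"
  shows "openin geodesic_topology (geodesics - meeting (hyp_segment x y))"
  unfolding openin_geodesic_topology
proof
  have "range c \<in> geodesics - meeting (hyp_segment x y) \<longleftrightarrow> side c x * side c y > 0"
    if "c \<in> unit_speed_geodesics" for c
    using geodesic_meets_segment_iff[OF that x y] range_in_geodesics[OF that]
    by (simp add: meeting_def not_le[symmetric] del: not_le)
  then have "{c \<in> unit_speed_geodesics. range c \<in> geodesics - meeting (hyp_segment x y)} =
      unit_speed_geodesics \<inter> (\<lambda>c. side c x * side c y) -` {0<..}"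
    by auto
  moreover have "openin (top_of_set unit_speed_geodesics) (unit_speed_geodesics \<inter> (\<lambda>c. side c x * side c y) -` {0<..})"
    by (intro continuous_openin_preimage_gen continuous_intros continuous_on_side x y)
  ultimately show "openin (top_of_set unit_speed_geodesics) {c \<in> unit_speed_geodesics. range c \<in> geodesics - meeting (hyp_segment x y)}"
    by simp
qed auto

section \<open>The action of the surface group\<close>

locale surface_group =
  fixes \<Gamma> :: "(complex \<Rightarrow> complex) set"
  assumes surface: "closed_hyperbolic_surface_group \<Gamma>"
begin

lemma group_subset: "\<Gamma> \<subseteq> Bij hyp_plane"
  using surface subgroup.subset by (fastforce simp: closed_hyperbolic_surface_group_def BijGroup_def)

lemma act_in_plane: "g \<in> \<Gamma> \<Longrightarrow> z \<in> hyp_plane \<Longrightarrow> g z \<in> hyp_plane"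
  using group_subset Bij_imp_funcset by blast

lemma act_dist: "g \<in> \<Gamma> \<Longrightarrow> z \<in> hyp_plane \<Longrightarrow> w \<in> hyp_plane \<Longrightarrow> hyp_dist (g z) (g w) = hyp_dist z w"
  using surface by (simp add: closed_hyperbolic_surface_group_def)

lemma act_inverse:
  assumes g: "g \<in> \<Gamma>"
  obtains h where "h \<in> \<Gamma>" "\<And>z. z \<in> hyp_plane \<Longrightarrow> h (g z) = z" "\<And>z. z \<in> hyp_plane \<Longrightarrow> g (h z) = z"
proof -
  have sg: "subgroup \<Gamma> (BijGroup hyp_plane)" using surface by (simp add: closed_hyperbolic_surface_group_def)
  have gB: "g \<in> Bij hyp_plane" using g group_subset by blast
  define h where "h = (\<lambda>x \<in> hyp_plane. inv_into hyp_plane g x)"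
  have "h \<in> \<Gamma>" using subgroup.m_inv_closed[OF sg g] inv_BijGroup[OF gB] by (simp add: h_def)
  moreover have "h (g z) = z" "g (h z) = z" if "z \<in> hyp_plane" for z
    using gB that act_in_plane[OF g] bij_betw_inv_into_left[of g hyp_plane hyp_plane z]
      bij_betw_inv_into_right[of g hyp_plane hyp_plane z] by (auto simp: h_def Bij_def)
  ultimately show thesis using that by blast
qed

lemma act_compose:
  assumes g: "g \<in> \<Gamma>" and h: "h \<in> \<Gamma>"
  obtains k where "k \<in> \<Gamma>" "\<And>z. z \<in> hyp_plane \<Longrightarrow> k z = g (h z)"
proof -
  have sg: "subgroup \<Gamma> (BijGroup hyp_plane)" using surface by (simp add: closed_hyperbolic_surface_group_def)
  have "g \<otimes>\<^bsub>BijGroup hyp_plane\<^esub> h = compose hyp_plane g h"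
    using g h group_subset by (auto simp: BijGroup_def)
  then have "compose hyp_plane g h \<in> \<Gamma>" using subgroup.m_closed[OF sg g h] by simp
  then show thesis by (rule that) (simp add: compose_def)
qed

lemma act_free:
  assumes g: "g \<in> \<Gamma>" and z: "z \<in> hyp_plane" "g z = z" and w: "w \<in> hyp_plane"
  shows "g w = w"
proof -
  have "g = \<one>\<^bsub>BijGroup hyp_plane\<^esub>"
  proof (rule ccontr)
    assume "g \<noteq> \<one>\<^bsub>BijGroup hyp_plane\<^esub>"
    moreover obtain U where "z \<in> U" "\<forall>g\<in>\<Gamma> - {\<one>\<^bsub>BijGroup hyp_plane\<^esub>}. g ` U \<inter> U = {}"
      using surface z(1) unfolding closed_hyperbolic_surface_group_def by blast
    ultimately show False using g z(2) by (metis DiffI disjoint_iff image_eqI singletonD)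
  qed
  then show ?thesis using w by (simp add: BijGroup_def)
qed

lemma act_cocompact:
  obtains K where "compact K" "K \<subseteq> hyp_plane" "\<And>x. x \<in> hyp_plane \<Longrightarrow> \<exists>g\<in>\<Gamma>. g x \<in> K"
proof -
  obtain K where K: "compact K" "K \<subseteq> hyp_plane" "(\<Union>g\<in>\<Gamma>. g ` K) = hyp_plane"
    using surface unfolding closed_hyperbolic_surface_group_def by blast
  have cov: "\<exists>g\<in>\<Gamma>. \<exists>y\<in>K. x = g y" if "x \<in> hyp_plane" for x using that K(3) by blast
  have "\<exists>g\<in>\<Gamma>. g x \<in> K" if xH: "x \<in> hyp_plane" for x
  proof -
    obtain g y where gy: "g \<in> \<Gamma>" "y \<in> K" "x = g y" using cov[OF xH] by blast
    obtain h where "h \<in> \<Gamma>" "\<And>z. z \<in> hyp_plane \<Longrightarrow> h (g z) = z" using act_inverse[OF gy(1)] by metis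
    then show ?thesis using gy K(2) by (metis subsetD)
  qed
  then show thesis using that K by blast
qed

lemma act_unit_speed:
  assumes g: "g \<in> \<Gamma>" and c: "c \<in> unit_speed_geodesics"
  shows "(\<lambda>t. g (c t)) \<in> unit_speed_geodesics"
  using act_in_plane[OF g unit_speed_in_plane[OF c]] act_dist[OF g unit_speed_in_plane[OF c] unit_speed_in_plane[OF c]]
    unit_speed_dist[OF c]
  by (auto simp: unit_speed_geodesics_def)

lemma act_geodesics:
  assumes g: "g \<in> \<Gamma>" and \<gamma>: "\<gamma> \<in> geodesics"
  shows "g ` \<gamma> \<in> geodesics"
proof -
  obtain c where c: "c \<in> unit_speed_geodesics" "\<gamma> = range c" using geodesics_obtain[OF \<gamma>] .
  then have "g ` \<gamma> = range (\<lambda>t. g (c t))" by (simp add: image_image)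
  then show ?thesis using range_in_geodesics[OF act_unit_speed[OF g c(1)]] by simp
qed

lemma act_segment:
  assumes g: "g \<in> \<Gamma>" and x: "x \<in> hyp_plane" and y: "y \<in> hyp_plane"
  shows "g ` hyp_segment x y = hyp_segment (g x) (g y)"
proof -
  obtain h where h: "h \<in> \<Gamma>" "\<And>z. z \<in> hyp_plane \<Longrightarrow> h (g z) = z" "\<And>z. z \<in> hyp_plane \<Longrightarrow> g (h z) = z"
    using act_inverse[OF g] by blast
  show ?thesis
  proof (intro subset_antisym subsetI)
    fix z assume "z \<in> g ` hyp_segment x y"
    then show "z \<in> hyp_segment (g x) (g y)"
      using x y act_in_plane[OF g] act_dist[OF g] by (auto simp: hyp_segment_def)
  next
    fix z assume z: "z \<in> hyp_segment (g x) (g y)"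
    have zH: "z \<in> hyp_plane" by (rule hyp_segment_in_plane[OF z])
    have "h z \<in> hyp_segment x y"
      using z x y zH act_in_plane[OF h(1) zH] act_dist[OF g x act_in_plane[OF h(1) zH]]
        act_dist[OF g act_in_plane[OF h(1) zH] y] act_dist[OF g x y] h(3)[OF zH]
      by (simp add: hyp_segment_def)
    then show "z \<in> g ` hyp_segment x y" using h(3)[OF zH] by (metis image_eqI)
  qed
qed

lemma act_image_inverse:
  assumes "\<And>z. z \<in> hyp_plane \<Longrightarrow> g (h z) = z" "A \<subseteq> hyp_plane"
  shows "g ` (h ` A) = A"
  using assms by (force simp: image_image subset_iff)

lemma act_meeting:
  assumes g: "g \<in> \<Gamma>" and A: "A \<subseteq> hyp_plane"
  shows "(`) g ` meeting A = meeting (g ` A)"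
proof -
  obtain h where h: "h \<in> \<Gamma>" "\<And>z. z \<in> hyp_plane \<Longrightarrow> h (g z) = z" "\<And>z. z \<in> hyp_plane \<Longrightarrow> g (h z) = z"
    using act_inverse[OF g] by blast
  show ?thesis
  proof (intro subset_antisym subsetI)
    fix \<gamma> assume "\<gamma> \<in> (`) g ` meeting A"
    then show "\<gamma> \<in> meeting (g ` A)" using act_geodesics[OF g] by (auto simp: meeting_def)
  next
    fix \<delta> assume \<delta>: "\<delta> \<in> meeting (g ` A)"
    then have dg: "\<delta> \<in> geodesics" by (simp add: meeting_def)
    have "h ` \<delta> \<in> meeting A"
      using \<delta> act_geodesics[OF h(1) dg] h(2) A by (fastforce simp: meeting_def)
    moreover have "g ` (h ` \<delta>) = \<delta>"
      by (rule act_image_inverse) (use h(3) geodesic_in_plane[OF dg] in auto)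
    ultimately show "\<delta> \<in> (`) g ` meeting A" by (metis image_eqI)
  qed
qed

lemma act_continuous: "g \<in> \<Gamma> \<Longrightarrow> continuous_on hyp_plane g"
  using surface by (auto simp: closed_hyperbolic_surface_group_def intro: holomorphic_on_imp_continuous_on)

lemma act_geodesics_inj: "g \<in> \<Gamma> \<Longrightarrow> inj_on ((`) g) geodesics"
proof (rule inj_onI)
  fix \<gamma> \<delta> assume g: "g \<in> \<Gamma>" and \<gamma>: "\<gamma> \<in> geodesics" and \<delta>: "\<delta> \<in> geodesics" and eq: "g ` \<gamma> = g ` \<delta>"
  obtain h where h: "\<And>z. z \<in> hyp_plane \<Longrightarrow> h (g z) = z" using act_inverse[OF g] by metis
  have "h ` (g ` \<gamma>) = \<gamma>" by (rule act_image_inverse) (use h geodesic_in_plane[OF \<gamma>] in auto)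
  moreover have "h ` (g ` \<delta>) = \<delta>" by (rule act_image_inverse) (use h geodesic_in_plane[OF \<delta>] in auto)
  ultimately show "\<gamma> = \<delta>" using eq by metis
qed

lemma act_geodesics_surj:
  assumes g: "g \<in> \<Gamma>" shows "(`) g ` geodesics = geodesics"
proof (intro subset_antisym subsetI)
  fix \<delta> assume \<delta>: "\<delta> \<in> geodesics"
  obtain h where h: "h \<in> \<Gamma>" "\<And>z. z \<in> hyp_plane \<Longrightarrow> g (h z) = z" using act_inverse[OF g] by metis
  have "g ` (h ` \<delta>) = \<delta>" by (rule act_image_inverse) (use h geodesic_in_plane[OF \<delta>] in auto)
  then show "\<delta> \<in> (`) g ` geodesics" using act_geodesics[OF h(1) \<delta>] by (metis image_eqI)
qed (use act_geodesics[OF g] in auto)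

text \<open>
  The preimage of \<open>(`) g ` U\<close> in the space of parametrized geodesics is the preimage of \<open>U\<close> under
  composition with the inverse of \<open>g\<close>.
\<close>
lemma act_openin:
  assumes g: "g \<in> \<Gamma>" and U: "openin geodesic_topology U"
  shows "openin geodesic_topology ((`) g ` U)"
  unfolding openin_geodesic_topology
proof
  obtain h where h: "h \<in> \<Gamma>" "\<And>z. z \<in> hyp_plane \<Longrightarrow> h (g z) = z" "\<And>z. z \<in> hyp_plane \<Longrightarrow> g (h z) = z"
    using act_inverse[OF g] by blast
  have Ug: "U \<subseteq> geodesics" using U by (simp add: openin_geodesic_topology)
  show "(`) g ` U \<subseteq> geodesics" using act_geodesics[OF g] Ug by auto
  have ev: "continuous_on unit_speed_geodesics (\<lambda>c. c t)" for t :: real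
    by (rule continuous_on_subset[OF continuous_on_product_coordinates]) auto
  have cont: "continuous_on unit_speed_geodesics (\<lambda>c t. h (c t))"
    by (intro continuous_on_coordinatewise_then_product continuous_on_compose2[OF act_continuous[OF h(1)] ev])
      (auto intro: unit_speed_in_plane)
  have "range c \<in> (`) g ` U \<longleftrightarrow> range (\<lambda>t. h (c t)) \<in> U" if c: "c \<in> unit_speed_geodesics" for c
  proof -
    have r: "range (\<lambda>t. h (c t)) = h ` range c" by (simp add: image_image)
    have c': "range c \<in> geodesics" by (rule range_in_geodesics[OF c])
    have "g ` (h ` range c) = range c" by (rule act_image_inverse) (use h(3) geodesic_in_plane[OF c'] in auto)
    moreover have "h ` (g ` \<gamma>) = \<gamma>" if "\<gamma> \<in> U" for \<gamma>
      by (rule act_image_inverse) (use h(2) geodesic_in_plane Ug that in blast)+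
    ultimately show ?thesis unfolding r by (metis (no_types, lifting) image_iff)
  qed
  then have "{c \<in> unit_speed_geodesics. range c \<in> (`) g ` U} =
      unit_speed_geodesics \<inter> (\<lambda>c t. h (c t)) -` {c \<in> unit_speed_geodesics. range c \<in> U}"
    using act_unit_speed[OF h(1)] by auto
  also have "openin (top_of_set unit_speed_geodesics) \<dots>"
    using U act_unit_speed[OF h(1)] unfolding openin_geodesic_topology
    by (intro continuous_openin_preimage[OF cont, where T = unit_speed_geodesics]) auto
  finally show "openin (top_of_set unit_speed_geodesics) {c \<in> unit_speed_geodesics. range c \<in> (`) g ` U}" .
qed

end

section \<open>The dual pseudometric of a current\<close>

definition transversals :: "complex set \<Rightarrow> complex set set" where
  "transversals \<gamma> = {\<delta> \<in> geodesics. \<delta> \<noteq> \<gamma> \<and> \<delta> \<inter> \<gamma> \<noteq> {}}"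

text \<open>
  Cutting \<open>c\<close> into pieces of length \<open>l\<close> is compatible with a translation of length \<open>l\<close> along \<open>c\<close>.
\<close>
lemma meeting_union_exhausts_transversals:
  assumes c: "c \<in> unit_speed_geodesics" and l: "l > 0"
  shows "transversals (range c) =
    (\<Union>k::int. meeting (hyp_segment (c (of_int k * l)) (c (of_int (k + 1) * l)))) - {range c}"
proof (intro subset_antisym subsetI)
  fix \<delta> assume "\<delta> \<in> transversals (range c)"
  then obtain t where t: "c t \<in> \<delta>" "\<delta> \<in> geodesics" "\<delta> \<noteq> range c" by (auto simp: transversals_def)
  define k where "k = \<lfloor>t / l\<rfloor>"
  have "of_int k \<le> t / l" "t / l \<le> of_int (k + 1)" unfolding k_def by linarith+
  then have k: "of_int k * l \<le> t" "t \<le> of_int (k + 1) * l" using l by (simp_all add: pos_le_divide_eq pos_divide_le_eq)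
  then have "c t \<in> hyp_segment (c (of_int k * l)) (c (of_int (k + 1) * l))"
    by (subst segment_of_geodesic[OF c]) auto
  then show "\<delta> \<in> (\<Union>k::int. meeting (hyp_segment (c (of_int k * l)) (c (of_int (k + 1) * l)))) - {range c}"
    using t by (auto simp: meeting_def)
next
  fix \<delta> assume "\<delta> \<in> (\<Union>k::int. meeting (hyp_segment (c (of_int k * l)) (c (of_int (k + 1) * l)))) - {range c}"
  then obtain k v where v: "\<delta> \<in> geodesics" "\<delta> \<noteq> range c" "v \<in> \<delta>"
    "v \<in> hyp_segment (c (of_int k * l)) (c (of_int (k + 1) * l))" by (auto simp: meeting_def)
  then have "v \<in> range c" using segment_in_geodesic[OF range_in_geodesics[OF c]] by blast
  then show "\<delta> \<in> transversals (range c)" using v by (auto simp: transversals_def)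
qed

text \<open>
  The reverse Fatou inequality for sets of finite total measure.
\<close>
lemma measure_limsup_ge:
  fixes A :: "nat \<Rightarrow> 'a set"
  assumes A: "\<And>n. A n \<in> sets M" "\<And>n. A n \<subseteq> W" and W: "W \<in> sets M" "emeasure M W < \<infinity>"
    and ge: "\<And>n. \<eta> \<le> measure M (A n)"
  shows "\<eta> \<le> measure M (\<Inter>n. \<Union>k\<in>{n..}. A k)"
proof -
  define B where "B n = (\<Union>k\<in>{n..}. A k)" for n :: nat
  have B: "B n \<in> sets M" "B n \<subseteq> W" for n using A by (auto simp: B_def)
  have fin: "emeasure M (B n) \<noteq> \<infinity>" for n
    using emeasure_mono[OF B(2) W(1)] W(2) by (metis infinity_ennreal_def leD)
  have "decseq B" unfolding decseq_def B_def by (intro allI impI UN_mono) auto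
  then have "(\<lambda>n. measure M (B n)) \<longlonglongrightarrow> measure M (\<Inter>n. B n)"
    using B fin by (intro Lim_measure_decseq) auto
  moreover have "\<eta> \<le> measure M (B n)" for n
  proof -
    have "measure M (A n) \<le> measure M (B n)"
      using fin[of n] A(1) B(1) by (intro measure_mono_fmeasurable) (auto simp: B_def fmeasurable_def less_top)
    then show ?thesis using ge[of n] by simp
  qed
  ultimately have "\<eta> \<le> measure M (\<Inter>n. B n)" by (intro LIMSEQ_le_const) auto
  then show ?thesis by (simp add: B_def)
qed

locale surface_current = surface_group +
  fixes \<mu> :: "complex set measure"
  assumes current: "geodesic_current \<Gamma> \<mu>"
begin

lemma space_current: "space \<mu> = geodesics"
  using current by (simp add: geodesic_current_def)

lemma openin_in_sets: "openin geodesic_topology U \<Longrightarrow> U \<in> sets \<mu>"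
  using current by (simp add: geodesic_current_def)

lemma meeting_segment_sets:
  assumes "x \<in> hyp_plane" "y \<in> hyp_plane"
  shows "meeting (hyp_segment x y) \<in> sets \<mu>"
proof -
  have "space \<mu> - (geodesics - meeting (hyp_segment x y)) \<in> sets \<mu>"
    using openin_in_sets[OF openin_not_meeting_segment[OF assms]] by (rule sets.compl_sets)
  also have "space \<mu> - (geodesics - meeting (hyp_segment x y)) = meeting (hyp_segment x y)"
    by (auto simp: space_current meeting_def)
  finally show ?thesis .
qed

lemma meeting_point_sets: "x \<in> hyp_plane \<Longrightarrow> meeting {x} \<in> sets \<mu>"
  using meeting_segment_sets[of x x] by (simp add: hyp_segment_self)

lemma singleton_sets:
  assumes "\<gamma> \<in> geodesics" shows "{\<gamma>} \<in> sets \<mu>"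
proof -
  obtain c where c: "c \<in> unit_speed_geodesics" "\<gamma> = range c" using geodesics_obtain[OF assms] .
  have "c 0 \<noteq> c 1" using unit_speed_dist[OF c(1), of 0 1] hyp_dist_self[OF unit_speed_in_plane[OF c(1)]] by auto
  have "{\<gamma>} = meeting {c 0} \<inter> meeting {c 1}"
  proof (intro subset_antisym subsetI)
    fix \<delta> assume "\<delta> \<in> meeting {c 0} \<inter> meeting {c 1}"
    then have "\<delta> = \<gamma>"
      using \<open>c 0 \<noteq> c 1\<close> c by (intro geodesics_unique[OF _ assms, of _ "c 0" "c 1"]) (auto simp: meeting_def)
    then show "\<delta> \<in> {\<gamma>}" by simp
  qed (use c assms in \<open>auto simp: meeting_def\<close>)
  then show ?thesis using meeting_point_sets unit_speed_in_plane[OF c(1)] by auto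
qed

text \<open>
  The parametrized geodesics starting in a compact set form a compact set, so finitely many of the
  open sets given by local finiteness cover the geodesics passing close to it.
\<close>
lemma finite_measure_near_compact:
  assumes K: "compact K" "K \<subseteq> hyp_plane"
  obtains W where "W \<in> sets \<mu>" "emeasure \<mu> W < \<infinity>"
    "\<And>\<gamma> p v. \<gamma> \<in> geodesics \<Longrightarrow> p \<in> K \<Longrightarrow> v \<in> \<gamma> \<Longrightarrow> hyp_dist p v \<le> r \<Longrightarrow> \<gamma> \<in> W"
proof -
  obtain K' where K': "compact K'" "K' \<subseteq> hyp_plane"
    "\<And>p q. p \<in> K \<Longrightarrow> q \<in> hyp_plane \<Longrightarrow> hyp_dist p q \<le> r \<Longrightarrow> q \<in> K'"
    using hyp_ball_relatively_compact[OF K] by metis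
  have "\<forall>\<gamma>\<in>geodesics. \<exists>U. openin geodesic_topology U \<and> \<gamma> \<in> U \<and> emeasure \<mu> U < \<infinity>"
    using current by (simp add: geodesic_current_def)
  then obtain U where U: "\<And>\<gamma>. \<gamma> \<in> geodesics \<Longrightarrow> openin geodesic_topology (U \<gamma>)"
    "\<And>\<gamma>. \<gamma> \<in> geodesics \<Longrightarrow> \<gamma> \<in> U \<gamma>" "\<And>\<gamma>. \<gamma> \<in> geodesics \<Longrightarrow> emeasure \<mu> (U \<gamma>) < \<infinity>" by metis
  have "\<exists>O'. open O' \<and> {c \<in> unit_speed_geodesics. range c \<in> U \<gamma>} = unit_speed_geodesics \<inter> O'"
    if "\<gamma> \<in> geodesics" for \<gamma>
    using U(1)[OF that] unfolding openin_geodesic_topology openin_open by blast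
  then obtain O' where O': "\<And>\<gamma>. \<gamma> \<in> geodesics \<Longrightarrow> open (O' \<gamma>)"
    "\<And>\<gamma>. \<gamma> \<in> geodesics \<Longrightarrow> {c \<in> unit_speed_geodesics. range c \<in> U \<gamma>} = unit_speed_geodesics \<inter> O' \<gamma>" by metis
  have cover: "{c \<in> unit_speed_geodesics. c 0 \<in> K'} \<subseteq> (\<Union>\<gamma>\<in>geodesics. O' \<gamma>)"
    using U(2) O'(2) range_in_geodesics by blast
  obtain D where D: "D \<subseteq> geodesics" "finite D" "{c \<in> unit_speed_geodesics. c 0 \<in> K'} \<subseteq> (\<Union>\<gamma>\<in>D. O' \<gamma>)"
    by (rule compactE_image[OF compact_geodesics_from_compact[OF K'(1,2)] O'(1) cover])
  define W where "W = (\<Union>\<gamma>\<in>D. U \<gamma>)"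
  have Us: "U \<gamma> \<in> sets \<mu>" if "\<gamma> \<in> D" for \<gamma> using openin_in_sets U(1) D(1) that by blast
  have "W \<in> sets \<mu>" unfolding W_def using D(2) Us by auto
  moreover have "emeasure \<mu> W < \<infinity>"
  proof -
    have "emeasure \<mu> W \<le> (\<Sum>\<gamma>\<in>D. emeasure \<mu> (U \<gamma>))"
      unfolding W_def using D(2) Us by (intro emeasure_subadditive_finite) auto
    also have "\<dots> < \<infinity>" using D U(3) by (auto simp: less_top)
    finally show ?thesis .
  qed
  moreover have "\<gamma> \<in> W" if \<gamma>: "\<gamma> \<in> geodesics" "p \<in> K" "v \<in> \<gamma>" "hyp_dist p v \<le> r" for \<gamma> p v
  proof -
    obtain c t where c: "c \<in> unit_speed_geodesics" "\<gamma> = range c" "v = c t"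
      using geodesics_obtain[OF \<gamma>(1)] \<gamma>(3) by blast
    define b where "b = (\<lambda>s. c (s + t))"
    have b: "b \<in> unit_speed_geodesics" "range b = \<gamma>" using unit_speed_shift[OF c(1)] c(2) by (simp_all add: b_def)
    have "b 0 \<in> K'" using K'(3)[OF \<gamma>(2) geodesic_in_plane[OF \<gamma>(1,3)] \<gamma>(4)] by (simp add: b_def c)
    then obtain \<delta> where "\<delta> \<in> D" "b \<in> O' \<delta>" using D(3) b by blast
    then have "range b \<in> U \<delta>" using O'(2) D(1) b(1) by blast
    then show ?thesis using \<open>\<delta> \<in> D\<close> b by (auto simp: W_def)
  qed
  ultimately show thesis using that by blast
qed

lemma meeting_segment_finite:
  assumes x: "x \<in> hyp_plane" and y: "y \<in> hyp_plane"
  shows "emeasure \<mu> (meeting (hyp_segment x y)) < \<infinity>"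
proof -
  obtain W where W: "W \<in> sets \<mu>" "emeasure \<mu> W < \<infinity>"
    "\<And>\<gamma> p v. \<gamma> \<in> geodesics \<Longrightarrow> p \<in> {x} \<Longrightarrow> v \<in> \<gamma> \<Longrightarrow> hyp_dist p v \<le> hyp_dist x y \<Longrightarrow> \<gamma> \<in> W"
    using finite_measure_near_compact[of "{x}"] x by (metis compact_insert compact_empty empty_subsetI insert_subset)
  have "meeting (hyp_segment x y) \<subseteq> W"
  proof
    fix \<gamma> assume \<gamma>: "\<gamma> \<in> meeting (hyp_segment x y)"
    then obtain v where v: "v \<in> \<gamma>" "v \<in> hyp_segment x y" "\<gamma> \<in> geodesics" by (auto simp: meeting_def)
    then have "hyp_dist x v \<le> hyp_dist x y" using hyp_dist_nonneg[of v y] y by (simp add: hyp_segment_def)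
    then show "\<gamma> \<in> W" using W(3) v by blast
  qed
  then show ?thesis using emeasure_mono W by (metis le_less_trans)
qed

lemma finite_subset_of_meeting:
  assumes "x \<in> hyp_plane" "y \<in> hyp_plane" "A \<subseteq> meeting (hyp_segment x y)"
  shows "emeasure \<mu> A < \<infinity>"
  using meeting_segment_finite[OF assms(1,2)] emeasure_mono[OF assms(3) meeting_segment_sets[OF assms(1,2)]]
  by (rule le_less_trans[rotated])

lemma integrable_crossing:
  assumes x: "x \<in> hyp_plane" and y: "y \<in> hyp_plane"
  shows "integrable \<mu> (crossing x y)"
  unfolding crossing_def[abs_def]
  using finite_subset_of_meeting[OF x y] meeting_segment_sets[OF x y] meeting_point_sets[OF x] meeting_point_sets[OF y]
  by (intro integrable_divide Bochner_Integration.integrable_add integrable_real_indicator) auto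

lemma dual_pseudometric_eq_integral:
  assumes x: "x \<in> hyp_plane" and y: "y \<in> hyp_plane"
  shows "dual_pseudometric \<mu> x y = (\<integral>\<gamma>. crossing x y \<gamma> \<partial>\<mu>)"
proof -
  let ?Y = "meeting (hyp_segment x y) - meeting {y}" and ?X = "meeting (hyp_segment x y) - meeting {x}"
  have s: "?X \<in> sets \<mu>" "?Y \<in> sets \<mu>"
    using meeting_segment_sets[OF x y] meeting_point_sets[OF x] meeting_point_sets[OF y] by auto
  have f: "emeasure \<mu> ?X < \<infinity>" "emeasure \<mu> ?Y < \<infinity>" by (rule finite_subset_of_meeting[OF x y], blast)+
  have i: "integrable \<mu> (indicator ?X :: _ \<Rightarrow> real)" "integrable \<mu> (indicator ?Y :: _ \<Rightarrow> real)"
    using s f by (auto intro: integrable_real_indicator)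
  have "(\<integral>\<gamma>. crossing x y \<gamma> \<partial>\<mu>) = (measure \<mu> ?Y + measure \<mu> ?X) / 2"
    using s i sets.sets_into_space[OF s(1)] sets.sets_into_space[OF s(2)]
    by (simp add: crossing_def inf.absorb1)
  moreover have "transverse_geodesics (hyp_segment x y - {x}) = ?X"
    using transverse_half_open_segment[OF y x] by (simp add: hyp_segment_commute[of y x])
  ultimately show ?thesis
    unfolding dual_pseudometric_def transverse_half_open_segment[OF x y] by simp
qed

lemma dual_nonneg: "0 \<le> dual_pseudometric \<mu> x y"
  by (simp add: dual_pseudometric_def)

lemma dual_commute: "dual_pseudometric \<mu> x y = dual_pseudometric \<mu> y x"
  by (simp add: dual_pseudometric_def hyp_segment_commute[of y x])

lemma dual_self: "x \<in> hyp_plane \<Longrightarrow> dual_pseudometric \<mu> x x = 0"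
  by (simp add: dual_pseudometric_eq_integral crossing_def hyp_segment_self)

lemma dual_triangle:
  assumes "x \<in> hyp_plane" "y \<in> hyp_plane" "z \<in> hyp_plane"
  shows "dual_pseudometric \<mu> x z \<le> dual_pseudometric \<mu> x y + dual_pseudometric \<mu> y z"
proof -
  have "(\<integral>\<gamma>. crossing x z \<gamma> \<partial>\<mu>) \<le> (\<integral>\<gamma>. crossing x y \<gamma> + crossing y z \<gamma> \<partial>\<mu>)"
    using assms by (intro integral_mono Bochner_Integration.integrable_add integrable_crossing crossing_triangle)
      (auto simp: space_current)
  then show ?thesis using assms by (simp add: dual_pseudometric_eq_integral integrable_crossing)
qed

lemma pseudometric_dual: "pseudometric_on hyp_plane (dual_pseudometric \<mu>)"
  using dual_self dual_nonneg dual_commute dual_triangle unfolding pseudometric_on_def by blast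

lemma dual_additive:
  assumes "x \<in> hyp_plane" "y \<in> hyp_plane" "z \<in> hyp_segment x y"
  shows "dual_pseudometric \<mu> x y = dual_pseudometric \<mu> x z + dual_pseudometric \<mu> z y"
proof -
  have zH: "z \<in> hyp_plane" by (rule hyp_segment_in_plane[OF assms(3)])
  have "(\<integral>\<gamma>. crossing x y \<gamma> \<partial>\<mu>) = (\<integral>\<gamma>. crossing x z \<gamma> + crossing z y \<gamma> \<partial>\<mu>)"
    using crossing_additive[OF _ assms] by (intro Bochner_Integration.integral_cong) (auto simp: space_current)
  then show ?thesis using assms zH by (simp add: dual_pseudometric_eq_integral integrable_crossing)
qed

lemma dual_le_measure_meeting:
  assumes "x \<in> hyp_plane" "y \<in> hyp_plane"
  shows "dual_pseudometric \<mu> x y \<le> measure \<mu> (meeting (hyp_segment x y))"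
proof -
  have s: "meeting (hyp_segment x y) \<in> sets \<mu>" by (rule meeting_segment_sets[OF assms])
  have "(\<integral>\<gamma>. crossing x y \<gamma> \<partial>\<mu>) \<le> (\<integral>\<gamma>. indicator (meeting (hyp_segment x y)) \<gamma> \<partial>\<mu>)"
    using assms s meeting_segment_finite[OF assms] crossing_le_indicator
    by (intro integral_mono integrable_crossing integrable_real_indicator) auto
  then show ?thesis
    using sets.sets_into_space[OF s] by (simp add: dual_pseudometric_eq_integral assms inf.absorb1)
qed

lemma dual_four_points:
  assumes H: "x \<in> hyp_plane" "y \<in> hyp_plane" "z \<in> hyp_plane" "w \<in> hyp_plane"
  defines "E \<equiv> \<lambda>\<gamma>. crossing x z \<gamma> + crossing y w \<gamma> - crossing x w \<gamma> - crossing y z \<gamma>"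
  shows "integrable \<mu> E"
    "dual_pseudometric \<mu> x z + dual_pseudometric \<mu> y w - dual_pseudometric \<mu> x w - dual_pseudometric \<mu> y z
      = (\<integral>\<gamma>. E \<gamma> \<partial>\<mu>)"
  unfolding E_def using H
  by (auto simp: dual_pseudometric_eq_integral integrable_crossing
      intro!: Bochner_Integration.integrable_add Bochner_Integration.integrable_diff)

lemma dual_four_points_le:
  assumes H: "x \<in> hyp_plane" "y \<in> hyp_plane" "z \<in> hyp_plane" "w \<in> hyp_plane"
  shows "\<bar>dual_pseudometric \<mu> x z + dual_pseudometric \<mu> y w - dual_pseudometric \<mu> x w - dual_pseudometric \<mu> y z\<bar>
    \<le> 2 * measure \<mu> (meeting (hyp_segment x y) \<inter> meeting (hyp_segment z w))"
proof -
  let ?C = "meeting (hyp_segment x y) \<inter> meeting (hyp_segment z w)"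
  let ?E = "\<lambda>\<gamma>. crossing x z \<gamma> + crossing y w \<gamma> - crossing x w \<gamma> - crossing y z \<gamma>"
  have s: "?C \<in> sets \<mu>" using meeting_segment_sets H by auto
  have i: "integrable \<mu> (indicator ?C :: _ \<Rightarrow> real)"
    using s finite_subset_of_meeting[OF H(1,2), of ?C] by (intro integrable_real_indicator) auto
  have "\<bar>\<integral>\<gamma>. ?E \<gamma> \<partial>\<mu>\<bar> \<le> (\<integral>\<gamma>. \<bar>?E \<gamma>\<bar> \<partial>\<mu>)" by (rule integral_abs_bound)
  also have "\<dots> \<le> (\<integral>\<gamma>. 2 * indicator ?C \<gamma> \<partial>\<mu>)"
    using dual_four_points(1)[OF H] i crossing_four_points[OF _ H]
    by (intro integral_mono) (auto simp: space_current)
  also have "\<dots> = 2 * measure \<mu> ?C"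
    using i sets.sets_into_space[OF s] by (simp add: inf.absorb1)
  finally show ?thesis unfolding dual_four_points(2)[OF H] .
qed

lemma emeasure_act:
  assumes "g \<in> \<Gamma>" "A \<in> sets \<mu>"
  shows "emeasure \<mu> ((`) g ` A) = emeasure \<mu> A"
  using current assms by (simp add: geodesic_current_def)

lemma act_sets:
  assumes g: "g \<in> \<Gamma>" and A: "A \<in> sets \<mu>"
  shows "(`) g ` A \<in> sets \<mu>"
proof -
  have sets_eq: "sets \<mu> = sigma_sets geodesics {U. openin geodesic_topology U}"
    using current by (simp add: geodesic_current_def)
  have "A \<in> sigma_sets geodesics {U. openin geodesic_topology U}" using A sets_eq by simp
  then show ?thesis
  proof (induction rule: sigma_sets.induct)
    case (Basic U)
    then show ?case using openin_in_sets act_openin[OF g] by blast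
  next
    case (Compl A)
    have "A \<subseteq> geodesics"
      using Compl.hyps sets.sets_into_space[of A \<mu>] by (simp add: sets_eq space_current)
    then have "(`) g ` (geodesics - A) = space \<mu> - (`) g ` A"
      using inj_on_image_set_diff[OF act_geodesics_inj[OF g], of geodesics A] act_geodesics_surj[OF g]
      by (simp add: space_current)
    then show ?case using Compl.IH by auto
  next
    case (Union A)
    then show ?case by (simp add: image_UN)
  qed simp
qed

lemma measure_meeting_act:
  assumes g: "g \<in> \<Gamma>" and "x \<in> hyp_plane" "y \<in> hyp_plane"
  shows "measure \<mu> (meeting (hyp_segment (g x) (g y))) = measure \<mu> (meeting (hyp_segment x y))"
proof -
  have "(`) g ` meeting (hyp_segment x y) = meeting (hyp_segment (g x) (g y))"
    unfolding act_segment[OF assms, symmetric]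
    by (rule act_meeting[OF g]) (use hyp_segment_in_plane in auto)
  then show ?thesis using emeasure_act[OF g meeting_segment_sets[OF assms(2,3)]] by (simp add: measure_def)
qed

text \<open>
  By invariance and cocompactness it suffices to look at segments that start in a fixed compact set.
\<close>
lemma dual_bounded_on_unit_scale:
  obtains B where "B \<ge> 0"
    "\<And>x y. x \<in> hyp_plane \<Longrightarrow> y \<in> hyp_plane \<Longrightarrow> hyp_dist x y \<le> 1 \<Longrightarrow> dual_pseudometric \<mu> x y \<le> B"
proof -
  obtain K where K: "compact K" "K \<subseteq> hyp_plane" "\<And>x. x \<in> hyp_plane \<Longrightarrow> \<exists>g\<in>\<Gamma>. g x \<in> K"
    using act_cocompact by metis
  obtain W where W: "W \<in> sets \<mu>" "emeasure \<mu> W < \<infinity>"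
    "\<And>\<gamma> p v. \<gamma> \<in> geodesics \<Longrightarrow> p \<in> K \<Longrightarrow> v \<in> \<gamma> \<Longrightarrow> hyp_dist p v \<le> 1 \<Longrightarrow> \<gamma> \<in> W"
    using finite_measure_near_compact[OF K(1,2)] by metis
  have "dual_pseudometric \<mu> x y \<le> measure \<mu> W"
    if x: "x \<in> hyp_plane" and y: "y \<in> hyp_plane" and d: "hyp_dist x y \<le> 1" for x y
  proof -
    obtain g where g: "g \<in> \<Gamma>" "g x \<in> K" using K(3)[OF x] by blast
    have gH: "g x \<in> hyp_plane" "g y \<in> hyp_plane" using act_in_plane[OF g(1)] x y by auto
    have sub: "meeting (hyp_segment (g x) (g y)) \<subseteq> W"
    proof
      fix \<gamma> assume "\<gamma> \<in> meeting (hyp_segment (g x) (g y))"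
      then obtain v where v: "v \<in> \<gamma>" "v \<in> hyp_segment (g x) (g y)" "\<gamma> \<in> geodesics" by (auto simp: meeting_def)
      then have "hyp_dist (g x) v \<le> hyp_dist (g x) (g y)"
        using hyp_dist_nonneg[of v "g y"] gH by (simp add: hyp_segment_def)
      also have "\<dots> \<le> 1" using act_dist[OF g(1) x y] d by simp
      finally show "\<gamma> \<in> W" using W(3)[OF v(3) g(2) v(1)] by simp
    qed
    have "dual_pseudometric \<mu> x y \<le> measure \<mu> (meeting (hyp_segment (g x) (g y)))"
      using dual_le_measure_meeting[OF x y] measure_meeting_act[OF g(1) x y] by simp
    also have "\<dots> \<le> measure \<mu> W"
      using W sub meeting_segment_sets[OF gH] by (intro measure_mono_fmeasurable) (auto simp: fmeasurable_def)
    finally show ?thesis .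
  qed
  then show thesis using that[of "measure \<mu> W"] by simp
qed

lemma dual_linear_bound:
  assumes B: "B \<ge> 0" "\<And>x y. x \<in> hyp_plane \<Longrightarrow> y \<in> hyp_plane \<Longrightarrow> hyp_dist x y \<le> 1 \<Longrightarrow> dual_pseudometric \<mu> x y \<le> B"
    and "x \<in> hyp_plane" "y \<in> hyp_plane" "hyp_dist x y \<le> real n"
  shows "dual_pseudometric \<mu> x y \<le> B * real n"
  using assms(3-)
proof (induction n arbitrary: x)
  case 0
  then have "x = y" using hyp_dist_nonneg[of x y] hyp_dist_eq_0[of x y] by simp
  then show ?case using 0 dual_self by simp
next
  case (Suc n)
  show ?case
  proof (cases "hyp_dist x y \<le> 1")
    case True
    then have "dual_pseudometric \<mu> x y \<le> B" using B(2) Suc.prems by blast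
    also have "\<dots> \<le> B * real (Suc n)" using B(1) by (simp add: algebra_simps)
    finally show ?thesis .
  next
    case False
    then have "x \<noteq> y" using Suc.prems hyp_dist_self[of x] by auto
    then obtain c where c: "c \<in> unit_speed_geodesics" "c 0 = x" "c (hyp_dist x y) = y"
      using geodesic_through Suc.prems by metis
    have seg: "c 1 \<in> hyp_segment x y"
      using segment_of_geodesic[OF c(1), of 0 "hyp_dist x y"] c False by auto
    have cH: "c 1 \<in> hyp_plane" by (rule unit_speed_in_plane[OF c(1)])
    have "hyp_dist x (c 1) = 1" using unit_speed_dist[OF c(1), of 0 1] c by simp
    moreover have "hyp_dist (c 1) y = hyp_dist x y - 1"
      using unit_speed_dist[OF c(1), of 1 "hyp_dist x y"] c False by simp
    ultimately have "dual_pseudometric \<mu> x (c 1) \<le> B" "dual_pseudometric \<mu> (c 1) y \<le> B * real n"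
      using B(2)[OF Suc.prems(1) cH] Suc.IH[OF cH] Suc.prems by auto
    then show ?thesis
      using dual_additive[OF Suc.prems(1,2) seg] by (simp add: algebra_simps)
  qed
qed

text \<open>
  Reparametrize the hyperbolic segment from \<open>x\<close> to \<open>y\<close> by \<open>F t = d\<^sub>\<mu> x (b t)\<close>. This function is monotone
  and \<open>d\<^sub>\<mu> (b s) (b t) = F t - F s\<close> for \<open>s \<le> t\<close>, but it may jump; its jumps are bounded by the
  constant \<open>B\<close> of \<open>dual_bounded_on_unit_scale\<close>.
\<close>
lemma roughly_geodesic_dual: "roughly_geodesic hyp_plane (dual_pseudometric \<mu>)"
proof -
  obtain B where B: "B \<ge> 0"
    "\<And>x y. x \<in> hyp_plane \<Longrightarrow> y \<in> hyp_plane \<Longrightarrow> hyp_dist x y \<le> 1 \<Longrightarrow> dual_pseudometric \<mu> x y \<le> B"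
    using dual_bounded_on_unit_scale by metis
  have "\<exists>L\<ge>0. \<exists>c. c ` {0..L} \<subseteq> hyp_plane \<and> c 0 = x \<and> c L = y \<and>
      (\<forall>s\<in>{0..L}. \<forall>t\<in>{0..L}. \<bar>dual_pseudometric \<mu> (c s) (c t) - \<bar>s - t\<bar>\<bar> \<le> 2 * B + 2)"
    if x: "x \<in> hyp_plane" and y: "y \<in> hyp_plane" for x y
  proof (cases "x = y")
    case True
    then show ?thesis using x B(1) by (intro exI[of _ 0] conjI exI[of _ "\<lambda>_. x"]) (auto simp: dual_self)
  next
    case False
    then obtain b where b: "b \<in> unit_speed_geodesics" "b 0 = x" "b (hyp_dist x y) = y"
      using geodesic_through x y by metis
    define l where "l = hyp_dist x y"
    have l: "l \<ge> 0" "b l = y" using hyp_dist_nonneg[OF x y] b by (simp_all add: l_def)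
    have bH: "b t \<in> hyp_plane" for t by (rule unit_speed_in_plane[OF b(1)])
    define F where "F t = dual_pseudometric \<mu> x (b t)" for t
    have F0: "F 0 = 0" using x b by (simp add: F_def dual_self)
    have Fdiff: "dual_pseudometric \<mu> (b s) (b t) = F t - F s" if "0 \<le> s" "s \<le> t" for s t
      using dual_additive[OF bH[of 0] bH[of t], of "b s"] segment_of_geodesic[OF b(1), of 0 t] that b
      by (simp add: F_def)
    have Fabs: "dual_pseudometric \<mu> (b s) (b t) = \<bar>F t - F s\<bar>" if "0 \<le> s" "0 \<le> t" for s t
      using Fdiff[of s t] Fdiff[of t s] that dual_nonneg[of "b s" "b t"] dual_nonneg[of "b t" "b s"]
        dual_commute[of "b s" "b t"] by (cases "s \<le> t") auto
    have near: "\<exists>t. 0 \<le> t \<and> t \<le> l \<and> \<bar>F t - u\<bar> \<le> B" if u: "0 \<le> u" "u \<le> F l" for u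
    proof -
      define S where "S = {t. 0 \<le> t \<and> t \<le> l \<and> F t \<le> u}"
      have "0 \<in> S" using l u F0 by (simp add: S_def)
      have bdd: "bdd_above S" by (rule bdd_aboveI[of _ l]) (auto simp: S_def)
      \<comment> \<open>At t the value of F is at most u, and one unit of time later, or at l, it is at least u.\<close>
      obtain t where t: "t \<in> S" "Sup S - 1/2 < t"
        using less_cSup_iff[of S "Sup S - 1/2"] \<open>0 \<in> S\<close> bdd by auto
      define t' where "t' = min (t + 1) l"
      have tt: "0 \<le> t" "t \<le> t'" "t' \<le> l" "t' - t \<le> 1" using t(1) by (auto simp: S_def t'_def)
      have "u \<le> F t'"
      proof (cases "t' = l")
        case False
        then have "t' = t + 1" by (simp add: t'_def min_def split: if_splits)
        have "t' \<notin> S"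
        proof
          assume "t' \<in> S"
          then have "t' \<le> Sup S" using bdd by (rule cSup_upper)
          then show False using t(2) \<open>t' = t + 1\<close> by simp
        qed
        then show ?thesis using tt by (auto simp: S_def)
      qed (use u in simp)
      moreover have "F t' - F t \<le> B"
        using B(2)[OF bH[of t] bH[of t']] unit_speed_dist[OF b(1), of t t'] tt Fdiff[of t t'] by simp
      moreover have "F t \<le> u" using t(1) by (simp add: S_def)
      ultimately show ?thesis using tt by (intro exI[of _ t]) auto
    qed
    then obtain T where T: "\<And>u. 0 \<le> u \<Longrightarrow> u \<le> F l \<Longrightarrow> 0 \<le> T u \<and> T u \<le> l \<and> \<bar>F (T u) - u\<bar> \<le> B" by metis
    have Fl: "F l \<ge> 0" by (simp add: F_def dual_nonneg)
    \<comment> \<open>The length is F l + 1, as an interval of length F l may be too short: if F l = 0, it is a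
       point, although x and y differ.\<close>
    define \<tau> where "\<tau> u = (if u = 0 then 0 else if u = F l + 1 then l else T (min u (F l)))" for u
    have \<tau>: "0 \<le> \<tau> u \<and> \<bar>F (\<tau> u) - u\<bar> \<le> B + 1" if "0 \<le> u" "u \<le> F l + 1" for u
      using T[of "min u (F l)"] that l F0 Fl B(1) by (auto simp: \<tau>_def min_def split: if_splits)
    show ?thesis
    proof (intro exI[of _ "F l + 1"] conjI exI[of _ "\<lambda>u. b (\<tau> u)"] ballI)
      show "0 \<le> F l + 1" using Fl by simp
      show "(\<lambda>u. b (\<tau> u)) ` {0..F l + 1} \<subseteq> hyp_plane" using bH by auto
      show "b (\<tau> 0) = x" "b (\<tau> (F l + 1)) = y" using b l Fl by (auto simp: \<tau>_def)
      fix s t assume "s \<in> {0..F l + 1}" "t \<in> {0..F l + 1}"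
      then have "0 \<le> \<tau> s" "\<bar>F (\<tau> s) - s\<bar> \<le> B + 1" "0 \<le> \<tau> t" "\<bar>F (\<tau> t) - t\<bar> \<le> B + 1" using \<tau> by auto
      then show "\<bar>dual_pseudometric \<mu> (b (\<tau> s)) (b (\<tau> t)) - \<bar>s - t\<bar>\<bar> \<le> 2 * B + 2"
        unfolding Fabs[OF \<open>0 \<le> \<tau> s\<close> \<open>0 \<le> \<tau> t\<close>] by linarith
    qed
  qed
  moreover have "2 * B + 2 \<ge> 0" using B(1) by simp
  ultimately show ?thesis unfolding roughly_geodesic_def by blast
qed

section \<open>Non-atomic currents\<close>

text \<open>
  Suppose that for each \<open>n\<close> some pair of segments at distance at least \<open>2 n + 10\<close> is met by a set of
  geodesics of measure at least \<open>\<eta>\<close>. These geodesics follow a geodesic \<open>c\<^sub>n\<close> along \<open>[-n, n]\<close>, and after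
  a deck transformation \<open>c\<^sub>n\<close> starts in a fixed compact set, hence subconverges to some \<open>b\<close>. A
  geodesic lying in infinitely many of the sets is at bounded distance from all of \<open>b\<close>, hence it is
  \<open>b\<close>. By the reverse Fatou inequality \<open>b\<close> is an atom.
\<close>
lemma non_atomic_distant_segments:
  assumes na: "non_atomic \<mu>" and \<eta>: "\<eta> > 0"
  obtains T where "T \<ge> 0"
    "\<And>x y z w. x \<in> hyp_plane \<Longrightarrow> y \<in> hyp_plane \<Longrightarrow> z \<in> hyp_plane \<Longrightarrow> w \<in> hyp_plane \<Longrightarrow>
      (\<And>a b. a \<in> hyp_segment x y \<Longrightarrow> b \<in> hyp_segment z w \<Longrightarrow> hyp_dist a b \<ge> 2 * T + 10) \<Longrightarrow>
      measure \<mu> (meeting (hyp_segment x y) \<inter> meeting (hyp_segment z w)) < \<eta>"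
proof (rule ccontr)
  assume no: "\<not> thesis"
  note witness = that
  obtain K where K: "compact K" "K \<subseteq> hyp_plane" "\<And>x. x \<in> hyp_plane \<Longrightarrow> \<exists>g\<in>\<Gamma>. g x \<in> K"
    using act_cocompact by metis
  have "\<exists>c A. c \<in> unit_speed_geodesics \<and> c 0 \<in> K \<and> A \<in> sets \<mu> \<and> \<eta> \<le> measure \<mu> A \<and> A \<subseteq> geodesics \<and>
      (\<forall>\<delta>\<in>A. \<forall>t. \<bar>t\<bar> \<le> real n \<longrightarrow> (\<exists>v\<in>\<delta>. hyp_dist (c t) v \<le> 4))" for n :: nat
  proof -
    obtain x y z w where H: "x \<in> hyp_plane" "y \<in> hyp_plane" "z \<in> hyp_plane" "w \<in> hyp_plane"
      and far: "\<And>a b. a \<in> hyp_segment x y \<Longrightarrow> b \<in> hyp_segment z w \<Longrightarrow> hyp_dist a b \<ge> 2 * real n + 10"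
      and big: "\<not> measure \<mu> (meeting (hyp_segment x y) \<inter> meeting (hyp_segment z w)) < \<eta>"
      using no witness[of "real n"] by (metis of_nat_0_le_iff)
    define C where "C = meeting (hyp_segment x y) \<inter> meeting (hyp_segment z w)"
    have Cs: "C \<in> sets \<mu>" using meeting_segment_sets H by (auto simp: C_def)
    obtain c where c: "c \<in> unit_speed_geodesics"
      "\<And>\<delta> t. \<delta> \<in> C \<Longrightarrow> \<bar>t\<bar> \<le> real n \<Longrightarrow> \<exists>v\<in>\<delta>. hyp_dist (c t) v \<le> 4"
      using geodesics_between_distant_segments[OF H, of "real n"] far unfolding C_def by (metis of_nat_0_le_iff)
    have cH: "c t \<in> hyp_plane" for t by (rule unit_speed_in_plane[OF c(1)])
    obtain g where g: "g \<in> \<Gamma>" "g (c 0) \<in> K" using K(3)[OF cH] by blast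
    have meas: "measure \<mu> ((`) g ` C) = measure \<mu> C"
      using emeasure_act[OF g(1) Cs] by (simp add: measure_def)
    then have ge: "\<eta> \<le> measure \<mu> ((`) g ` C)" using big by (simp add: C_def)
    moreover have "(`) g ` C \<in> sets \<mu>" by (rule act_sets[OF g(1) Cs])
    moreover have "(`) g ` C \<subseteq> geodesics" using act_geodesics[OF g(1)] by (auto simp: C_def meeting_def)
    moreover have "\<exists>v\<in>\<delta>. hyp_dist (g (c t)) v \<le> 4" if \<delta>: "\<delta> \<in> (`) g ` C" and t: "\<bar>t\<bar> \<le> real n" for \<delta> t
    proof -
      obtain \<gamma> where \<gamma>: "\<gamma> \<in> C" "\<delta> = g ` \<gamma>" using \<delta> by blast
      obtain v where v: "v \<in> \<gamma>" "hyp_dist (c t) v \<le> 4" using c(2)[OF \<gamma>(1) t] by blast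
      have "v \<in> hyp_plane" using \<gamma>(1) v(1) geodesic_in_plane by (auto simp: C_def meeting_def)
      then have "hyp_dist (g (c t)) (g v) \<le> 4" using act_dist[OF g(1) cH[of t]] v(2) by simp
      then show ?thesis using v(1) \<gamma>(2) by (intro bexI[of _ "g v"]) auto
    qed
    ultimately show ?thesis
      using act_unit_speed[OF g(1) c(1)] g(2)
      by (intro exI[of _ "\<lambda>t. g (c t)"] exI[of _ "(`) g ` C"]) blast
  qed
  then obtain c A where c: "\<And>n. c n \<in> unit_speed_geodesics" "\<And>n. c n 0 \<in> K"
    and A: "\<And>n. A n \<in> sets \<mu>" "\<And>n. \<eta> \<le> measure \<mu> (A n)" "\<And>n. A n \<subseteq> geodesics"
    and track: "\<And>n \<delta> t. \<delta> \<in> A n \<Longrightarrow> \<bar>t\<bar> \<le> real n \<Longrightarrow> \<exists>v\<in>\<delta>. hyp_dist (c n t) v \<le> 4" by metis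
  obtain b r where b: "b \<in> unit_speed_geodesics" "strict_mono r" "\<And>t. (\<lambda>n. c (r n) t) \<longlonglongrightarrow> b t"
    using geodesics_convergent_subsequence[of K c, OF K(1,2) c] by blast
  obtain W where W: "W \<in> sets \<mu>" "emeasure \<mu> W < \<infinity>"
    "\<And>\<gamma> p v. \<gamma> \<in> geodesics \<Longrightarrow> p \<in> K \<Longrightarrow> v \<in> \<gamma> \<Longrightarrow> hyp_dist p v \<le> 4 \<Longrightarrow> \<gamma> \<in> W"
    using finite_measure_near_compact[OF K(1,2)] by metis
  have AW: "A n \<subseteq> W" for n
  proof
    fix \<delta> assume \<delta>: "\<delta> \<in> A n"
    then show "\<delta> \<in> W" using track[OF \<delta>, of 0] W(3) A(3) c(2) by fastforce
  qed
  have "\<eta> \<le> measure \<mu> (\<Inter>n. \<Union>k\<in>{n..}. A (r k))"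
    using A AW W(1,2) by (intro measure_limsup_ge) auto
  moreover have "(\<Inter>n. \<Union>k\<in>{n..}. A (r k)) \<subseteq> {range b}"
  proof
    fix \<delta> assume \<delta>: "\<delta> \<in> (\<Inter>n. \<Union>k\<in>{n..}. A (r k))"
    then have dg: "\<delta> \<in> geodesics" using A(3) by blast
    have near: "\<exists>v\<in>\<delta>. hyp_dist (b t) v \<le> 5" for t
    proof -
      have bH: "b t \<in> hyp_plane" by (rule unit_speed_in_plane[OF b(1)])
      have "(\<lambda>n. hyp_dist (b t) (c (r n) t)) \<longlonglongrightarrow> 0"
        by (rule hyp_dist_tendsto[OF b(3) unit_speed_in_plane[OF c(1)] bH])
      then have "\<forall>\<^sub>F n in sequentially. hyp_dist (b t) (c (r n) t) < 1" by (rule order_tendstoD) simp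
      then obtain N where N: "\<And>n. n \<ge> N \<Longrightarrow> hyp_dist (b t) (c (r n) t) < 1" by (auto simp: eventually_sequentially)
      obtain k where k: "k \<ge> max N (nat \<lceil>\<bar>t\<bar>\<rceil>)" "\<delta> \<in> A (r k)" using \<delta> by blast
      have "\<bar>t\<bar> \<le> real k" using k(1) by linarith
      also have "\<dots> \<le> real (r k)" using strict_mono_imp_increasing[OF b(2)] by simp
      finally obtain v where v: "v \<in> \<delta>" "hyp_dist (c (r k) t) v \<le> 4" using track[OF k(2)] by blast
      have "hyp_dist (b t) v \<le> hyp_dist (b t) (c (r k) t) + hyp_dist (c (r k) t) v"
        by (rule hyp_dist_triangle[OF bH unit_speed_in_plane[OF c(1)] geodesic_in_plane[OF dg v(1)]])
      then show ?thesis using v N[of k] k(1) by (intro bexI[of _ v]) auto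
    qed
    obtain c' where c': "c' \<in> unit_speed_geodesics" "\<delta> = range c'" using geodesics_obtain[OF dg] .
    have "range b = range c'"
      by (rule geodesic_eq_if_bounded[OF b(1) c'(1), of 5]) (use near c'(2) in auto)
    then show "\<delta> \<in> {range b}" using c' by simp
  qed
  ultimately have "\<eta> \<le> measure \<mu> {range b}"
    using measure_mono_fmeasurable[of "\<Inter>n. \<Union>k\<in>{n..}. A (r k)" "{range b}" \<mu>] A(1)
      singleton_sets[OF range_in_geodesics[OF b(1)]] na range_in_geodesics[OF b(1)]
    by (force simp: fmeasurable_def non_atomic_def)
  moreover have "measure \<mu> {range b} = 0"
    using na range_in_geodesics[OF b(1)] by (simp add: non_atomic_def measure_def)
  ultimately show False using \<eta> by simp
qed

lemma non_atomic_imp_strongly_bolic: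
  assumes na: "non_atomic \<mu>"
  shows "strongly_bolic hyp_plane (dual_pseudometric \<mu>)"
  unfolding strongly_bolic_def
proof (intro conjI pseudometric_dual roughly_geodesic_dual allI impI)
  fix \<eta> :: real assume \<eta>: "\<eta> > 0"
  let ?d = "dual_pseudometric \<mu>"
  obtain T where T: "T \<ge> 0"
    "\<And>x y z w. x \<in> hyp_plane \<Longrightarrow> y \<in> hyp_plane \<Longrightarrow> z \<in> hyp_plane \<Longrightarrow> w \<in> hyp_plane \<Longrightarrow>
      (\<And>a b. a \<in> hyp_segment x y \<Longrightarrow> b \<in> hyp_segment z w \<Longrightarrow> hyp_dist a b \<ge> 2 * T + 10) \<Longrightarrow>
      measure \<mu> (meeting (hyp_segment x y) \<inter> meeting (hyp_segment z w)) < \<eta> / 2"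
    using non_atomic_distant_segments[OF na, of "\<eta> / 2"] \<eta> by (metis half_gt_zero)
  obtain B where B: "B \<ge> 0"
    "\<And>x y. x \<in> hyp_plane \<Longrightarrow> y \<in> hyp_plane \<Longrightarrow> hyp_dist x y \<le> 1 \<Longrightarrow> ?d x y \<le> B"
    using dual_bounded_on_unit_scale by metis
  define n where "n = nat \<lceil>2 * T + 10\<rceil>"
  show "\<exists>R>0. \<forall>x\<in>hyp_plane. \<forall>y\<in>hyp_plane. \<forall>z\<in>hyp_plane. \<forall>w\<in>hyp_plane.
      ?d x z + ?d y w - ?d x y - ?d z w > R \<longrightarrow> \<bar>?d x z + ?d y w - ?d x w - ?d y z\<bar> < \<eta>"
  proof (intro exI[of _ "2 * (B * real n) + 1"] conjI ballI impI)
    show "0 < 2 * (B * real n) + 1" using B(1) by (simp add: add_nonneg_pos)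
    fix x y z w assume H: "x \<in> hyp_plane" "y \<in> hyp_plane" "z \<in> hyp_plane" "w \<in> hyp_plane"
      and R: "2 * (B * real n) + 1 < ?d x z + ?d y w - ?d x y - ?d z w"
    have "hyp_dist a b \<ge> 2 * T + 10" if a: "a \<in> hyp_segment x y" and b: "b \<in> hyp_segment z w" for a b
    proof (rule ccontr)
      assume "\<not> ?thesis"
      then have near: "hyp_dist a b \<le> real n" unfolding n_def by linarith
      have aH: "a \<in> hyp_plane" and bH: "b \<in> hyp_plane" using a b hyp_segment_in_plane by auto
      have ab: "?d a b \<le> B * real n" by (rule dual_linear_bound[OF B aH bH near])
      have "?d x z \<le> ?d x a + ?d a z" "?d a z \<le> ?d a b + ?d b z" "?d y w \<le> ?d y a + ?d a w" "?d a w \<le> ?d a b + ?d b w"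
        using dual_triangle H aH bH by auto
      moreover have "?d x y = ?d x a + ?d y a" "?d z w = ?d b z + ?d b w"
        using dual_additive[OF H(1,2) a] dual_additive[OF H(3,4) b] dual_commute[of a y] dual_commute[of z b] by auto
      ultimately show False using R ab by linarith
    qed
    then have "measure \<mu> (meeting (hyp_segment x y) \<inter> meeting (hyp_segment z w)) < \<eta> / 2"
      by (intro T(2) H)
    then show "\<bar>?d x z + ?d y w - ?d x w - ?d y z\<bar> < \<eta>"
      using dual_four_points_le[OF H] by linarith
  qed
qed

section \<open>Currents with an atom\<close>

lemma singleton_finite:
  assumes "\<gamma> \<in> geodesics" shows "emeasure \<mu> {\<gamma>} < \<infinity>"
proof -
  obtain c where c: "c \<in> unit_speed_geodesics" "\<gamma> = range c" using geodesics_obtain[OF assms] .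
  have H: "c 0 \<in> hyp_plane" by (rule unit_speed_in_plane[OF c(1)])
  then have "{\<gamma>} \<subseteq> meeting (hyp_segment (c 0) (c 0))"
    using c assms by (auto simp: meeting_def hyp_segment_self)
  then show ?thesis by (rule finite_subset_of_meeting[OF H H])
qed

lemma geodesics_exhaustion:
  obtains W :: "nat \<Rightarrow> complex set set" where "\<And>n. W n \<in> sets \<mu>" "\<And>n. emeasure \<mu> (W n) < \<infinity>" "geodesics = (\<Union>n. W n)"
proof -
  have iH: "\<i> \<in> hyp_plane" by (simp add: hyp_plane_def)
  have "\<exists>W. W \<in> sets \<mu> \<and> emeasure \<mu> W < \<infinity> \<and> (\<forall>\<gamma>\<in>geodesics. \<forall>v\<in>\<gamma>. hyp_dist \<i> v \<le> real n \<longrightarrow> \<gamma> \<in> W)" for n :: nat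
  proof -
    have K: "compact {\<i>}" "{\<i>} \<subseteq> hyp_plane" using iH by auto
    obtain W where "W \<in> sets \<mu>" "emeasure \<mu> W < \<infinity>"
      "\<And>\<gamma> p v. \<gamma> \<in> geodesics \<Longrightarrow> p \<in> {\<i>} \<Longrightarrow> v \<in> \<gamma> \<Longrightarrow> hyp_dist p v \<le> real n \<Longrightarrow> \<gamma> \<in> W"
      using finite_measure_near_compact[OF K] by blast
    then show ?thesis by blast
  qed
  then obtain W where W: "\<And>n. W n \<in> sets \<mu>" "\<And>n. emeasure \<mu> (W n) < \<infinity>"
    "\<And>n \<gamma> v. \<gamma> \<in> geodesics \<Longrightarrow> v \<in> \<gamma> \<Longrightarrow> hyp_dist \<i> v \<le> real n \<Longrightarrow> \<gamma> \<in> W n" by metis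
  have "\<gamma> \<in> (\<Union>n. W n)" if \<gamma>: "\<gamma> \<in> geodesics" for \<gamma>
  proof -
    obtain v where v: "v \<in> \<gamma>" using \<gamma> by (auto simp: geodesics_def)
    obtain n :: nat where "hyp_dist \<i> v \<le> real n" using real_arch_simple by blast
    then show ?thesis using W(3)[OF \<gamma> v] by blast
  qed
  moreover have "W n \<subseteq> geodesics" for n using sets.sets_into_space[OF W(1)] by (simp add: space_current)
  ultimately have "geodesics = (\<Union>n. W n)" by blast
  then show thesis using that W by blast
qed

text \<open>
  More than \<open>\<mu> W / m\<close> atoms of mass \<open>m\<close> do not fit into \<open>W\<close>.
\<close>
lemma finite_equal_atoms:
  assumes W: "W \<in> sets \<mu>" "emeasure \<mu> W < \<infinity>" and m: "m > 0"
  shows "finite {\<delta> \<in> W. emeasure \<mu> {\<delta>} = ennreal m}" (is "finite ?F")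
proof (rule ccontr)
  assume inf: "infinite ?F"
  obtain N :: nat where N: "measure \<mu> W / m < real N" using reals_Archimedean2 by blast
  obtain S where S: "S \<subseteq> ?F" "finite S" "card S = N" using infinite_arbitrarily_large[OF inf] by blast
  have SW: "S \<subseteq> W" using S(1) by auto
  have Sg: "\<delta> \<in> geodesics" if "\<delta> \<in> S" for \<delta>
    using that SW sets.sets_into_space[OF W(1)] by (auto simp: space_current)
  have "emeasure \<mu> S = (\<Sum>\<delta>\<in>S. emeasure \<mu> {\<delta>})"
    using S(2) Sg singleton_sets by (intro emeasure_eq_sum_singleton) auto
  also have "\<dots> = (\<Sum>\<delta>\<in>S. ennreal m)" using S(1) by (intro sum.cong) auto
  also have "\<dots> = ennreal (real N * m)" using m by (simp add: S(3) ennreal_mult ennreal_of_nat_eq_real_of_nat)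
  finally have "ennreal (real N * m) \<le> emeasure \<mu> W" using emeasure_mono[OF SW W(1)] by simp
  also have "\<dots> = ennreal (measure \<mu> W)" using W(2) by (simp add: emeasure_eq_ennreal_measure less_top)
  finally have "real N * m \<le> measure \<mu> W" by (simp add: ennreal_le_iff)
  then show False using N m by (simp add: pos_divide_less_eq)
qed

text \<open>
  Points of \<open>\<gamma>\<close> at pairwise distance larger than the diameter of a compact fundamental set \<open>K\<close>
  are moved into \<open>K\<close> by different deck transformations. They take \<open>\<gamma>\<close> to atoms of equal mass that
  meet \<open>K\<close>, of which there are finitely many; so two of them take \<open>\<gamma>\<close> to the same geodesic, and they
  differ by a nontrivial element that preserves \<open>\<gamma>\<close>. It has no fixed point, hence it acts on \<open>\<gamma>\<close> by
  a translation and not by a reflection.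
\<close>
lemma atom_translation:
  assumes c: "c \<in> unit_speed_geodesics" and atom: "emeasure \<mu> {range c} \<noteq> 0"
  obtains h l where "h \<in> \<Gamma>" "l > 0" "\<And>t. h (c t) = c (t + l)"
proof -
  define \<gamma> where "\<gamma> = range c"
  have \<gamma>: "\<gamma> \<in> geodesics" using range_in_geodesics[OF c] by (simp add: \<gamma>_def)
  have cH: "c t \<in> hyp_plane" for t by (rule unit_speed_in_plane[OF c])
  define m where "m = measure \<mu> {\<gamma>}"
  have em: "emeasure \<mu> {\<gamma>} = ennreal m"
    using singleton_finite[OF \<gamma>] by (simp add: m_def emeasure_eq_ennreal_measure less_top)
  have m: "m > 0" using atom em by (simp add: \<gamma>_def[symmetric] m_def zero_less_measure_iff)
  obtain K where K: "compact K" "K \<subseteq> hyp_plane" "\<And>x. x \<in> hyp_plane \<Longrightarrow> \<exists>g\<in>\<Gamma>. g x \<in> K"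
    using act_cocompact by metis
  have "continuous_on (K \<times> K) (\<lambda>p. hyp_dist (fst p) (snd p))"
    by (rule continuous_on_subset[OF continuous_on_hyp_dist]) (use K(2) in auto)
  then have "compact ((\<lambda>p. hyp_dist (fst p) (snd p)) ` (K \<times> K))"
    using compact_continuous_image compact_Times[OF K(1) K(1)] by blast
  then obtain D where D: "\<And>p q. p \<in> K \<Longrightarrow> q \<in> K \<Longrightarrow> \<bar>hyp_dist p q\<bar> \<le> D"
    using compact_imp_bounded by (force simp: bounded_iff)
  obtain W where W: "W \<in> sets \<mu>" "emeasure \<mu> W < \<infinity>"
    "\<And>\<gamma> p v. \<gamma> \<in> geodesics \<Longrightarrow> p \<in> K \<Longrightarrow> v \<in> \<gamma> \<Longrightarrow> hyp_dist p v \<le> 0 \<Longrightarrow> \<gamma> \<in> W"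
    using finite_measure_near_compact[OF K(1,2)] by metis
  define s where "s n = real n * (\<bar>D\<bar> + 1)" for n
  have "\<forall>n. \<exists>g\<in>\<Gamma>. g (c (s n)) \<in> K" using K(3) cH by blast
  then obtain f where f: "\<And>n. f n \<in> \<Gamma>" "\<And>n. f n (c (s n)) \<in> K" by metis
  have "f n ` \<gamma> \<in> {\<delta> \<in> W. emeasure \<mu> {\<delta>} = ennreal m}" for n
  proof -
    have "f n ` \<gamma> \<in> W"
      by (rule W(3)[OF act_geodesics[OF f(1) \<gamma>] f(2)[of n], of "f n (c (s n))"])
        (auto simp: \<gamma>_def hyp_dist_self[OF act_in_plane[OF f(1) cH]])
    moreover have "emeasure \<mu> {f n ` \<gamma>} = ennreal m"
      using emeasure_act[OF f(1) singleton_sets[OF \<gamma>]] em by simp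
    ultimately show ?thesis by simp
  qed
  then have "finite (range (\<lambda>n. f n ` \<gamma>))"
    using finite_equal_atoms[OF W(1,2) m] by (rule_tac finite_subset) auto
  then have "\<not> inj (\<lambda>n. f n ` \<gamma>)" using finite_imageD infinite_UNIV_nat by blast
  then obtain n k where nk: "n \<noteq> k" "f n ` \<gamma> = f k ` \<gamma>" by (auto simp: inj_def)
  obtain g where g: "g \<in> \<Gamma>" "\<And>z. z \<in> hyp_plane \<Longrightarrow> g (f n z) = z" "\<And>z. z \<in> hyp_plane \<Longrightarrow> f n (g z) = z"
    using act_inverse[OF f(1)] by blast
  obtain h where h: "h \<in> \<Gamma>" "\<And>z. z \<in> hyp_plane \<Longrightarrow> h z = g (f k z)" using act_compose[OF g(1) f(1)] by blast
  have no_fix: "h z \<noteq> z" if z: "z \<in> hyp_plane" for z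
  proof
    assume "h z = z"
    then have "h (c (s k)) = c (s k)" using act_free[OF h(1) z _ cH] by simp
    then have "f n (c (s k)) = f k (c (s k))" using h(2)[OF cH] g(3)[OF act_in_plane[OF f(1) cH]] by metis
    then have "hyp_dist (f n (c (s n))) (f n (c (s k))) \<le> D" using D f(2) by (metis abs_le_D1)
    then have "\<bar>s n - s k\<bar> \<le> D" using act_dist[OF f(1) cH cH] unit_speed_dist[OF c] by simp
    moreover have "\<bar>s n - s k\<bar> = \<bar>real n - real k\<bar> * (\<bar>D\<bar> + 1)"
      by (simp add: s_def flip: left_diff_distrib abs_mult) (simp add: abs_mult)
    moreover have "\<bar>real n - real k\<bar> \<ge> 1" using nk(1) by linarith
    then have "\<bar>real n - real k\<bar> * (\<bar>D\<bar> + 1) \<ge> 1 * (\<bar>D\<bar> + 1)" by (intro mult_right_mono) auto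
    ultimately have "1 * (\<bar>D\<bar> + 1) \<le> D" by (metis order_trans)
    then have "\<bar>D\<bar> + 1 \<le> \<bar>D\<bar>" using abs_ge_self[of D] by (metis mult_1 order_trans)
    then show False by simp
  qed
  have "h ` \<gamma> = \<gamma>"
  proof -
    have "h ` \<gamma> = g ` (f k ` \<gamma>)" using h(2) geodesic_in_plane[OF \<gamma>] by (simp add: image_image)
    also have "\<dots> = g ` (f n ` \<gamma>)" using nk by simp
    also have "\<dots> = \<gamma>" by (rule act_image_inverse) (use g(2) geodesic_in_plane[OF \<gamma>] in auto)
    finally show ?thesis .
  qed
  then have "\<forall>t. \<exists>u. h (c t) = c u" by (auto simp: \<gamma>_def)
  then obtain p where p: "\<And>t. h (c t) = c (p t)" by metis
  have iso: "\<bar>p a - p b\<bar> = \<bar>a - b\<bar>" for a b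
    using act_dist[OF h(1) cH[of a] cH[of b]] unit_speed_dist[OF c] by (simp add: p)
  have pfix: "p t \<noteq> t" for t using no_fix[OF cH[of t]] p by metis
  define l where "l = p 0"
  have l: "l \<noteq> 0" using pfix[of 0] by (simp add: l_def)
  \<comment> \<open>A reflection p t = l - t would fix l / 2.\<close>
  have shift: "p t = t + l" for t
  proof -
    have a: "p t - l = t \<or> p t - l = - t" for t using iso[of t 0] by (auto simp: l_def abs_eq_iff)
    have half: "p (l / 2) = l / 2 + l" using a[of "l / 2"] pfix[of "l / 2"] by auto
    have "p t - p (l / 2) = t - l / 2 \<or> p t - p (l / 2) = - (t - l / 2)" using iso[of t "l / 2"] by (simp only: abs_eq_iff)
    then show ?thesis using a[of t] l half by auto
  qed
  show thesis
  proof (cases "l > 0")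
    case True
    then show ?thesis using that[OF h(1) True] p shift by simp
  next
    case False
    obtain h' where h': "h' \<in> \<Gamma>" "\<And>z. z \<in> hyp_plane \<Longrightarrow> h' (h z) = z" using act_inverse[OF h(1)] by metis
    have "h' (c t) = c (t + (- l))" for t
      using h'(2)[OF cH[of "t - l"]] p[of "t - l"] shift[of "t - l"] by simp
    then show ?thesis using that[OF h'(1), of "- l"] False l by simp
  qed
qed

lemma orbit_countable:
  assumes \<gamma>: "\<gamma> \<in> geodesics" and atom: "emeasure \<mu> {\<gamma>} \<noteq> 0"
  shows "countable ((\<lambda>g. g ` \<gamma>) ` \<Gamma>)"
proof -
  define m where "m = measure \<mu> {\<gamma>}"
  have em: "emeasure \<mu> {\<gamma>} = ennreal m"
    using singleton_finite[OF \<gamma>] by (simp add: m_def emeasure_eq_ennreal_measure less_top)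
  have m: "m > 0" using atom em by (simp add: m_def zero_less_measure_iff)
  obtain W :: "nat \<Rightarrow> complex set set" where W: "\<And>n. W n \<in> sets \<mu>" "\<And>n. emeasure \<mu> (W n) < \<infinity>" "geodesics = (\<Union>n. W n)"
    using geodesics_exhaustion by blast
  have "(\<lambda>g. g ` \<gamma>) ` \<Gamma> \<subseteq> (\<Union>n. {\<delta> \<in> W n. emeasure \<mu> {\<delta>} = ennreal m})"
  proof
    fix \<delta> assume "\<delta> \<in> (\<lambda>g. g ` \<gamma>) ` \<Gamma>"
    then obtain g where g: "g \<in> \<Gamma>" "\<delta> = g ` \<gamma>" by blast
    have "emeasure \<mu> {\<delta>} = ennreal m" using emeasure_act[OF g(1) singleton_sets[OF \<gamma>]] em g(2) by simp
    moreover have "\<delta> \<in> (\<Union>n. W n)" using act_geodesics[OF g(1) \<gamma>] g(2) W(3) by auto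
    ultimately show "\<delta> \<in> (\<Union>n. {\<delta> \<in> W n. emeasure \<mu> {\<delta>} = ennreal m})" by blast
  qed
  moreover have "countable (\<Union>n. {\<delta> \<in> W n. emeasure \<mu> {\<delta>} = ennreal m})"
    using finite_equal_atoms[OF W(1,2) m] by (intro countable_UN) (auto intro: countable_finite)
  ultimately show ?thesis by (rule countable_subset)
qed

lemma transversals_sets:
  assumes "\<gamma> \<in> geodesics" shows "transversals \<gamma> \<in> sets \<mu>"
proof -
  obtain c where c: "c \<in> unit_speed_geodesics" "\<gamma> = range c" using geodesics_obtain[OF assms] .
  show ?thesis
    unfolding c(2) meeting_union_exhausts_transversals[OF c(1) zero_less_one]
    using singleton_sets[OF assms] meeting_segment_sets unit_speed_in_plane[OF c(1)]
    by (intro sets.Diff sets.countable_UN') (auto simp: c(2))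
qed

lemma act_transversals:
  assumes g: "g \<in> \<Gamma>" and \<gamma>: "\<gamma> \<in> geodesics"
  shows "(`) g ` transversals \<gamma> = transversals (g ` \<gamma>)"
proof -
  have eq: "transversals \<delta> = meeting \<delta> - {\<delta>}" for \<delta> by (auto simp: transversals_def meeting_def)
  have "meeting \<gamma> \<subseteq> geodesics" "{\<gamma>} \<subseteq> geodesics" using \<gamma> by (auto simp: meeting_def)
  then have "(`) g ` (meeting \<gamma> - {\<gamma>}) = (`) g ` meeting \<gamma> - (`) g ` {\<gamma>}"
    by (intro inj_on_image_set_diff[OF act_geodesics_inj[OF g]]) auto
  moreover have "(`) g ` meeting \<gamma> = meeting (g ` \<gamma>)"
    by (rule act_meeting[OF g]) (use geodesic_in_plane[OF \<gamma>] in auto)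
  ultimately show ?thesis by (simp add: eq)
qed

text \<open>
  Restricted to the orbit of \<open>\<gamma>\<close>, the measure \<open>\<mu>\<close> is again a geodesic current; local finiteness is
  inherited. If no set of positive measure crossed \<open>\<gamma>\<close>, then, by invariance, none would cross a
  translate of \<open>\<gamma>\<close>, and Fubini would make the intersection form with this current vanish.
\<close>
lemma filling_crosses_atom:
  assumes fill: "filling \<Gamma> \<mu>" and \<gamma>: "\<gamma> \<in> geodesics" and atom: "emeasure \<mu> {\<gamma>} \<noteq> 0"
  shows "emeasure \<mu> (transversals \<gamma>) \<noteq> 0"
proof
  assume null: "emeasure \<mu> (transversals \<gamma>) = 0"
  define Orb where "Orb = (\<lambda>g. g ` \<gamma>) ` \<Gamma>"
  have cnt: "countable Orb" using orbit_countable[OF \<gamma> atom] by (simp add: Orb_def)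
  have Og: "Orb \<subseteq> geodesics" using act_geodesics[OF _ \<gamma>] by (auto simp: Orb_def)
  have Os: "Orb \<in> sets \<mu>"
    using sets.countable[OF _ cnt] singleton_sets Og by blast
  define \<nu> where "\<nu> = density \<mu> (indicator Orb)"
  have \<nu>: "emeasure \<nu> A = emeasure \<mu> (Orb \<inter> A)" if "A \<in> sets \<mu>" for A
    using that Os by (simp add: \<nu>_def emeasure_density flip: indicator_inter_arith)
  have sp: "space \<nu> = geodesics" "sets \<nu> = sets \<mu>" by (simp_all add: \<nu>_def space_current)
  have \<nu>_le: "emeasure \<nu> A \<le> emeasure \<mu> A" if "A \<in> sets \<mu>" for A
    using \<nu>[OF that] emeasure_mono[of "Orb \<inter> A" A \<mu>] that by auto
  have act_orbit: "(`) g ` Orb = Orb" if g: "g \<in> \<Gamma>" for g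
  proof -
    have sub: "(`) g ` Orb \<subseteq> Orb" if g: "g \<in> \<Gamma>" for g
    proof
      fix \<delta> assume "\<delta> \<in> (`) g ` Orb"
      then obtain f where f: "f \<in> \<Gamma>" "\<delta> = g ` (f ` \<gamma>)" by (auto simp: Orb_def)
      obtain k where k: "k \<in> \<Gamma>" "\<And>z. z \<in> hyp_plane \<Longrightarrow> k z = g (f z)" using act_compose[OF g f(1)] by blast
      have "\<delta> = k ` \<gamma>" using f(2) k(2) geodesic_in_plane[OF \<gamma>] by (simp add: image_image)
      then show "\<delta> \<in> Orb" using k(1) by (auto simp: Orb_def)
    qed
    obtain h where h: "h \<in> \<Gamma>" "\<And>z. z \<in> hyp_plane \<Longrightarrow> g (h z) = z" using act_inverse[OF g] by metis
    have "\<delta> \<in> (`) g ` Orb" if "\<delta> \<in> Orb" for \<delta>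
    proof -
      have "g ` (h ` \<delta>) = \<delta>" by (rule act_image_inverse) (use h(2) geodesic_in_plane Og that in auto)
      moreover have "h ` \<delta> \<in> Orb" using sub[OF h(1)] that by blast
      ultimately show ?thesis by (metis image_eqI)
    qed
    then show ?thesis using sub[OF g] by blast
  qed
  have "geodesic_current \<Gamma> \<nu>"
    unfolding geodesic_current_def
  proof (intro conjI ballI)
    show "space \<nu> = geodesics" by (rule sp)
    show "sets \<nu> = sigma_sets geodesics {U. openin geodesic_topology U}"
      using current sp(2) by (simp add: geodesic_current_def)
  next
    fix \<delta> assume "\<delta> \<in> geodesics"
    then obtain U where U: "openin geodesic_topology U" "\<delta> \<in> U" "emeasure \<mu> U < \<infinity>"
      using current unfolding geodesic_current_def by blast
    then show "\<exists>U. openin geodesic_topology U \<and> \<delta> \<in> U \<and> emeasure \<nu> U < \<infinity>"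
      using \<nu>_le[OF openin_in_sets] by (metis le_less_trans)
  next
    fix g A assume g: "g \<in> \<Gamma>" and "A \<in> sets \<nu>"
    then have A: "A \<in> sets \<mu>" "A \<subseteq> geodesics" using sp sets.sets_into_space[of A \<nu>] by auto
    have "(`) g ` (Orb \<inter> A) = Orb \<inter> (`) g ` A"
      using inj_on_image_Int[OF act_geodesics_inj[OF g] Og A(2)] act_orbit[OF g] by simp
    then show "emeasure \<nu> ((`) g ` A) = emeasure \<nu> A"
      using \<nu>[OF A(1)] \<nu>[OF act_sets[OF g A(1)]] emeasure_act[OF g, of "Orb \<inter> A"] Os A(1) by auto
  qed
  moreover have "emeasure \<nu> (space \<nu>) \<noteq> 0"
  proof
    assume "emeasure \<nu> (space \<nu>) = 0"
    then have "emeasure \<mu> Orb = 0"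
      using \<nu>[OF sets.top] sets.sets_into_space[OF Os] sp(1) space_current by (simp add: inf.absorb1)
    moreover have "\<gamma> \<in> Orb"
    proof -
      obtain g where g: "g \<in> \<Gamma>" using act_cocompact hyp_planeI[of \<i>] by (metis imaginary_unit.sel(2) zero_less_one)
      obtain h where h: "h \<in> \<Gamma>" "\<And>z. z \<in> hyp_plane \<Longrightarrow> h (g z) = z" using act_inverse[OF g] by metis
      have "h ` (g ` \<gamma>) = \<gamma>" by (rule act_image_inverse) (use h(2) geodesic_in_plane[OF \<gamma>] in auto)
      moreover have "h ` (g ` \<gamma>) \<in> (`) h ` Orb" using g by (intro imageI) (simp add: Orb_def)
      ultimately show ?thesis using act_orbit[OF h(1)] by simp
    qed
    ultimately show False using atom emeasure_mono[of "{\<gamma>}" Orb \<mu>] Os by simp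
  qed
  ultimately have "intersection_form \<Gamma> \<mu> \<nu> > 0" using fill by (simp add: filling_def)
  then obtain A where A: "A \<in> sets (\<mu> \<Otimes>\<^sub>M \<nu>)" "A \<subseteq> transverse_pairs" "emeasure (\<mu> \<Otimes>\<^sub>M \<nu>) A > 0"
    unfolding intersection_form_def less_SUP_iff by blast
  have "sigma_finite_measure \<nu>"
  proof
    obtain W :: "nat \<Rightarrow> complex set set" where W: "\<And>n. W n \<in> sets \<mu>" "\<And>n. emeasure \<mu> (W n) < \<infinity>" "geodesics = (\<Union>n. W n)"
      using geodesics_exhaustion by blast
    have "emeasure \<nu> (W n) \<noteq> \<infinity>" for n using \<nu>_le[OF W(1)] W(2)[of n] by (metis leD infinity_ennreal_def)
    then show "\<exists>A. countable A \<and> A \<subseteq> sets \<nu> \<and> \<Union> A = space \<nu> \<and> (\<forall>a\<in>A. emeasure \<nu> a \<noteq> \<infinity>)"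
      using W sp by (intro exI[of _ "range W"]) auto
  qed
  then have "emeasure (\<mu> \<Otimes>\<^sub>M \<nu>) A = (\<integral>\<^sup>+ x. \<integral>\<^sup>+ y. indicator A (x, y) \<partial>\<nu> \<partial>\<mu>)"
    using A(1) by (rule sigma_finite_measure.emeasure_pair_measure)
  also have "\<dots> = (\<integral>\<^sup>+ x. 0 \<partial>\<mu>)"
  proof (rule nn_integral_cong_AE)
    have "transversals \<delta> \<in> null_sets \<mu>" if in_orbit: "\<delta> \<in> Orb" for \<delta>
    proof -
      obtain g where g: "g \<in> \<Gamma>" "\<delta> = g ` \<gamma>" using in_orbit by (auto simp: Orb_def)
      have "emeasure \<mu> (transversals \<delta>) = 0"
        using emeasure_act[OF g(1) transversals_sets[OF \<gamma>]] act_transversals[OF g(1) \<gamma>] g(2) null by simp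
      then show ?thesis using transversals_sets Og in_orbit by (auto simp: null_sets_def)
    qed
    then have "(\<Union>\<delta>\<in>Orb. transversals \<delta>) \<in> null_sets \<mu>" by (rule null_sets_UN'[OF cnt])
    then have "AE x in \<mu>. x \<notin> (\<Union>\<delta>\<in>Orb. transversals \<delta>)" by (rule AE_not_in)
    then show "AE x in \<mu>. (\<integral>\<^sup>+ y. indicator A (x, y) \<partial>\<nu>) = 0"
    proof (rule AE_mp, intro AE_I2 impI)
      fix x assume x: "x \<notin> (\<Union>\<delta>\<in>Orb. transversals \<delta>)"
      have "AE y in \<nu>. indicator A (x, y) = (0::ennreal)"
        unfolding \<nu>_def
      proof (subst AE_density)
        show "AE y in \<mu>. 0 < (indicator Orb y :: ennreal) \<longrightarrow> indicator A (x, y) = (0::ennreal)"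
          using x A(2) by (intro AE_I2) (auto simp: indicator_def transverse_pairs_def transversals_def split: if_splits)
      qed (use Os in simp)
      then have "(\<integral>\<^sup>+ y. indicator A (x, y) \<partial>\<nu>) = (\<integral>\<^sup>+ y. 0 \<partial>\<nu>)"
        by (rule nn_integral_cong_AE)
      then show "(\<integral>\<^sup>+ y. indicator A (x, y) \<partial>\<nu>) = 0" by simp
    qed
  qed
  finally show False using A(3) by simp
qed

text \<open>
  A geodesic other than \<open>\<gamma>\<close> misses at least one of the two ends, so each of them is counted with
  weight at least \<open>1/2\<close>.
\<close>
lemma dual_ge_transverse_measure:
  assumes \<gamma>: "\<gamma> \<in> geodesics" and x: "x \<in> \<gamma>" and y: "y \<in> \<gamma>" and "x \<noteq> y"
  shows "measure \<mu> (meeting (hyp_segment x y) - {\<gamma>}) / 2 \<le> dual_pseudometric \<mu> x y"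
proof -
  have H: "x \<in> hyp_plane" "y \<in> hyp_plane" using geodesic_in_plane[OF \<gamma>] x y by auto
  let ?Y = "meeting (hyp_segment x y) - meeting {y}" and ?X = "meeting (hyp_segment x y) - meeting {x}"
  have s: "?X \<in> sets \<mu>" "?Y \<in> sets \<mu>" "meeting (hyp_segment x y) - {\<gamma>} \<in> sets \<mu>"
    using meeting_segment_sets[OF H] meeting_point_sets H singleton_sets[OF \<gamma>] by auto
  have fin: "emeasure \<mu> (?Y \<union> ?X) < \<infinity>" by (rule finite_subset_of_meeting[OF H]) auto
  have "meeting (hyp_segment x y) - {\<gamma>} \<subseteq> ?Y \<union> ?X"
    using geodesics_unique[OF _ \<gamma> \<open>x \<noteq> y\<close> _ _ x y] by (auto simp: meeting_def)
  then have "measure \<mu> (meeting (hyp_segment x y) - {\<gamma>}) \<le> measure \<mu> (?Y \<union> ?X)"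
    using s fin by (intro measure_mono_fmeasurable) (auto simp: fmeasurable_def)
  also have "\<dots> \<le> measure \<mu> ?Y + measure \<mu> ?X" using s by (intro measure_Un_le) auto
  also have "\<dots> = 2 * dual_pseudometric \<mu> x y"
    unfolding dual_pseudometric_def transverse_half_open_segment[OF H]
    using transverse_half_open_segment[OF H(2,1)] by (simp add: hyp_segment_commute[of y x])
  finally show ?thesis by simp
qed

text \<open>
  The translation \<open>h\<close> permutes the pieces \<open>[c (k l), c ((k + 1) l)]\<close>, so the geodesics crossing
  \<open>c\<close> in one piece have the same measure for all pieces. It is not zero, since these
  countably many sets exhaust the geodesics crossing \<open>c\<close>.
\<close>
lemma dual_grows_along_atom:
  assumes fill: "filling \<Gamma> \<mu>" and c: "c \<in> unit_speed_geodesics" and atom: "emeasure \<mu> {range c} \<noteq> 0"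
    and h: "h \<in> \<Gamma>" "l > 0" "\<And>t. h (c t) = c (t + l)"
  obtains \<theta> where "\<theta> > 0" "\<And>n. real n * \<theta> \<le> dual_pseudometric \<mu> (c (- (real n * l))) (c (real n * l))"
proof -
  have cH: "c t \<in> hyp_plane" for t by (rule unit_speed_in_plane[OF c])
  have \<gamma>: "range c \<in> geodesics" by (rule range_in_geodesics[OF c])
  define S where "S k = meeting (hyp_segment (c (of_int k * l)) (c (of_int (k + 1) * l)))" for k :: int
  have Ss: "S k \<in> sets \<mu>" for k unfolding S_def by (rule meeting_segment_sets[OF cH cH])
  have Sf: "emeasure \<mu> (S k) \<noteq> \<infinity>" for k using meeting_segment_finite[OF cH cH] by (simp add: S_def less_top[symmetric])
  have step: "measure \<mu> (S (k + 1)) = measure \<mu> (S k)" for k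
    using measure_meeting_act[OF h(1) cH cH, of "of_int k * l" "of_int (k + 1) * l"]
    by (simp add: S_def h(3) algebra_simps)
  have const: "measure \<mu> (S k) = measure \<mu> (S 0)" for k
  proof (induction k rule: int_induct[of _ 0])
    case (step2 i)
    then show ?case using step[of "i - 1"] by simp
  qed (use step in auto)
  have in_S: "range c \<in> S k" for k
    using \<gamma> ends_in_segment(1)[OF cH] by (force simp: S_def meeting_def)
  have S_minus: "measure \<mu> (S k - {range c}) = measure \<mu> (S 0 - {range c})" for k
  proof -
    have "measure \<mu> (S j - {range c}) = measure \<mu> (S j) - measure \<mu> {range c}" for j
      using Ss Sf singleton_sets[OF \<gamma>] in_S by (intro measure_Diff) auto
    then show ?thesis using const by simp
  qed
  define \<theta> where "\<theta> = measure \<mu> (S 0 - {range c})"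
  have "\<theta> \<noteq> 0"
  proof
    assume "\<theta> = 0"
    then have "measure \<mu> (S k - {range c}) = 0" for k using S_minus by (simp add: \<theta>_def)
    moreover have "emeasure \<mu> (S k - {range c}) \<noteq> \<infinity>" for k
      using Sf[of k] Ss[of k] emeasure_mono[of "S k - {range c}" "S k" \<mu>] by (auto simp: top_unique)
    ultimately have "emeasure \<mu> (S k - {range c}) = 0" for k
      using emeasure_eq_ennreal_measure[of \<mu> "S k - {range c}"] by simp
    then have "S k - {range c} \<in> null_sets \<mu>" for k using Ss singleton_sets[OF \<gamma>] by auto
    then have "(\<Union>k. S k - {range c}) \<in> null_sets \<mu>" by (intro null_sets_UN) auto
    moreover have "(\<Union>k. S k - {range c}) = transversals (range c)"
      unfolding meeting_union_exhausts_transversals[OF c h(2)] S_def by auto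
    ultimately show False using filling_crosses_atom[OF fill \<gamma> atom] by auto
  qed
  then have \<theta>: "\<theta> > 0" by (simp add: \<theta>_def zero_less_measure_iff)
  have piece: "\<theta> / 2 \<le> dual_pseudometric \<mu> (c (of_int k * l)) (c (of_int (k + 1) * l))" for k :: int
  proof -
    have "hyp_dist (c (of_int k * l)) (c (of_int (k + 1) * l)) = l"
      using h(2) by (simp add: unit_speed_dist[OF c] algebra_simps)
    then have "c (of_int k * l) \<noteq> c (of_int (k + 1) * l)" using h(2) hyp_dist_self[OF cH] by auto
    then show ?thesis
      using dual_ge_transverse_measure[OF \<gamma>, of "c (of_int k * l)" "c (of_int (k + 1) * l)"] S_minus[of k]
      by (simp add: S_def \<theta>_def)
  qed
  have add: "dual_pseudometric \<mu> (c r) (c t) = dual_pseudometric \<mu> (c r) (c s) + dual_pseudometric \<mu> (c s) (c t)"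
    if "r \<le> s" "s \<le> t" for r s t
    by (rule dual_additive[OF cH cH]) (use segment_of_geodesic[OF c, of r t] that in auto)
  have "real n * \<theta> \<le> dual_pseudometric \<mu> (c (- (real n * l))) (c (real n * l))" for n
  proof (induction n)
    case 0
    then show ?case by (simp add: dual_nonneg)
  next
    case (Suc n)
    define a where "a = real n * l"
    have al: "0 \<le> a" "- (real (Suc n) * l) = - a - l" "real (Suc n) * l = a + l"
      using h(2) by (auto simp: a_def algebra_simps)
    have "dual_pseudometric \<mu> (c (- a - l)) (c (a + l)) =
        dual_pseudometric \<mu> (c (- a - l)) (c (- a)) + (dual_pseudometric \<mu> (c (- a)) (c a) + dual_pseudometric \<mu> (c a) (c (a + l)))"
      using add[of "- a - l" "- a" "a + l"] add[of "- a" a "a + l"] al(1) h(2) by simp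
    moreover have "\<theta> / 2 \<le> dual_pseudometric \<mu> (c (- a - l)) (c (- a))"
      using piece[of "- int n - 1"] by (simp add: a_def algebra_simps)
    moreover have "\<theta> / 2 \<le> dual_pseudometric \<mu> (c a) (c (a + l))"
      using piece[of "int n"] by (simp add: a_def algebra_simps)
    moreover have "real (Suc n) * \<theta> = real n * \<theta> + \<theta>" by (simp add: algebra_simps)
    ultimately show ?case using Suc.IH unfolding al(2) unfolding al(3) a_def[symmetric] by linarith
  qed
  then show thesis using that \<theta> by blast
qed

text \<open>
  Apply strong bolicity with \<open>\<eta> = m\<close>, the mass of the atom, to the four points at unit distance from
  \<open>c (- n l)\<close> and \<open>c (n l)\<close>. It yields that the geodesics other than \<open>\<gamma>\<close> that meet both segments have
  measure at least \<open>m / 2\<close>, for all large \<open>n\<close>. But such a geodesic is close to \<open>\<gamma>\<close> at times \<open>- n l\<close> and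
  \<open>n l\<close>; none is so for infinitely many \<open>n\<close>, contradicting the reverse Fatou inequality.
\<close>
lemma strongly_bolic_imp_non_atomic:
  assumes fill: "filling \<Gamma> \<mu>" and sb: "strongly_bolic hyp_plane (dual_pseudometric \<mu>)"
  shows "non_atomic \<mu>"
proof (rule ccontr)
  assume "\<not> non_atomic \<mu>"
  then obtain \<gamma> where \<gamma>: "\<gamma> \<in> geodesics" and atom: "emeasure \<mu> {\<gamma>} \<noteq> 0" by (auto simp: non_atomic_def)
  obtain c where c: "c \<in> unit_speed_geodesics" and \<gamma>c: "\<gamma> = range c" using geodesics_obtain[OF \<gamma>] .
  have cH: "c t \<in> hyp_plane" for t by (rule unit_speed_in_plane[OF c])
  let ?d = "dual_pseudometric \<mu>"
  define m where "m = measure \<mu> {\<gamma>}"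
  have m: "m > 0"
    using atom singleton_finite[OF \<gamma>] by (simp add: m_def zero_less_measure_iff emeasure_eq_ennreal_measure less_top)
  obtain h l where h: "h \<in> \<Gamma>" "l > 0" "\<And>t. h (c t) = c (t + l)"
    using atom_translation[OF c] atom \<gamma>c by blast
  obtain \<theta> where \<theta>: "\<theta> > 0" "\<And>n. real n * \<theta> \<le> ?d (c (- (real n * l))) (c (real n * l))"
    using dual_grows_along_atom[OF fill c _ h] atom \<gamma>c by blast
  obtain B where B: "B \<ge> 0"
    "\<And>x y. x \<in> hyp_plane \<Longrightarrow> y \<in> hyp_plane \<Longrightarrow> hyp_dist x y \<le> 1 \<Longrightarrow> ?d x y \<le> B"
    using dual_bounded_on_unit_scale by blast
  obtain R where R: "\<And>x y z w. x \<in> hyp_plane \<Longrightarrow> y \<in> hyp_plane \<Longrightarrow> z \<in> hyp_plane \<Longrightarrow> w \<in> hyp_plane \<Longrightarrow>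
      ?d x z + ?d y w - ?d x y - ?d z w > R \<Longrightarrow> \<bar>?d x z + ?d y w - ?d x w - ?d y z\<bar> < m"
    using sb m unfolding strongly_bolic_def by blast
  \<comment> \<open>Replacing the four points by c (- n l) and c (n l) changes the distances by 8 B in total. The
     second bound makes c (n l) and c (- n l) far enough from c 0 for fellow_travelling with e = 3.\<close>
  obtain N :: nat where N: "(\<bar>R\<bar> + 8 * B) / \<theta> < real N" "8 / l < real N"
  proof -
    obtain n1 n2 :: nat where "(\<bar>R\<bar> + 8 * B) / \<theta> < real n1" "8 / l < real n2" using reals_Archimedean2 by metis
    then show thesis using that[of "max n1 n2"] by (auto simp: of_nat_max)
  qed
  have ex: "\<exists>A. A \<in> sets \<mu> \<and> m / 2 \<le> measure \<mu> A \<and> A \<subseteq> geodesics - {\<gamma>} \<and>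
      (\<forall>\<delta>\<in>A. \<exists>p\<in>\<delta>. \<exists>q\<in>\<delta>. hyp_dist (c (- (real n * l))) p \<le> 3 \<and> hyp_dist (c (real n * l)) q \<le> 3)"
    if n: "n \<ge> N" for n
  proof -
    define a b where "a = c (- (real n * l))" and "b = c (real n * l)"
    have abH: "a \<in> hyp_plane" "b \<in> hyp_plane" using cH by (auto simp: a_def b_def)
    obtain x y where xy: "x \<in> hyp_plane" "hyp_dist x a = 1" "side c x > 0" "y \<in> hyp_plane" "hyp_dist y a = 1" "side c y < 0"
      using points_beside_geodesic[OF c] unfolding a_def by blast
    obtain z w where zw: "z \<in> hyp_plane" "hyp_dist z b = 1" "side c z > 0" "w \<in> hyp_plane" "hyp_dist w b = 1" "side c w < 0"
      using points_beside_geodesic[OF c] unfolding b_def by blast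
    have H: "x \<in> hyp_plane" "y \<in> hyp_plane" "z \<in> hyp_plane" "w \<in> hyp_plane" using xy zw by auto
    have near: "?d x a \<le> B" "?d y a \<le> B" "?d z b \<le> B" "?d w b \<le> B"
      using B(2) xy zw abH by auto
    have far: "real n * \<theta> \<le> ?d a b" using \<theta>(2) by (simp add: a_def b_def)
    have tri: "?d a b \<le> ?d x a + ?d x z + ?d z b" "?d a b \<le> ?d y a + ?d y w + ?d w b"
        "?d x y \<le> ?d x a + ?d y a" "?d z w \<le> ?d z b + ?d w b"
      using dual_triangle[OF abH(1) H(1) abH(2)] dual_triangle[OF H(1,3) abH(2)]
        dual_triangle[OF abH(1) H(2) abH(2)] dual_triangle[OF H(2,4) abH(2)]
        dual_triangle[OF H(1) abH(1) H(2)] dual_triangle[OF H(3) abH(2) H(4)]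
        dual_commute[of a x] dual_commute[of a y] dual_commute[of b w] by auto
    have "\<bar>R\<bar> + 8 * B < real N * \<theta>" using N(1) \<theta>(1) by (simp add: pos_divide_less_eq)
    also have "\<dots> \<le> real n * \<theta>" using n \<theta>(1) by (intro mult_right_mono) auto
    finally have large: "\<bar>R\<bar> + 8 * B < real n * \<theta>" .
    have "?d x z + ?d y w - ?d x y - ?d z w > R"
      using near far tri large B(1) abs_ge_self[of R] abs_ge_zero[of R] by linarith
    then have small: "\<bar>?d x z + ?d y w - ?d x w - ?d y z\<bar> < m" using R H by blast
    define C where "C = meeting (hyp_segment x y) \<inter> meeting (hyp_segment z w)"
    define A where "A = C - {\<gamma>}"
    have Cs: "C \<in> sets \<mu>" using meeting_segment_sets H by (auto simp: C_def)
    have As: "A \<in> sets \<mu>" using Cs singleton_sets[OF \<gamma>] by (auto simp: A_def)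
    have Af: "emeasure \<mu> A < \<infinity>" by (rule finite_subset_of_meeting[OF H(1,2)]) (auto simp: A_def C_def)
    have iA: "integrable \<mu> (indicator A :: _ \<Rightarrow> real)" by (rule integrable_real_indicator[OF As Af])
    have i\<gamma>: "integrable \<mu> (indicator {\<gamma>} :: _ \<Rightarrow> real)"
      by (rule integrable_real_indicator[OF singleton_sets[OF \<gamma>] singleton_finite[OF \<gamma>]])
    let ?E = "\<lambda>\<delta>. crossing x z \<delta> + crossing y w \<delta> - crossing x w \<delta> - crossing y z \<delta>"
    have "(\<integral>\<delta>. ?E \<delta> \<partial>\<mu>) \<le> (\<integral>\<delta>. 2 * indicator A \<delta> - 2 * indicator {\<gamma>} \<delta> \<partial>\<mu>)"
    proof (rule integral_mono[OF dual_four_points(1)[OF H]])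
      show "integrable \<mu> (\<lambda>\<delta>. 2 * indicator A \<delta> - 2 * indicator {\<gamma>} \<delta> :: real)" using iA i\<gamma> by simp
      fix \<delta> assume "\<delta> \<in> space \<mu>"
      then have dg: "\<delta> \<in> geodesics" by (simp add: space_current)
      show "?E \<delta> \<le> 2 * indicator A \<delta> - 2 * indicator {\<gamma>} \<delta>"
      proof (cases "\<delta> = \<gamma>")
        case True
        then show ?thesis using crossing_four_points_separated[OF c H xy(3,6) zw(3,6)] by (simp add: A_def \<gamma>c)
      next
        case False
        then have "indicator A \<delta> = (indicator C \<delta> :: real)" by (simp add: A_def indicator_def)
        then show ?thesis using False crossing_four_points[OF dg H] by (simp add: C_def)
      qed
    qed
    also have "\<dots> = 2 * measure \<mu> A - 2 * m"
      using iA i\<gamma> sets.sets_into_space[OF As] sets.sets_into_space[OF singleton_sets[OF \<gamma>]]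
      by (simp add: m_def inf.absorb1)
    finally have "m / 2 \<le> measure \<mu> A" using small unfolding dual_four_points(2)[OF H] by linarith
    moreover have "A \<subseteq> geodesics - {\<gamma>}" by (auto simp: A_def C_def meeting_def)
    moreover have "\<exists>p\<in>\<delta>. \<exists>q\<in>\<delta>. hyp_dist a p \<le> 3 \<and> hyp_dist b q \<le> 3" if "\<delta> \<in> A" for \<delta>
    proof -
      have close: "hyp_dist e v \<le> 3"
        if "u \<in> hyp_plane" "u' \<in> hyp_plane" "e \<in> hyp_plane" "hyp_dist u e = 1" "hyp_dist u' e = 1" "v \<in> hyp_segment u u'" for u u' e v
      proof -
        have vH: "v \<in> hyp_plane" by (rule hyp_segment_in_plane[OF that(6)])
        have "hyp_dist u v \<le> hyp_dist u u'" using that hyp_dist_nonneg[OF vH that(2)] by (simp add: hyp_segment_def)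
        also have "\<dots> \<le> hyp_dist u e + hyp_dist e u'" by (rule hyp_dist_triangle) (use that in auto)
        finally have "hyp_dist u v \<le> 2" using that by (simp add: hyp_dist_commute)
        moreover have "hyp_dist e v \<le> hyp_dist e u + hyp_dist u v" by (rule hyp_dist_triangle) (use that vH in auto)
        ultimately show ?thesis using that by (simp add: hyp_dist_commute)
      qed
      obtain p q where "p \<in> \<delta>" "p \<in> hyp_segment x y" "q \<in> \<delta>" "q \<in> hyp_segment z w"
        using \<open>\<delta> \<in> A\<close> by (auto simp: A_def C_def meeting_def)
      then show ?thesis
        using close[OF H(1,2) abH(1) xy(2,5)] close[OF H(3,4) abH(2) zw(2,5)] by blast
    qed
    ultimately show ?thesis using As unfolding a_def b_def by blast
  qed
  have "\<forall>n. \<exists>A. A \<in> sets \<mu> \<and> m / 2 \<le> measure \<mu> A \<and> A \<subseteq> geodesics - {\<gamma>} \<and>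
      (\<forall>\<delta>\<in>A. \<exists>p\<in>\<delta>. \<exists>q\<in>\<delta>. hyp_dist (c (- (real (n + N) * l))) p \<le> 3 \<and> hyp_dist (c (real (n + N) * l)) q \<le> 3)"
    by (intro allI ex) simp
  then obtain A where A: "\<And>n. A n \<in> sets \<mu>" "\<And>n. m / 2 \<le> measure \<mu> (A n)" "\<And>n. A n \<subseteq> geodesics - {\<gamma>}"
    and ends: "\<And>n \<delta>. \<delta> \<in> A n \<Longrightarrow>
      \<exists>p\<in>\<delta>. \<exists>q\<in>\<delta>. hyp_dist (c (- (real (n + N) * l))) p \<le> 3 \<and> hyp_dist (c (real (n + N) * l)) q \<le> 3" by metis
  have K: "compact {c 0}" "{c 0} \<subseteq> hyp_plane" using cH by auto
  obtain W where W: "W \<in> sets \<mu>" "emeasure \<mu> W < \<infinity>"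
    "\<And>\<delta> p v. \<delta> \<in> geodesics \<Longrightarrow> p \<in> {c 0} \<Longrightarrow> v \<in> \<delta> \<Longrightarrow> hyp_dist p v \<le> 4 \<Longrightarrow> \<delta> \<in> W"
    using finite_measure_near_compact[OF K] by blast
  have AW: "A n \<subseteq> W" for n
  proof
    fix \<delta> assume \<delta>: "\<delta> \<in> A n"
    then obtain p q where pq: "p \<in> \<delta>" "q \<in> \<delta>" "hyp_dist (c (- (real (n + N) * l))) p \<le> 3" "hyp_dist (c (real (n + N) * l)) q \<le> 3"
      using ends by blast
    have dg: "\<delta> \<in> geodesics" using \<delta> A(3) by blast
    have "8 < real N * l" using N(2) h(2) by (simp add: pos_divide_less_eq)
    also have "\<dots> \<le> real (n + N) * l" using h(2) by (intro mult_right_mono) auto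
    finally have "8 < real (n + N) * l" .
    then obtain v where "v \<in> \<delta>" "hyp_dist (c 0) v \<le> 4"
      using fellow_travelling[OF c dg pq, of 0] by auto
    then show "\<delta> \<in> W" using W(3)[OF dg] by blast
  qed
  have "m / 2 \<le> measure \<mu> (\<Inter>n. \<Union>k\<in>{n..}. A k)"
    by (rule measure_limsup_ge[of A \<mu> W, OF A(1) AW W(1,2) A(2)])
  moreover have "(\<Inter>n. \<Union>k\<in>{n..}. A k) = {}"
  proof (rule ccontr)
    assume "(\<Inter>n. \<Union>k\<in>{n..}. A k) \<noteq> {}"
    then obtain \<delta> where "\<delta> \<in> (\<Inter>n. \<Union>k\<in>{n..}. A k)" by blast
    then have \<delta>: "\<exists>k\<ge>n. \<delta> \<in> A k" for n by auto
    then have dg: "\<delta> \<in> geodesics" and ne: "\<delta> \<noteq> \<gamma>" using A(3) by blast+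
    obtain c' where c': "c' \<in> unit_speed_geodesics" "\<delta> = range c'" using geodesics_obtain[OF dg] .
    have far: "\<exists>u\<ge>T. (\<exists>v\<in>\<delta>. hyp_dist (c u) v \<le> 3) \<and> (\<exists>v\<in>\<delta>. hyp_dist (c (- u)) v \<le> 3)" for T
    proof -
      obtain n :: nat where n: "T / l \<le> real n" using real_arch_simple by blast
      obtain k where k: "k \<ge> n" "\<delta> \<in> A k" using \<delta> by blast
      have "T \<le> real n * l" using n h(2) by (simp add: pos_divide_le_eq)
      also have "\<dots> \<le> real (k + N) * l" using k(1) h(2) by (intro mult_right_mono) auto
      finally show ?thesis using ends[OF k(2)] by blast
    qed
    have "range c = range c'"
    proof (rule geodesic_eq_if_bounded[OF c c'(1), of 3])
      fix T
      show "\<exists>t\<ge>T. \<exists>v\<in>range c'. hyp_dist (c t) v \<le> 3" using far[of T] c'(2) by blast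
      obtain u where "u \<ge> - T" "\<exists>v\<in>\<delta>. hyp_dist (c (- u)) v \<le> 3" using far[of "- T"] by blast
      then show "\<exists>t\<le>T. \<exists>v\<in>range c'. hyp_dist (c t) v \<le> 3" using c'(2) by (intro exI[of _ "- u"]) auto
    qed
    then show False using ne \<gamma>c c'(2) by simp
  qed
  ultimately show False using m by simp
qed

end

theorem theorem4:
  fixes \<Gamma> :: "(complex \<Rightarrow> complex) set" and \<mu> :: "complex set measure"
  assumes "closed_hyperbolic_surface_group \<Gamma>"
    and "geodesic_current \<Gamma> \<mu>"
    and "filling \<Gamma> \<mu>"
  shows "non_atomic \<mu> \<longleftrightarrow> strongly_bolic hyp_plane (dual_pseudometric \<mu>)"
proof -
  interpret surface_current \<Gamma> \<mu> by unfold_locales (use assms in auto)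
  show ?thesis using non_atomic_imp_strongly_bolic strongly_bolic_imp_non_atomic[OF assms(3)] by blast
qed

end
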